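(* Let $k\in\mathbb{N}_0$ and let $M$ be a metric space. Equip the set $F(M)$ of finite nonempty subsets of $M$ and the set $K(M)\supset F(M)$ of nonempty compact subsets of $M$ with the Hausdorff distance $d_H$, and let $\beta_k:F(M)\to\mathcal{B}\subset\hat{\mathcal{B}}_\infty$ be the $k$-th barcode map, where $\hat{\mathcal{B}}_\infty$ is the completion of the barcode space $\mathcal{B}$ with respect to the bottleneck distance $d_\infty$. Then: (1) The map $\beta_k:F(M)\to\hat{\mathcal{B}}_\infty$ is Lipschitz continuous with Lipschitz constant equal to $1$. (2) There is a unique continuous extension $K(M)\to\hat{\mathcal{B}}_\infty$ of $\beta_k:F(M)\to\mathcal{B}\subset\hat{\mathcal{B}}_\infty$. The extended map is also Lipschitz continuous with Lipschitz constant $1$.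
   Context: Homology has coefficients in a fixed field $\mathbf{k}$; reduced homology is $\tilde H_k(X)=\ker(H_k(X)\to H_k(\mathrm{pt}))$. Persistent homology: for a metric space $(M,d)$, a finite nonempty $P\subset M$ and $t\ge 0$, the Čech complex $\check C_t(P)$ is the abstract simplicial complex with vertex set $P$ in which $\{x_0,\dots,x_j\}$ spans a simplex iff $\bigcap_{i}\overline B_t(x_i)\neq\emptyset$, where $\overline B_t(x)=\{y\in M: d(x,y)\le t\}$. The persistence module $\mathrm{PH}_k(P)$ has $\mathrm{PH}_k(P)_t=\tilde H_k(\check C_t(P))$ for $t\ge 0$, with maps induced by inclusions. It is a direct sum of finitely many interval modules (an interval module is $\mathbf{k}$ on an interval and $0$ outside, with identity maps inside), all of finite length; the multiset of these intervals is the barcode of $\mathrm{PH}_k(P)$. Barcode space: $\mathcal{B}$ is the set of finite multisets of pairs $(x,d)\in\mathbb{R}_{\ge0}^2$ (an interval with left endpoint $x$ and length $d$), where two multisets are identified if they agree after deleting pairs with $d=0$. $\beta_k(P)\in\mathcal{B}$ is the multiset of pairs (left endpoint, length) of the intervals in the barcode of $\mathrm{PH}_k(P)$. Bottleneck distance: put $d_\infty((x_1,d_1),(x_2,d_2))=\max(|x_1-x_2|,|(x_1+d_1)-(x_2+d_2)|)$ and $d_\infty((x,d),\Delta)=d/2$. For $b_1=\{I_i\}_{i=1}^n$, $b_2=\{J_j\}_{j=1}^m$, $d_\infty(b_1,b_2)$ is the minimum over all bijections $\theta:A\to B$ with $A\subset\{1,\dots,n\}$, $B\subset\{1,\dots,m\}$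 of $\max\big(\max_{a\in A}d_\infty(I_a,J_{\theta(a)}),\max_{a\notin A}d_\infty(I_a,\Delta),\max_{b\notin B}d_\infty(J_b,\Delta)\big)$. Hausdorff distance: $d_H(A,B)=\max(\inf\{t\ge0: A\subset B_t\},\inf\{t\ge0:B\subset A_t\})$, where $A_t=\{x\in M: d(x,A)\le t\}$. *)

theory Defs
  imports "HOL-Analysis.Analysis" "HOL-Library.Function_Algebras" "HOL-Library.Set_Algebras"
    "HOL-Library.Multiset" "HOL-Combinatorics.Permutations"
begin

section \<open>Simplicial homology of finite complexes over a field\<close>

text \<open>
  An abstract simplicial complex is given by its set of simplices (nonempty finite sets of
  vertices). All complexes considered here are finite; the sums below are only meaningful then.

  Oriented chains: a \<open>k\<close>-chain is a function on the orderings \<open>[x\<^sub>0, \<dots>, x\<^sub>k]\<close> of the \<open>k\<close>-simplices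
  that changes by the sign of a permutation of the vertices. The oriented simplex
  \<open>[x\<^sub>0, \<dots>, x\<^sub>k]\<close> is the chain whose value at the reordering of \<open>[x\<^sub>0, \<dots>, x\<^sub>k]\<close> by \<open>p\<close> is \<open>sign p\<close>,
  and which vanishes on all other lists.
\<close>

definition chains :: "nat \<Rightarrow> 'a set set \<Rightarrow> ('a list \<Rightarrow> 'f::field) set" where
  "chains k K = {c. (\<forall>xs. c xs \<noteq> 0 \<longrightarrow> length xs = Suc k \<and> distinct xs \<and> set xs \<in> K) \<and>
     (\<forall>xs p. p permutes {..<length xs} \<longrightarrow> c (permute_list p xs) = of_int (sign p) * c xs)}"

text \<open>
  In terms of oriented simplices this is the usual
  \<open>\<partial>[x\<^sub>0, \<dots>, x\<^sub>k] = (\<Sum>i. (-1)^i [x\<^sub>0, \<dots>, x\<^sub>i omitted, \<dots>, x\<^sub>k])\<close>: the only vertex \<open>v\<close> contributing to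
  the value at \<open>[x\<^sub>0, \<dots>, x\<^sub>i omitted, \<dots>, x\<^sub>k]\<close> is \<open>x\<^sub>i\<close>, and moving it to the front costs \<open>(-1)^i\<close>.
  The case distinction makes the (unaugmented) boundary of a \<open>0\<close>-chain vanish.
\<close>

definition boundary :: "'a set set \<Rightarrow> ('a list \<Rightarrow> 'f::field) \<Rightarrow> 'a list \<Rightarrow> 'f" where
  "boundary K c = (\<lambda>ys. if ys = [] then 0 else \<Sum>v\<in>\<Union>K. c (v # ys))"

definition cycles :: "nat \<Rightarrow> 'a set set \<Rightarrow> ('a list \<Rightarrow> 'f::field) set" where
  "cycles k K = {z \<in> chains k K. boundary K z = 0}"

definition boundaries :: "nat \<Rightarrow> 'a set set \<Rightarrow> ('a list \<Rightarrow> 'f::field) set" where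
  "boundaries k K = boundary K ` chains (Suc k) K"

text \<open>Homology classes are the cosets of the space of boundaries.\<close>

definition homology :: "nat \<Rightarrow> 'a set set \<Rightarrow> ('a list \<Rightarrow> 'f::field) set set" where
  "homology k K = (\<lambda>z. z +o boundaries k K) ` cycles k K"

text \<open>
  The chain map of a simplicial map \<open>f\<close> sends \<open>[x\<^sub>0, \<dots>, x\<^sub>k]\<close> to \<open>[f x\<^sub>0, \<dots>, f x\<^sub>k]\<close>, or to \<open>0\<close> if \<open>f\<close> is
  not injective on the simplex; in the latter case the contributions below cancel because
  chains are alternating.
\<close>

definition pushforward :: "('a \<Rightarrow> 'b) \<Rightarrow> 'a set set \<Rightarrow> ('a list \<Rightarrow> 'f::field) \<Rightarrow> 'b list \<Rightarrow> 'f" where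
  "pushforward f K c = (\<lambda>ys. \<Sum>xs | distinct xs \<and> set xs \<in> K \<and> map f xs = ys. c xs)"

definition homology_map ::
    "nat \<Rightarrow> ('a \<Rightarrow> 'b) \<Rightarrow> 'a set set \<Rightarrow> 'b set set \<Rightarrow> ('a list \<Rightarrow> 'f::field) set \<Rightarrow> ('b list \<Rightarrow> 'f) set" where
  "homology_map k f K L h = pushforward f K ` h + boundaries k L"

text \<open>The kernel of the map to the homology of the one-point complex, whose zero is the coset
  \<open>boundaries k {{()}}\<close>.\<close>

definition reduced_homology :: "nat \<Rightarrow> 'a set set \<Rightarrow> ('a list \<Rightarrow> 'f::field) set set" where
  "reduced_homology k K =
     {h \<in> homology k K. homology_map k (\<lambda>_. ()) K {{()}} h = boundaries k {{()}}}"


section \<open>Persistence modules\<close>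

record ('f, 'v) vspace =
  vcarrier :: "'v set"
  vadd :: "'v \<Rightarrow> 'v \<Rightarrow> 'v"
  vscale :: "'f \<Rightarrow> 'v \<Rightarrow> 'v"

text \<open>Persistence modules are indexed by \<open>t \<ge> 0\<close>; values at negative indices, and of
  \<open>pshift s t\<close> unless \<open>0 \<le> s \<le> t\<close>, are irrelevant.\<close>

record ('f, 'v) pmodule =
  pspace :: "real \<Rightarrow> ('f, 'v) vspace"
  pshift :: "real \<Rightarrow> real \<Rightarrow> 'v \<Rightarrow> 'v"

definition linear_iso :: "('f, 'v) vspace \<Rightarrow> ('f, 'w) vspace \<Rightarrow> ('v \<Rightarrow> 'w) \<Rightarrow> bool" where
  "linear_iso V W \<phi> \<longleftrightarrow> bij_betw \<phi> (vcarrier V) (vcarrier W) \<and>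
     (\<forall>x\<in>vcarrier V. \<forall>y\<in>vcarrier V. \<phi> (vadd V x y) = vadd W (\<phi> x) (\<phi> y)) \<and>
     (\<forall>a. \<forall>x\<in>vcarrier V. \<phi> (vscale V a x) = vscale W a (\<phi> x))"

definition pmodule_isomorphic :: "('f, 'v) pmodule \<Rightarrow> ('f, 'w) pmodule \<Rightarrow> bool" where
  "pmodule_isomorphic V W \<longleftrightarrow> (\<exists>\<phi>.
     (\<forall>t\<ge>0. linear_iso (pspace V t) (pspace W t) (\<phi> t)) \<and>
     (\<forall>s t. 0 \<le> s \<and> s \<le> t \<longrightarrow>
        (\<forall>x\<in>vcarrier (pspace V s). \<phi> t (pshift V s t x) = pshift W s t (\<phi> s x))))"

definition interval_module :: "real set \<Rightarrow> ('f::field, 'f) pmodule" where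
  "interval_module I =
     \<lparr>pspace = \<lambda>t. \<lparr>vcarrier = (if t \<in> I then UNIV else {0}), vadd = (+), vscale = (*)\<rparr>,
      pshift = \<lambda>s t x. if s \<in> I \<and> t \<in> I then x else 0\<rparr>"

definition direct_sum :: "('f, 'v) pmodule list \<Rightarrow> ('f, nat \<Rightarrow> 'v) pmodule" where
  "direct_sum Vs =
     \<lparr>pspace = \<lambda>t.
        \<lparr>vcarrier = (\<Pi>\<^sub>E i\<in>{..<length Vs}. vcarrier (pspace (Vs ! i) t)),
         vadd = (\<lambda>x y. \<lambda>i\<in>{..<length Vs}. vadd (pspace (Vs ! i) t) (x i) (y i)),
         vscale = (\<lambda>a x. \<lambda>i\<in>{..<length Vs}. vscale (pspace (Vs ! i) t) a (x i))\<rparr>,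
      pshift = \<lambda>s t x. \<lambda>i\<in>{..<length Vs}. pshift (Vs ! i) s t (x i)\<rparr>"

text \<open>Intervals may be open, closed or half-open, and may be single points.\<close>

definition interval_decomposition :: "('f::field, 'v) pmodule \<Rightarrow> real set list \<Rightarrow> bool" where
  "interval_decomposition V Is \<longleftrightarrow>
     (\<forall>I\<in>set Is. I \<noteq> {} \<and> I \<subseteq> {0..} \<and> is_interval I \<and> bounded I) \<and>
     pmodule_isomorphic V (direct_sum (map interval_module Is))"

text \<open>The multiset does not depend on the choice of the decomposition (Krull-Schmidt-Azumaya).\<close>

definition intervals_of :: "('f::field, 'v) pmodule \<Rightarrow> real set multiset" where
  "intervals_of V = mset (SOME Is. interval_decomposition V Is)"


section \<open>Persistent homology of finite sets\<close>

definition cech :: "real \<Rightarrow> 'a::metric_space set \<Rightarrow> 'a set set" where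
  "cech t P = {\<sigma>. \<sigma> \<noteq> {} \<and> \<sigma> \<subseteq> P \<and> (\<Inter>x\<in>\<sigma>. cball x t) \<noteq> {}}"

definition reduced_homology_space ::
    "nat \<Rightarrow> 'a set set \<Rightarrow> ('f::field, ('a list \<Rightarrow> 'f) set) vspace" where
  "reduced_homology_space k K =
     \<lparr>vcarrier = reduced_homology k K,
      vadd = (+),
      vscale = \<lambda>a h. (\<lambda>c xs. a * c xs) ` h + boundaries k K\<rparr>"

definition PH :: "nat \<Rightarrow> 'a::metric_space set \<Rightarrow> ('f::field, ('a list \<Rightarrow> 'f) set) pmodule" where
  "PH k P =
     \<lparr>pspace = \<lambda>t. reduced_homology_space k (cech t P),
      pshift = \<lambda>s t. homology_map k id (cech s P) (cech t P)\<rparr>"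


section \<open>Barcode space with the bottleneck distance\<close>

text \<open>A pair \<open>(x, d)\<close> stands for an interval with left endpoint \<open>x\<close> and length \<open>d\<close>.\<close>

type_synonym bar = "real \<times> real"

definition valid_bars :: "bar multiset \<Rightarrow> bool" where
  "valid_bars b \<longleftrightarrow> (\<forall>(x, d)\<in>#b. 0 \<le> x \<and> 0 \<le> d)"

definition barcode_eq :: "bar multiset \<Rightarrow> bar multiset \<Rightarrow> bool" where
  "barcode_eq b c \<longleftrightarrow> valid_bars b \<and> valid_bars c \<and>
     filter_mset (\<lambda>p. snd p \<noteq> 0) b = filter_mset (\<lambda>p. snd p \<noteq> 0) c"

quotient_type barcode = "bar multiset" / partial: barcode_eq
proof (rule part_equivpI)
  show "\<exists>x. barcode_eq x x"
    by (rule exI[of _ "{#}"]) (simp add: barcode_eq_def valid_bars_def)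
  show "symp barcode_eq" "transp barcode_eq"
    by (auto simp: symp_def transp_def barcode_eq_def)
qed

definition bar_dist :: "bar \<Rightarrow> bar \<Rightarrow> real" where
  "bar_dist p q = max \<bar>fst p - fst q\<bar> \<bar>(fst p + snd p) - (fst q + snd q)\<bar>"

definition diag_dist :: "bar \<Rightarrow> real" where
  "diag_dist p = snd p / 2"

text \<open>The element \<open>0\<close> fixes the maximum over the empty set.\<close>

definition matching_cost ::
    "bar list \<Rightarrow> bar list \<Rightarrow> nat set \<Rightarrow> nat set \<Rightarrow> (nat \<Rightarrow> nat) \<Rightarrow> real" where
  "matching_cost I J A B \<theta> = Max (insert 0 (
     {bar_dist (I ! a) (J ! \<theta> a) | a. a \<in> A} \<union>
     {diag_dist (I ! a) | a. a < length I \<and> a \<notin> A} \<union>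
     {diag_dist (J ! b) | b. b < length J \<and> b \<notin> B}))"

text \<open>The enumerations \<open>I\<close>, \<open>J\<close> of the two multisets are immaterial, so the minimum is also taken
  over them. The set is finite, since costs lie in a finite set of values.\<close>

definition bottleneck :: "bar multiset \<Rightarrow> bar multiset \<Rightarrow> real" where
  "bottleneck b c = Min {matching_cost I J A B \<theta> | I J A B \<theta>.
     mset I = b \<and> mset J = c \<and> A \<subseteq> {..<length I} \<and> B \<subseteq> {..<length J} \<and> bij_betw \<theta> A B}"

text \<open>
  Proof that \<^const>\<open>bottleneck\<close> induces a metric: a bound on the bottleneck distance amounts to a
  perfect matching after adding bars of length \<open>0\<close> on both sides.
\<close>

definition padded :: "real \<Rightarrow> bar multiset \<Rightarrow> bar multiset \<Rightarrow> bool" where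
  "padded e b c \<longleftrightarrow> (\<exists>r s. (\<forall>p\<in>#r. snd p = 0) \<and> (\<forall>p\<in>#s. snd p = 0) \<and>
     rel_mset (\<lambda>p q. bar_dist p q \<le> e) (b + r) (c + s))"

definition partial_match :: "real \<Rightarrow> bar multiset \<Rightarrow> bar multiset \<Rightarrow> bool" where
  "partial_match e b c \<longleftrightarrow> (\<exists>m r s. b = image_mset fst m + r \<and> c = image_mset snd m + s \<and>
     (\<forall>(p, q)\<in>#m. bar_dist p q \<le> e) \<and> (\<forall>p\<in>#r. diag_dist p \<le> e) \<and> (\<forall>p\<in>#s. diag_dist p \<le> e))"

lemma bar_dist_diag: "snd q = 0 \<Longrightarrow> diag_dist p \<le> bar_dist p q" "snd q = 0 \<Longrightarrow> diag_dist p \<le> bar_dist q p"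
  by (auto simp: bar_dist_def diag_dist_def max_def abs_if)

lemma partial_matchI:
  assumes "b = image_mset fst m + r" "c = image_mset snd m + s" "\<forall>(p, q)\<in>#m. bar_dist p q \<le> e"
    "\<forall>p\<in>#r. diag_dist p \<le> e" "\<forall>p\<in>#s. diag_dist p \<le> e"
  shows "partial_match e b c"
  using assms unfolding partial_match_def by blast

lemma paddedI:
  assumes "rel_mset (\<lambda>p q. bar_dist p q \<le> e) (b + r) (c + s)"
    "\<forall>p\<in>#r. snd p = 0" "\<forall>p\<in>#s. snd p = 0"
  shows "padded e b c"
  using assms unfolding padded_def by blast

lemma rel_msetI:
  assumes "\<And>x y. (x, y) \<in># z \<Longrightarrow> R x y" "image_mset fst z = M" "image_mset snd z = N"
  shows "rel_mset R M N"
  using assms unfolding multiset.in_rel by blast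

lemma partial_match_imp_padded:
  assumes "partial_match e b c" "valid_bars b" "valid_bars c"
  shows "padded e b c"
proof -
  from assms(1) obtain m r s where h: "b = image_mset fst m + r" "c = image_mset snd m + s"
     "\<forall>(p, q)\<in>#m. bar_dist p q \<le> e" "\<forall>p\<in>#r. diag_dist p \<le> e" "\<forall>p\<in>#s. diag_dist p \<le> e"
    unfolding partial_match_def by blast
  define mid where "mid = (\<lambda>p::bar. (fst p + snd p / 2, 0::real))"
  have mid: "bar_dist p (mid p) = diag_dist p" "bar_dist (mid p) p = diag_dist p" if "0 \<le> snd p" for p
    using that by (auto simp: bar_dist_def mid_def diag_dist_def)
  have v: "0 \<le> snd p" if "p \<in># r \<or> p \<in># s" for p
    using that assms(2,3) h(1,2) by (auto simp: valid_bars_def case_prod_beta)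
  let ?z = "m + image_mset (\<lambda>p. (p, mid p)) r + image_mset (\<lambda>p. (mid p, p)) s"
  have "rel_mset (\<lambda>p q. bar_dist p q \<le> e) (b + image_mset mid s) (c + image_mset mid r)"
  proof (rule rel_msetI[of ?z])
    fix p q assume "(p, q) \<in># ?z"
    then consider "(p, q) \<in># m" | "p \<in># r" "q = mid p" | "q \<in># s" "p = mid q" by auto
    then show "bar_dist p q \<le> e" using h(3,4,5) v mid by cases auto
  qed (use h in \<open>simp_all add: multiset.map_comp comp_def ac_simps\<close>)
  then show ?thesis by (rule paddedI) (auto simp: mid_def)
qed

lemma padded_imp_partial_match_aux:
  assumes "rel_mset (\<lambda>p q. bar_dist p q \<le> e) M N"
  shows "M = b + r \<Longrightarrow> N = c + s \<Longrightarrow> \<forall>p\<in>#r. snd p = 0 \<Longrightarrow> \<forall>p\<in>#s. snd p = 0 \<Longrightarrow> partial_match e b c"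
proof -
  obtain z where z: "\<forall>(p, q)\<in>#z. bar_dist p q \<le> e" "image_mset fst z = M" "image_mset snd z = N"
    using assms unfolding multiset.in_rel by auto
  show "M = b + r \<Longrightarrow> N = c + s \<Longrightarrow> \<forall>p\<in>#r. snd p = 0 \<Longrightarrow> \<forall>p\<in>#s. snd p = 0 \<Longrightarrow> partial_match e b c"
    using z
  proof (induction z arbitrary: M N b c r s)
    case empty
    then have "b = {#}" "c = {#}" by auto
    then show ?case unfolding partial_match_def by (intro exI[of _ "{#}"]) auto
  next
    case (add x z)
    obtain p q where x: "x = (p, q)" by (cases x) auto
    have e: "bar_dist p q \<le> e" using add.prems x by auto
    have zz: "\<forall>(p, q)\<in>#z. bar_dist p q \<le> e" using add.prems by auto
    have L: "add_mset p (image_mset fst z) = b + r" "add_mset q (image_mset snd z) = c + s"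
      using add.prems x by auto
    consider b' where "b = add_mset p b'" "image_mset fst z = b' + r"
      | r' where "r = add_mset p r'" "image_mset fst z = b + r'" "snd p = 0"
    proof -
      have "p \<in># b + r" using L(1) by (metis union_single_eq_member)
      then show thesis
      proof (elim union_iff[THEN iffD1, THEN disjE])
        assume "p \<in># b"
        then obtain b' where "b = add_mset p b'" by (metis multi_member_split)
        with that(1) L(1) show thesis by auto
      next
        assume a: "p \<in># r"
        then obtain r' where "r = add_mset p r'" by (metis multi_member_split)
        with that(2) L(1) a add.prems(3) show thesis by auto
      qed
    qed note P = this
    consider c' where "c = add_mset q c'" "image_mset snd z = c' + s"
      | s' where "s = add_mset q s'" "image_mset snd z = c + s'" "snd q = 0"
    proof -
      have "q \<in># c + s" using L(2) by (metis union_single_eq_member)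
      then show thesis
      proof (elim union_iff[THEN iffD1, THEN disjE])
        assume "q \<in># c"
        then obtain c' where "c = add_mset q c'" by (metis multi_member_split)
        with that(1) L(2) show thesis by auto
      next
        assume a: "q \<in># s"
        then obtain s' where "s = add_mset q s'" by (metis multi_member_split)
        with that(2) L(2) a add.prems(4) show thesis by auto
      qed
    qed note Q = this
    show ?case
    proof (cases rule: P)
      case (1 b')
      show ?thesis
      proof (cases rule: Q)
        case c: (1 c')
        have "partial_match e b' c'"
          using add.IH[OF 1(2) c(2)] add.prems zz by auto
        then obtain m r s where "b' = image_mset fst m + r" "c' = image_mset snd m + s"
     "\<forall>(p, q)\<in>#m. bar_dist p q \<le> e" "\<forall>p\<in>#r. diag_dist p \<le> e" "\<forall>p\<in>#s. diag_dist p \<le> e"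
          unfolding partial_match_def by blast
        then show ?thesis using 1 c e
          by (intro partial_matchI[where m="add_mset (p, q) m" and r=r and s=s]) auto
      next
        case s: (2 s')
        have "partial_match e b' c"
          using add.IH[OF 1(2) s(2)] add.prems zz s by auto
        then obtain m r t where "b' = image_mset fst m + r" "c = image_mset snd m + t"
     "\<forall>(p, q)\<in>#m. bar_dist p q \<le> e" "\<forall>p\<in>#r. diag_dist p \<le> e" "\<forall>p\<in>#t. diag_dist p \<le> e"
          unfolding partial_match_def by blast
        then show ?thesis using 1 s e bar_dist_diag(1)[of q p]
          by (intro partial_matchI[where m=m and r="add_mset p r" and s=t]) auto
      qed
    next
      case r: (2 r')
      show ?thesis
      proof (cases rule: Q)
        case c: (1 c')
        have "partial_match e b c'"
          using add.IH[OF r(2) c(2)] add.prems zz r by auto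
        then obtain m u t where "b = image_mset fst m + u" "c' = image_mset snd m + t"
     "\<forall>(p, q)\<in>#m. bar_dist p q \<le> e" "\<forall>p\<in>#u. diag_dist p \<le> e" "\<forall>p\<in>#t. diag_dist p \<le> e"
          unfolding partial_match_def by blast
        then show ?thesis using r c e bar_dist_diag(2)[of p q]
          by (intro partial_matchI[where m=m and r=u and s="add_mset q t"]) auto
      next
        case s: (2 s')
        show ?thesis using add.IH[OF r(2) s(2)] add.prems zz s r by auto
      qed
    qed
  qed
qed

lemma padded_imp_partial_match: "padded e b c \<Longrightarrow> partial_match e b c"
  unfolding padded_def by (elim exE conjE) (rule padded_imp_partial_match_aux[OF _ refl refl])

definition matching_costs :: "bar multiset \<Rightarrow> bar multiset \<Rightarrow> real set" where
  "matching_costs b c = {matching_cost I J A B \<theta> | I J A B \<theta>.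
     mset I = b \<and> mset J = c \<and> A \<subseteq> {..<length I} \<and> B \<subseteq> {..<length J} \<and> bij_betw \<theta> A B}"

lemma matching_cost_le_iff:
  assumes "A \<subseteq> {..<length I}"
  shows "matching_cost I J A B \<theta> \<le> e \<longleftrightarrow> 0 \<le> e \<and> (\<forall>a\<in>A. bar_dist (I ! a) (J ! \<theta> a) \<le> e) \<and>
    (\<forall>a<length I. a \<notin> A \<longrightarrow> diag_dist (I ! a) \<le> e) \<and> (\<forall>b<length J. b \<notin> B \<longrightarrow> diag_dist (J ! b) \<le> e)"
proof -
  have "finite A" using assms finite_subset by blast
  then show ?thesis unfolding matching_cost_def by (subst Max_le_iff) (auto simp: setcompr_eq_image)
qed

lemma finite_matching_costs: "finite (matching_costs b c)"
proof (rule finite_subset)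
  let ?V = "insert 0 ((\<lambda>(p, q). bar_dist p q) ` (set_mset b \<times> set_mset c)
       \<union> diag_dist ` set_mset b \<union> diag_dist ` set_mset c)"
  show "finite ?V" by auto
  show "matching_costs b c \<subseteq> ?V"
  proof
    fix v assume "v \<in> matching_costs b c"
    then obtain I J A B \<theta> where h: "v = matching_cost I J A B \<theta>" "mset I = b" "mset J = c"
      "A \<subseteq> {..<length I}" "B \<subseteq> {..<length J}" "bij_betw \<theta> A B"
      unfolding matching_costs_def by blast
    let ?S = "insert 0 ({bar_dist (I ! a) (J ! \<theta> a) | a. a \<in> A} \<union>
     {diag_dist (I ! a) | a. a < length I \<and> a \<notin> A} \<union>
     {diag_dist (J ! b) | b. b < length J \<and> b \<notin> B})"
    have fA: "finite A" using h finite_subset by blast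
    have s: "set_mset b = set I" "set_mset c = set J" using h by auto
    have "finite ?S" using fA by (auto simp: setcompr_eq_image)
    then have "v \<in> ?S" unfolding h(1) matching_cost_def by (rule Max_in) auto
    moreover have "?S \<subseteq> ?V"
    proof -
      have "bar_dist (I ! a) (J ! \<theta> a) \<in> ?V" if "a \<in> A" for a
      proof -
        have "a < length I" "\<theta> a < length J"
          using h that by (auto simp: bij_betw_def)
        then have "(I ! a, J ! \<theta> a) \<in> set_mset b \<times> set_mset c" by (simp add: s)
        then show ?thesis by force
      qed
      moreover have "diag_dist (I ! a) \<in> ?V" if "a < length I" for a
        using that by (simp add: s)
      moreover have "diag_dist (J ! a) \<in> ?V" if "a < length J" for a
        using that by (simp add: s)
      ultimately show ?thesis by blast
    qed
    ultimately show "v \<in> ?V" by blast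
  qed
qed

lemma matching_costs_nonempty: "matching_costs b c \<noteq> {}"
proof -
  obtain I J where "mset I = b" "mset J = c" by (metis ex_mset)
  then have "matching_cost I J {} {} id \<in> matching_costs b c"
    unfolding matching_costs_def by (intro CollectI exI) auto
  then show ?thesis by auto
qed

lemma bottleneck_le_partial_match: "bottleneck b c \<le> e \<longleftrightarrow> 0 \<le> e \<and> partial_match e b c"
proof -
  have "bottleneck b c \<le> e \<longleftrightarrow> (\<exists>v\<in>matching_costs b c. v \<le> e)"
    unfolding bottleneck_def matching_costs_def[symmetric]
    by (rule Min_le_iff[OF finite_matching_costs matching_costs_nonempty])
  also have "\<dots> \<longleftrightarrow> 0 \<le> e \<and> partial_match e b c"
  proof
    assume "\<exists>v\<in>matching_costs b c. v \<le> e"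
    then obtain I J A B \<theta> where h: "matching_cost I J A B \<theta> \<le> e" "mset I = b" "mset J = c"
      "A \<subseteq> {..<length I}" "B \<subseteq> {..<length J}" "bij_betw \<theta> A B"
      unfolding matching_costs_def by blast
    have fin: "finite A" "finite B" using h finite_subset by blast+
    have c: "0 \<le> e" "\<forall>a\<in>A. bar_dist (I ! a) (J ! \<theta> a) \<le> e"
      "\<forall>a<length I. a \<notin> A \<longrightarrow> diag_dist (I ! a) \<le> e"
      "\<forall>b<length J. b \<notin> B \<longrightarrow> diag_dist (J ! b) \<le> e"
      using h(1) unfolding matching_cost_le_iff[OF h(4)] by auto
    have ms: "mset I = image_mset ((!) I) (mset_set A) + image_mset ((!) I) (mset_set ({..<length I} - A))"
      if "A \<subseteq> {..<length I}" for A and I :: "bar list"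
    proof -
      have f: "finite A" using that finite_subset by blast
      have "mset I = mset (map ((!) I) [0..<length I])" by (simp add: map_nth)
      also have "\<dots> = image_mset ((!) I) (mset_set {..<length I})"
        by (simp add: mset_map mset_upt atLeast0LessThan del: map_nth)
      also have "{..<length I} = A \<union> ({..<length I} - A)" using that by auto
      also have "mset_set \<dots> = mset_set A + mset_set ({..<length I} - A)"
        using f by (subst mset_set_Union) auto
      finally show ?thesis by simp
    qed
    have B: "image_mset \<theta> (mset_set A) = mset_set B"
      using h(6) by (metis bij_betw_def image_mset_mset_set)
    have "partial_match e b c" unfolding partial_match_def
      apply (rule exI[of _ "image_mset (\<lambda>a. (I ! a, J ! \<theta> a)) (mset_set A)"],
         rule exI[of _ "image_mset ((!) I) (mset_set ({..<length I} - A))"],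
         rule exI[of _ "image_mset ((!) J) (mset_set ({..<length J} - B))"], intro conjI)
      subgoal using ms[OF h(4)] h(2) by (simp add: multiset.map_comp comp_def)
      subgoal using ms[OF h(5)] h(3) by (simp add: multiset.map_comp comp_def B[symmetric])
      using c fin by auto
    with c(1) show "0 \<le> e \<and> partial_match e b c" by blast
  next
    assume a: "0 \<le> e \<and> partial_match e b c"
    then obtain m r s where h: "b = image_mset fst m + r" "c = image_mset snd m + s"
       "\<forall>(p, q)\<in>#m. bar_dist p q \<le> e" "\<forall>p\<in>#r. diag_dist p \<le> e" "\<forall>p\<in>#s. diag_dist p \<le> e"
      unfolding partial_match_def by blast
    obtain zs rs ss where l: "mset zs = m" "mset rs = r" "mset ss = s" by (metis ex_mset)
    let ?I = "map fst zs @ rs" and ?J = "map snd zs @ ss" and ?A = "{..<length zs}"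
    have "matching_cost ?I ?J ?A ?A id \<le> e"
    proof (subst matching_cost_le_iff, goal_cases)
      case 1 then show ?case by auto
    next
      case 2
      have "bar_dist (?I ! a) (?J ! a) \<le> e" if "a < length zs" for a
      proof -
        have "zs ! a \<in># m" using that l by auto
        then show ?thesis using h(3) that by (auto simp: nth_append case_prod_beta)
      qed
      moreover have "diag_dist (?I ! a) \<le> e" if "a < length ?I" "\<not> a < length zs" for a
      proof -
        have "?I ! a \<in># r" using that l(2) by (auto simp: nth_append)
        then show ?thesis using h(4) by blast
      qed
      moreover have "diag_dist (?J ! a) \<le> e" if "a < length ?J" "\<not> a < length zs" for a
      proof -
        have "?J ! a \<in># s" using that l(3) by (auto simp: nth_append)
        then show ?thesis using h(5) by blast
      qed
      ultimately show ?case using a by simp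
    qed
    moreover have "matching_cost ?I ?J ?A ?A id \<in> matching_costs b c"
      unfolding matching_costs_def
      by (intro CollectI exI[of _ ?I] exI[of _ ?J] exI[of _ ?A] exI[of _ id])
         (use h l in auto)
    ultimately show "\<exists>v\<in>matching_costs b c. v \<le> e" by blast
  qed
  finally show ?thesis .
qed

lemma bottleneck_le_iff:
  "valid_bars b \<Longrightarrow> valid_bars c \<Longrightarrow> bottleneck b c \<le> e \<longleftrightarrow> 0 \<le> e \<and> padded e b c"
  unfolding bottleneck_le_partial_match
  using partial_match_imp_padded[of e b c] padded_imp_partial_match[of e b c] by iprover

lemma padded_sym:
  assumes "padded e b c"
  shows "padded e c b"
proof -
  obtain r s where h: "\<forall>p\<in>#r. snd p = 0" "\<forall>p\<in>#s. snd p = 0"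
     "rel_mset (\<lambda>p q. bar_dist p q \<le> e) (b + r) (c + s)"
    using assms unfolding padded_def by blast
  have "(\<lambda>p q. bar_dist p q \<le> e)\<inverse>\<inverse> = (\<lambda>p q. bar_dist p q \<le> e)"
    by (auto simp: fun_eq_iff bar_dist_def abs_minus_commute)
  with h(3) have "rel_mset (\<lambda>p q. bar_dist p q \<le> e) (c + s) (b + r)"
    using multiset.rel_flip[of "\<lambda>p q. bar_dist p q \<le> e" "c + s" "b + r"] by simp
  then show ?thesis using h by (intro paddedI)
qed

lemma rel_mset_add_refl:
  assumes "rel_mset R M N" "\<And>x. R x x"
  shows "rel_mset R (M + U) (N + U)"
proof -
  obtain z where z: "set_mset z \<subseteq> {(x, y). R x y}" "image_mset fst z = M" "image_mset snd z = N"
    using assms(1) unfolding multiset.in_rel by auto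
  show ?thesis
    by (rule rel_msetI[of "z + image_mset (\<lambda>x. (x, x)) U"])
       (use z assms(2) in \<open>auto simp: multiset.map_comp comp_def\<close>)
qed

lemma padded_trans:
  assumes "padded e b c" "padded f c d" "0 \<le> e" "0 \<le> f"
  shows "padded (e + f) b d"
proof -
  obtain r s where 1: "\<forall>p\<in>#r. snd p = 0" "\<forall>p\<in>#s. snd p = 0"
     "rel_mset (\<lambda>p q. bar_dist p q \<le> e) (b + r) (c + s)"
    using assms(1) unfolding padded_def by blast
  obtain t u where 2: "\<forall>p\<in>#t. snd p = 0" "\<forall>p\<in>#u. snd p = 0"
     "rel_mset (\<lambda>p q. bar_dist p q \<le> f) (c + t) (d + u)"
    using assms(2) unfolding padded_def by blast
  have "rel_mset (\<lambda>p q. bar_dist p q \<le> e) (b + r + t) (c + s + t)"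
    by (rule rel_mset_add_refl[OF 1(3)]) (use assms in \<open>auto simp: bar_dist_def\<close>)
  moreover have "rel_mset (\<lambda>p q. bar_dist p q \<le> f) (c + t + s) (d + u + s)"
    by (rule rel_mset_add_refl[OF 2(3)]) (use assms in \<open>auto simp: bar_dist_def\<close>)
  moreover have "c + t + s = c + s + t" by (simp only: ac_simps)
  ultimately have "rel_mset ((\<lambda>p q. bar_dist p q \<le> e) OO (\<lambda>p q. bar_dist p q \<le> f)) (b + r + t) (d + u + s)"
    unfolding multiset.rel_compp by (auto intro: relcomppI)
  then have "rel_mset (\<lambda>p q. bar_dist p q \<le> e + f) (b + r + t) (d + u + s)"
    by (rule multiset.rel_mono_strong) (auto simp: bar_dist_def)
  then have "rel_mset (\<lambda>p q. bar_dist p q \<le> e + f) (b + (r + t)) (d + (u + s))"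
    by (simp only: add.assoc)
  then show ?thesis by (rule paddedI) (use 1 2 in auto)
qed

lemma padded_0_iff: "padded 0 b c \<longleftrightarrow> filter_mset (\<lambda>p. snd p \<noteq> 0) b = filter_mset (\<lambda>p. snd p \<noteq> 0) c"
proof -
  have eq: "(\<lambda>p q. bar_dist p q \<le> 0) = (=)"
    by (auto simp: fun_eq_iff bar_dist_def prod_eq_iff)
  have split: "M = filter_mset (\<lambda>p. snd p \<noteq> 0) M + filter_mset (\<lambda>p. snd p = 0) M" for M :: "bar multiset"
    using multiset_partition[of M "\<lambda>p. snd p \<noteq> 0"] by simp
  have nil: "filter_mset (\<lambda>p. snd p \<noteq> 0) r = {#}" if "\<forall>p\<in>#r. snd p = 0" for r :: "bar multiset"
    using that by (auto simp: filter_mset_eq_conv)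
  show ?thesis
  proof
    assume "padded 0 b c"
    then obtain r s where h: "\<forall>p\<in>#r. snd p = 0" "\<forall>p\<in>#s. snd p = 0" "b + r = c + s"
      unfolding padded_def eq by (auto simp: multiset.rel_eq)
    have "filter_mset (\<lambda>p. snd p \<noteq> 0) b + filter_mset (\<lambda>p. snd p \<noteq> 0) r =
        filter_mset (\<lambda>p. snd p \<noteq> 0) c + filter_mset (\<lambda>p. snd p \<noteq> 0) s"
      using arg_cong[OF h(3), of "filter_mset (\<lambda>p. snd p \<noteq> 0)"] by (simp only: filter_union_mset)
    then show "filter_mset (\<lambda>p. snd p \<noteq> 0) b = filter_mset (\<lambda>p. snd p \<noteq> 0) c"
      unfolding nil[OF h(1)] nil[OF h(2)] by (simp only: add_0_right)
  next
    assume a: "filter_mset (\<lambda>p. snd p \<noteq> 0) b = filter_mset (\<lambda>p. snd p \<noteq> 0) c"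
    have "b + filter_mset (\<lambda>p. snd p = 0) c =
        filter_mset (\<lambda>p. snd p \<noteq> 0) b + filter_mset (\<lambda>p. snd p = 0) b + filter_mset (\<lambda>p. snd p = 0) c"
      by (subst split[of b]) (rule refl)
    also have "\<dots> = filter_mset (\<lambda>p. snd p \<noteq> 0) c + filter_mset (\<lambda>p. snd p = 0) c + filter_mset (\<lambda>p. snd p = 0) b"
      unfolding a by (simp only: ac_simps)
    also have "\<dots> = c + filter_mset (\<lambda>p. snd p = 0) b"
      by (subst split[of c]) (rule refl)
    finally have "b + filter_mset (\<lambda>p. snd p = 0) c = c + filter_mset (\<lambda>p. snd p = 0) b" .
    then show "padded 0 b c"
      by (intro paddedI[where r = "filter_mset (\<lambda>p. snd p = 0) c"
            and s = "filter_mset (\<lambda>p. snd p = 0) b"]) (auto simp: eq multiset.rel_eq)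
  qed
qed

lemma bottleneck_ge_0: "0 \<le> bottleneck b c"
  using bottleneck_le_partial_match[of b c "bottleneck b c"] by simp

lemma bottleneck_sym: "valid_bars b \<Longrightarrow> valid_bars c \<Longrightarrow> bottleneck b c = bottleneck c b"
proof -
  have "bottleneck b c \<le> bottleneck c b" if "valid_bars b" "valid_bars c" for b c
    using bottleneck_le_iff[OF that(2,1), of "bottleneck c b"]
      bottleneck_le_iff[OF that, of "bottleneck c b"] padded_sym by blast
  then show "valid_bars b \<Longrightarrow> valid_bars c \<Longrightarrow> bottleneck b c = bottleneck c b"
    by (simp add: antisym)
qed

lemma bottleneck_triangle:
  assumes "valid_bars b" "valid_bars c" "valid_bars d"
  shows "bottleneck b d \<le> bottleneck b c + bottleneck c d"
proof -
  have "padded (bottleneck b c) b c" "padded (bottleneck c d) c d"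
    using bottleneck_le_iff[OF assms(1,2), of "bottleneck b c"]
      bottleneck_le_iff[OF assms(2,3), of "bottleneck c d"] by simp_all
  then have "padded (bottleneck b c + bottleneck c d) b d"
    using padded_trans bottleneck_ge_0 by blast
  then show ?thesis
    using bottleneck_le_iff[OF assms(1,3)] by (simp add: bottleneck_ge_0)
qed

lemma bottleneck_eq_0_iff:
  assumes "valid_bars b" "valid_bars c"
  shows "bottleneck b c = 0 \<longleftrightarrow> barcode_eq b c"
proof -
  have "bottleneck b c = 0 \<longleftrightarrow> bottleneck b c \<le> 0" using bottleneck_ge_0[of b c] by auto
  also have "\<dots> \<longleftrightarrow> barcode_eq b c"
    using assms by (simp add: bottleneck_le_iff padded_0_iff barcode_eq_def)
  finally show ?thesis .
qed

instantiation barcode :: metric_space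
begin

lift_definition dist_barcode :: "barcode \<Rightarrow> barcode \<Rightarrow> real" is bottleneck
proof -
  fix b b' c c' assume a: "barcode_eq b b'" "barcode_eq c c'"
  have le: "bottleneck b c \<le> bottleneck b' c'" if a: "barcode_eq b b'" "barcode_eq c c'" for b b' c c'
  proof -
    have v: "valid_bars b" "valid_bars b'" "valid_bars c" "valid_bars c'"
      using a by (auto simp: barcode_eq_def)
    have z: "bottleneck b b' = 0" "bottleneck c' c = 0"
      using a v by (simp_all add: bottleneck_eq_0_iff barcode_eq_def)
    show ?thesis
      using bottleneck_triangle[OF v(1,2,3)] bottleneck_triangle[OF v(2,4,3)] z by simp
  qed
  have "barcode_eq b' b" "barcode_eq c' c" using a by (auto simp: barcode_eq_def)
  then show "bottleneck b c = bottleneck b' c'" using le[OF a] le[of b' b c' c] by simp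
qed

definition uniformity_barcode :: "(barcode \<times> barcode) filter" where
  "uniformity_barcode = (INF e\<in>{0<..}. principal {(x, y). dist x y < e})"

definition open_barcode :: "barcode set \<Rightarrow> bool" where
  "open_barcode U = (\<forall>x\<in>U. eventually (\<lambda>(x', y). x' = x \<longrightarrow> y \<in> U) uniformity)"

instance
proof
  fix x y z :: barcode
  show "dist x y = 0 \<longleftrightarrow> x = y"
    by transfer (auto simp: bottleneck_eq_0_iff barcode_eq_def)
  have tri: "dist x y \<le> dist x z + dist z y"
    by transfer (auto simp: bottleneck_triangle barcode_eq_def)
  have sym: "dist z y = dist y z"
    by transfer (auto simp: bottleneck_sym barcode_eq_def)
  show "dist x y \<le> dist x z + dist y z"
    using tri sym by simp
qed (fact uniformity_barcode_def open_barcode_def)+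

end

text \<open>The argument of type \<open>'f itself\<close> selects the coefficient field.\<close>

definition barcode_map :: "'f::field itself \<Rightarrow> nat \<Rightarrow> 'a::metric_space set \<Rightarrow> barcode" where
  "barcode_map F k P = abs_barcode
     (image_mset (\<lambda>I. (Inf I, Sup I - Inf I)) (intervals_of (PH k P :: ('f, ('a list \<Rightarrow> 'f) set) pmodule)))"

text \<open>\<open>\<iota>\<close> exhibits \<open>'c\<close> as the completion of \<open>'b\<close>, which is determined up to a unique isometry.\<close>

definition is_completion :: "('b::metric_space \<Rightarrow> 'c::complete_space) \<Rightarrow> bool" where
  "is_completion \<iota> \<longleftrightarrow> (\<forall>x y. dist (\<iota> x) (\<iota> y) = dist x y) \<and> closure (range \<iota>) = UNIV"


section \<open>Compact sets with the Hausdorff distance\<close>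

definition thickening :: "'a::metric_space set \<Rightarrow> real \<Rightarrow> 'a set" where
  "thickening A t = {x. infdist x A \<le> t}"

definition hausdorff_dist :: "'a::metric_space set \<Rightarrow> 'a set \<Rightarrow> real" where
  "hausdorff_dist A B =
     max (Inf {t. 0 \<le> t \<and> A \<subseteq> thickening B t}) (Inf {t. 0 \<le> t \<and> B \<subseteq> thickening A t})"

typedef (overloaded) 'a compacts = "{K::'a::metric_space set. compact K \<and> K \<noteq> {}}"
  morphisms set_of_compact Abs_compacts
  by (rule exI[of _ "{undefined}"]) auto

setup_lifting type_definition_compacts

lemma half_hausdorff_le_iff:
  fixes A B :: "'a::metric_space set"
  assumes "compact A" "A \<noteq> {}"
  shows "Inf {t. 0 \<le> t \<and> A \<subseteq> thickening B t} \<le> e \<longleftrightarrow> 0 \<le> e \<and> A \<subseteq> thickening B e"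
proof -
  let ?T = "{t. 0 \<le> t \<and> A \<subseteq> thickening B t}"
  have "compact ((\<lambda>x. infdist x B) ` A)"
    by (intro compact_continuous_image assms continuous_intros)
  then obtain M where "\<forall>x\<in>A. infdist x B \<le> M"
    by (metis bounded_imp_bdd_above compact_imp_bounded bdd_above.E imageI)
  then have "max 0 M \<in> ?T" by (auto simp: thickening_def intro: max.coboundedI2)
  then have ne: "?T \<noteq> {}" by blast
  have bdd: "bdd_below ?T" by (rule bdd_belowI[of _ 0]) auto
  show ?thesis
  proof
    assume le: "Inf ?T \<le> e"
    have "0 \<le> Inf ?T" using ne by (intro cInf_greatest) auto
    moreover have "infdist x B \<le> Inf ?T" if "x \<in> A" for x
      using ne that by (intro cInf_greatest) (auto simp: thickening_def)
    ultimately show "0 \<le> e \<and> A \<subseteq> thickening B e" using le by (force simp: thickening_def)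
  next
    assume "0 \<le> e \<and> A \<subseteq> thickening B e"
    then show "Inf ?T \<le> e" using bdd by (intro cInf_lower) auto
  qed
qed

lemma hausdorff_dist_le_iff:
  assumes "compact A" "A \<noteq> {}" "compact B" "B \<noteq> {}"
  shows "hausdorff_dist A B \<le> e \<longleftrightarrow> 0 \<le> e \<and> A \<subseteq> thickening B e \<and> B \<subseteq> thickening A e"
  unfolding hausdorff_dist_def using half_hausdorff_le_iff[OF assms(1,2), of B e] half_hausdorff_le_iff[OF assms(3,4), of A e]
  by auto

lemma thickening_trans:
  assumes "A \<subseteq> thickening B s" "B \<subseteq> thickening C t" "B \<noteq> {}"
  shows "A \<subseteq> thickening C (s + t)"
proof
  fix x assume "x \<in> A"
  then have x: "infdist x B \<le> s" using assms by (auto simp: thickening_def)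
  have "infdist x C - t \<le> dist x b" if "b \<in> B" for b
    using infdist_triangle[of x C b] assms(2) that by (force simp: thickening_def)
  then have "infdist x C - t \<le> infdist x B"
    unfolding infdist_notempty[OF assms(3)] using assms(3) by (intro cINF_greatest) auto
  with x show "x \<in> thickening C (s + t)" by (auto simp: thickening_def)
qed

instantiation compacts :: (metric_space) metric_space
begin

lift_definition dist_compacts :: "'a compacts \<Rightarrow> 'a compacts \<Rightarrow> real" is hausdorff_dist .

definition uniformity_compacts :: "('a compacts \<times> 'a compacts) filter" where
  "uniformity_compacts = (INF e\<in>{0<..}. principal {(x, y). dist x y < e})"

definition open_compacts :: "'a compacts set \<Rightarrow> bool" where
  "open_compacts U = (\<forall>x\<in>U. eventually (\<lambda>(x', y). x' = x \<longrightarrow> y \<in> U) uniformity)"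

instance
proof
  fix x y z :: "'a compacts"
  show "dist x y = 0 \<longleftrightarrow> x = y"
  proof transfer
    fix A B :: "'a set" assume h: "compact A \<and> A \<noteq> {}" "compact B \<and> B \<noteq> {}"
    have le: "hausdorff_dist A B \<le> e \<longleftrightarrow> 0 \<le> e \<and> A \<subseteq> thickening B e \<and> B \<subseteq> thickening A e" for e
      by (rule hausdorff_dist_le_iff) (use h in auto)
    have th: "thickening C 0 = C" if "compact C \<and> C \<noteq> {}" for C :: "'a set"
    proof -
      have "x \<in> C \<longleftrightarrow> infdist x C \<le> 0" for x
        using in_closed_iff_infdist_zero[of C x] that infdist_nonneg[of x C]
        by (auto simp: compact_imp_closed)
      then show ?thesis by (auto simp: thickening_def)
    qed
    have "hausdorff_dist A B = 0 \<longleftrightarrow> hausdorff_dist A B \<le> 0"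
      using le[of "hausdorff_dist A B"] by auto
    also have "\<dots> \<longleftrightarrow> A = B" unfolding le th[OF h(1)] th[OF h(2)] by blast
    finally show "hausdorff_dist A B = 0 \<longleftrightarrow> A = B" .
  qed
  show "dist x y \<le> dist x z + dist y z"
  proof transfer
    fix A B C :: "'a set"
    assume h: "compact A \<and> A \<noteq> {}" "compact B \<and> B \<noteq> {}" "compact C \<and> C \<noteq> {}"
    have le: "hausdorff_dist A B \<le> e \<longleftrightarrow> 0 \<le> e \<and> A \<subseteq> thickening B e \<and> B \<subseteq> thickening A e"
      if "compact A \<and> A \<noteq> {}" "compact B \<and> B \<noteq> {}" for e and A B :: "'a set"
      by (rule hausdorff_dist_le_iff) (use that in auto)
    have 1: "0 \<le> hausdorff_dist A C" "A \<subseteq> thickening C (hausdorff_dist A C)"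
        "C \<subseteq> thickening A (hausdorff_dist A C)"
      using le[OF h(1,3), of "hausdorff_dist A C"] by auto
    have 2: "0 \<le> hausdorff_dist B C" "B \<subseteq> thickening C (hausdorff_dist B C)"
        "C \<subseteq> thickening B (hausdorff_dist B C)"
      using le[OF h(2,3), of "hausdorff_dist B C"] by auto
    have "A \<subseteq> thickening B (hausdorff_dist A C + hausdorff_dist B C)"
      using thickening_trans[OF 1(2) 2(3)] h(3) by blast
    moreover have "B \<subseteq> thickening A (hausdorff_dist A C + hausdorff_dist B C)"
      using thickening_trans[OF 2(2) 1(3)] h(3) by (simp add: add.commute)
    ultimately show "hausdorff_dist A B \<le> hausdorff_dist A C + hausdorff_dist B C"
      unfolding le[OF h(1,2)] using 1(1) 2(1) by simp
  qed
qed (fact uniformity_compacts_def open_compacts_def)+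

end

definition finite_compacts :: "'a::metric_space compacts set" where
  "finite_compacts = {P. finite (set_of_compact P)}"

end

theory Submission
  imports Defs
begin

text \<open>
  Both parts of the theorem follow from one estimate: if \<open>P\<close> and \<open>Q\<close> are finite and every point of
  either set is within \<open>\<delta>\<close> of a point of the other, then the barcodes of \<open>P\<close> and \<open>Q\<close> are at
  bottleneck distance at most \<open>\<delta>\<close> (\<open>barcode_map_dist_le\<close>). Since the finite sets are dense among the
  compact ones (\<open>closure_finite_compacts\<close>), a 1-Lipschitz map from them into a complete space has a
  unique continuous extension, which is 1-Lipschitz again.

  The estimate comes from linear algebra. In degree \<open>k\<close>, the homology of a filtered complex is the
  quotient \<open>Z\<^sub>t / B\<^sub>t\<close> of reduced cycles by boundaries, and \<open>Z\<^sub>t\<close> and \<open>B\<^sub>t\<close> are two increasing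
  families of subspaces of one finite-dimensional space of chains. Any two chains of subspaces have
  a common adapted basis \<open>E\<close>: each of the subspaces is spanned by the elements of \<open>E\<close> that it
  contains (\<open>common_adapted_basis\<close>). A basis element \<open>e\<close> represents a nonzero class from the time it
  enters \<open>Z\<^sub>t\<close> until it enters \<open>B\<^sub>t\<close>, and these lifetimes form an interval decomposition
  (\<open>filtration_interval_decomposition\<close>). The multiset of intervals is intrinsic, because the number of
  intervals that contain \<open>s\<close> and \<open>t\<close> is the rank of the shift from \<open>s\<close> to \<open>t\<close>
  (\<open>intervals_of_eq\<close>).

  Suppose that all complexes of two filtrations \<open>K\<close> and \<open>L\<close> of the same simplex are comparable under
  inclusion. Then a single basis \<open>E\<close> is adapted to both. If moreover \<open>K\<^sub>t \<subseteq> L\<^sub>t\<^sub>+\<^sub>\<delta>\<close> and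
  \<open>L\<^sub>t \<subseteq> K\<^sub>t\<^sub>+\<^sub>\<delta>\<close>, then every \<open>e\<close> is born in \<open>K\<close> and in \<open>L\<close> at times that differ by at most \<open>\<delta>\<close>, and
  likewise it dies, so matching the two bars of each \<open>e\<close> costs at most \<open>\<delta>\<close>
  (\<open>filtration_barcode_dist_comparable\<close>). Without comparability, the entry times of the simplices in
  \<open>K\<close> and in \<open>L\<close> are joined by a segment of functions. Around each function on the segment there is a
  neighbourhood in which no function orders two simplices in the opposite way, so the comparable case
  applies locally, and the local estimates add up along the segment
  (\<open>sublevel_barcode_dist\<close>, \<open>filtration_barcode_stability\<close>).

  It remains to bring the Cech complexes of \<open>P\<close> and \<open>Q\<close> onto the common vertex set \<open>P \<union> Q\<close>. A point of
  \<open>Q\<close> is treated as a duplicate of a nearby point of \<open>P\<close>, that is, the Cech complex of \<open>P\<close> is pulled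
  back along a retraction \<open>P \<union> Q \<rightarrow> P\<close>, and symmetrically for \<open>Q\<close>. Duplicate vertices can be deleted
  without changing homology (\<open>remove_dominated_vertices\<close>), so the barcodes stay the same, while
  the two pulled-back filtrations are included in each other up to a shift by \<open>\<delta>\<close>.
\<close>

section \<open>Bases adapted to two chains of subspaces\<close>

text \<open>
  A basis is grown along the first chain: all of one member is exhausted before vectors outside it
  are used. This order is what the last condition of \<open>good\<close> below records. A vector added next is
  taken from the smallest intersection \<open>M \<inter> N\<close> of members of the two chains that is not yet
  spanned; minimality then forces the new vector to lie in every member that meets the enlarged
  span in something new.
\<close>

lemma (in vector_space) common_adapted_basis:
  assumes fin: "finite \<A>" "finite \<B>" "finite S"
    and sub: "\<And>U. U \<in> \<A> \<union> \<B> \<Longrightarrow> subspace U \<and> U \<subseteq> span S"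
    and chA: "\<And>U V. U \<in> \<A> \<Longrightarrow> V \<in> \<A> \<Longrightarrow> U \<subseteq> V \<or> V \<subseteq> U"
    and chB: "\<And>U V. U \<in> \<B> \<Longrightarrow> V \<in> \<B> \<Longrightarrow> U \<subseteq> V \<or> V \<subseteq> U"
  obtains E where "finite E" "independent E" "\<And>U. U \<in> \<A> \<union> \<B> \<Longrightarrow> span (E \<inter> U) = U"
proof -
  define W where "W = span S"
  define A where "A = insert W \<A>"
  define B where "B = insert W \<B>"
  have AB: "finite A" "finite B" "W \<in> A" "W \<in> B"
    using fin unfolding A_def B_def by auto
  have subW: "U \<subseteq> W" if "U \<in> \<A> \<union> \<B>" for U using sub that unfolding W_def by blast
  have subAB: "subspace U \<and> U \<subseteq> W" if "U \<in> A \<union> B" for U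
    using sub that unfolding A_def B_def W_def by auto
  have chAB: "\<And>U V. U \<in> A \<Longrightarrow> V \<in> A \<Longrightarrow> U \<subseteq> V \<or> V \<subseteq> U"
      "\<And>U V. U \<in> B \<Longrightarrow> V \<in> B \<Longrightarrow> U \<subseteq> V \<or> V \<subseteq> U"
    unfolding A_def B_def using chA chB subW by (metis UnI1 insertE order_refl, metis UnI2 insertE
      order_refl)
  define good where "good E \<longleftrightarrow> independent E \<and> E \<subseteq> W \<and>
     (\<forall>U\<in>A \<union> B. span E \<inter> U \<subseteq> span (E \<inter> U)) \<and> (\<forall>U\<in>A. U \<subseteq> span E \<or> E \<subseteq> U)" for E
  have bound: "finite E \<and> card E \<le> card S" if "good E" for E
    using independent_span_bound[of S E] that fin unfolding good_def W_def by blast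
  have "good {}"
    unfolding good_def by (auto simp: independent_empty)
  then obtain E where E: "good E" and max: "\<And>E'. good E' \<Longrightarrow> card E' \<le> card E"
    using ex_has_greatest_nat[of good "{}" card "Suc (card S)"] bound
    by (metis le_imp_less_Suc)
  have finE: "finite E" and indE: "independent E" and EW: "E \<subseteq> W"
    and spE: "\<And>U. U \<in> A \<union> B \<Longrightarrow> span E \<inter> U \<subseteq> span (E \<inter> U)"
    and invE: "\<And>U. U \<in> A \<Longrightarrow> U \<subseteq> span E \<or> E \<subseteq> U"
    using E bound[OF E] unfolding good_def by simp_all
  \<comment> \<open>A good set of maximal size spans everything, since otherwise it could be enlarged.\<close>
  have WE: "W \<subseteq> span E"
  proof (rule ccontr)
    assume "\<not> W \<subseteq> span E"
    then have "{U\<in>A. \<not> U \<subseteq> span E} \<noteq> {}" "finite {U\<in>A. \<not> U \<subseteq> span E}"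
      using AB by auto
    then obtain M where M: "M \<in> A" "\<not> M \<subseteq> span E"
        and minM: "\<And>U. U \<in> A \<Longrightarrow> U \<subset> M \<Longrightarrow> U \<subseteq> span E"
      using finite_has_minimal[of "{U\<in>A. \<not> U \<subseteq> span E}"] by (auto simp: psubset_eq)
    have "M \<inter> W = M" using subAB M by blast
    then have "{U\<in>B. \<not> M \<inter> U \<subseteq> span E} \<noteq> {}" "finite {U\<in>B. \<not> M \<inter> U \<subseteq> span E}"
      using AB M by auto
    then obtain N where N: "N \<in> B" "\<not> M \<inter> N \<subseteq> span E"
        and minN: "\<And>U. U \<in> B \<Longrightarrow> U \<subset> N \<Longrightarrow> M \<inter> U \<subseteq> span E"
      using finite_has_minimal[of "{U\<in>B. \<not> M \<inter> U \<subseteq> span E}"] by (auto simp: psubset_eq)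
    obtain v where v: "v \<in> M" "v \<in> N" "v \<notin> span E" using N by blast
    have EM: "E \<subseteq> M" using invE M by blast
    have spEM: "span E \<subseteq> M" using EM subAB M(1) by (simp add: span_minimal)
    have ins: "span (insert v E) \<inter> U \<subseteq> span (insert v E \<inter> U)" if U: "U \<in> A \<union> B" for U
    proof
      fix x assume "x \<in> span (insert v E) \<inter> U"
      then have xU: "x \<in> U" and "x \<in> span (insert v E)" by auto
      then obtain a where y: "x - scale a v \<in> span E" by (auto simp: span_insert)
      have sU: "subspace U" using subAB U by blast
      show "x \<in> span (insert v E \<inter> U)"
      proof (cases "a = 0")
        case True
        then have "x \<in> span (E \<inter> U)" using y xU spE[OF U] by auto
        then show ?thesis using span_mono[of "E \<inter> U" "insert v E \<inter> U"] by auto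
      next
        case False
        have "v \<in> U"
        proof (rule ccontr)
          assume vU: "v \<notin> U"
          have "x \<in> span E"
          proof (cases "U \<in> A")
            case True
            then have "U \<subset> M" using chAB(1)[OF True M(1)] v vU by blast
            then show ?thesis using minM True xU by blast
          next
            case False
            then have "U \<in> B" using U by blast
            then have "U \<subset> N" using chAB(2)[OF _ N(1), of U] v vU by blast
            then have "M \<inter> U \<subseteq> span E" using minN \<open>U \<in> B\<close> by blast
            \<comment> \<open>Here the growth order enters: \<open>E\<close> lies in \<open>M\<close>, so \<open>x\<close> does not leave \<open>M\<close>.\<close>
            moreover have "x \<in> M"
            proof -
              have "x - scale a v \<in> M" "scale a v \<in> M"
                using y spEM v subAB[of M] M(1) subspace_scale by auto
              then have "(x - scale a v) + scale a v \<in> M"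
                using subAB[of M] M(1) subspace_add by blast
              then show ?thesis by simp
            qed
            ultimately show ?thesis using xU by blast
          qed
          then have "x - (x - scale a v) \<in> span E" using y span_diff by blast
          then have "scale a v \<in> span E" by simp
          then have "scale (inverse a) (scale a v) \<in> span E" by (rule span_scale)
          moreover have "scale (inverse a) (scale a v) = v" using False by simp
          ultimately show False using v by metis
        qed
        then have "x - scale a v \<in> U" using xU sU by (simp add: subspace_diff subspace_scale)
        then have "x - scale a v \<in> span (E \<inter> U)" using y spE[OF U] by blast
        then have "x - scale a v \<in> span (insert v E \<inter> U)"
          using span_mono[of "E \<inter> U" "insert v E \<inter> U"] by auto
        moreover have "scale a v \<in> span (insert v E \<inter> U)"
          using \<open>v \<in> U\<close> by (intro span_scale span_base) auto
        ultimately have "(x - scale a v) + scale a v \<in> span (insert v E \<inter> U)"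
          by (rule span_add)
        then show ?thesis by simp
      qed
    qed
    have inv: "U \<subseteq> span (insert v E) \<or> insert v E \<subseteq> U" if U: "U \<in> A" for U
    proof (cases "U \<subseteq> span E")
      case True
      then show ?thesis using span_mono[of E "insert v E"] by blast
    next
      case False
      then have "\<not> U \<subset> M" using minM U by blast
      then have "M \<subseteq> U" using chAB(1)[OF U M(1)] by blast
      then show ?thesis using invE[OF U] False v by blast
    qed
    have "v \<in> W" using v(1) subAB[of M] M(1) by blast
    then have "good (insert v E)"
      unfolding good_def using ins inv indE v(3) EW by (simp add: independent_insert)
    then have "card (insert v E) \<le> card E" by (rule max)
    moreover have "v \<notin> E" using v span_base by blast
    ultimately show False using finE by simp
  qed
  show ?thesis
  proof
    show "finite E" "independent E" by fact+
    fix U assume "U \<in> \<A> \<union> \<B>"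
    then have U: "U \<in> A \<union> B" unfolding A_def B_def by auto
    have "U \<subseteq> span (E \<inter> U)" using spE[OF U] subAB[OF U] WE by blast
    then show "span (E \<inter> U) = U"
      using subAB[OF U] by (simp add: span_minimal subset_antisym)
  qed
qed

definition fscale :: "'f::field \<Rightarrow> ('b \<Rightarrow> 'f) \<Rightarrow> 'b \<Rightarrow> 'f" where
  "fscale a c = (\<lambda>x. a * c x)"

lemma fscale_apply [simp]: "fscale a c x = a * c x"
  by (simp add: fscale_def)

interpretation fn: vector_space fscale
  by unfold_locales (auto simp: fun_eq_iff algebra_simps)

interpretation fnp: vector_space_pair fscale fscale
  by unfold_locales

definition supported_on :: "'b set \<Rightarrow> ('b \<Rightarrow> 'f::field) set" where
  "supported_on A = {c. \<forall>x. c x \<noteq> 0 \<longrightarrow> x \<in> A}"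

definition unit_vector :: "'b \<Rightarrow> 'b \<Rightarrow> 'f::field" where
  "unit_vector a = (\<lambda>x. if x = a then 1 else 0)"

lemma sum_fun_apply: "(\<Sum>a\<in>A. f a) x = (\<Sum>a\<in>A. f a x)" for f :: "'i \<Rightarrow> 'b \<Rightarrow> 'f::comm_monoid_add"
  by (induction A rule: infinite_finite_induct) auto

lemma sum_fscale_unit_vector:
  assumes "finite A"
  shows "(\<Sum>a\<in>A. fscale (u a) (unit_vector a)) = (\<lambda>x. if x \<in> A then u x else 0)"
  using assms by (simp add: fun_eq_iff sum_fun_apply unit_vector_def if_distrib cong: if_cong)

lemma inj_unit_vector: "inj (unit_vector :: 'b \<Rightarrow> 'b \<Rightarrow> 'f::field)"
  by (rule injI) (metis unit_vector_def zero_neq_one)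

lemma span_unit_vectors:
  assumes "finite A"
  shows "fn.span (unit_vector ` A) = (supported_on A :: ('b \<Rightarrow> 'f::field) set)"
proof
  have "fn.subspace (supported_on A :: ('b \<Rightarrow> 'f) set)"
    by (rule fn.subspaceI) (auto simp: supported_on_def, force)
  then show "fn.span (unit_vector ` A) \<subseteq> (supported_on A :: ('b \<Rightarrow> 'f) set)"
    by (rule fn.span_minimal[rotated]) (auto simp: supported_on_def unit_vector_def split: if_splits)
  show "(supported_on A :: ('b \<Rightarrow> 'f) set) \<subseteq> fn.span (unit_vector ` A)"
  proof
    fix c :: "'b \<Rightarrow> 'f" assume "c \<in> supported_on A"
    then have "c = (\<Sum>a\<in>A. fscale (c a) (unit_vector a))"
      unfolding sum_fscale_unit_vector[OF assms] by (auto simp: supported_on_def fun_eq_iff)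
    also have "\<dots> \<in> fn.span (unit_vector ` A)"
      by (intro fn.span_sum fn.span_scale fn.span_base) auto
    finally show "c \<in> fn.span (unit_vector ` A)" .
  qed
qed

lemma independent_unit_vectors:
  assumes "finite A"
  shows "fn.independent (unit_vector ` A :: ('b \<Rightarrow> 'f::field) set)"
proof
  assume "fn.dependent (unit_vector ` A :: ('b \<Rightarrow> 'f) set)"
  then obtain u a where u: "a \<in> A" "u (unit_vector a) \<noteq> 0"
      "(\<Sum>v\<in>unit_vector ` A. fscale (u v) v) = (0 :: 'b \<Rightarrow> 'f)"
    using assms by (auto simp: fn.dependent_finite)
  have "(\<Sum>v\<in>unit_vector ` A. fscale (u v) v) = (\<Sum>a\<in>A. fscale (u (unit_vector a)) (unit_vector a))"
    by (rule sum.reindex[OF inj_on_subset[OF inj_unit_vector], unfolded comp_def]) simp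
  with u(3) have "(\<lambda>x. if x \<in> A then u (unit_vector x) else 0) = (0 :: 'b \<Rightarrow> 'f)"
    unfolding sum_fscale_unit_vector[OF assms] by simp
  from fun_cong[OF this, of a] show False using u(1,2) by simp
qed

text \<open>
  Comparison of dimensions for a map that is only known to be linear on a subspace of coordinates;
  precomposing with the coordinate projection \<open>cut\<close> makes it linear everywhere.
\<close>

lemma card_le_of_injective_linear:
  fixes \<phi> :: "('i \<Rightarrow> 'f::field) \<Rightarrow> ('j \<Rightarrow> 'f)"
  assumes fin: "finite A" "finite B"
    and maps: "\<And>x. x \<in> supported_on A \<Longrightarrow> \<phi> x \<in> supported_on B"
    and add: "\<And>x y. x \<in> supported_on A \<Longrightarrow> y \<in> supported_on A \<Longrightarrow> \<phi> (x + y) = \<phi> x + \<phi> y"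
    and scale: "\<And>a x. x \<in> supported_on A \<Longrightarrow> \<phi> (fscale a x) = fscale a (\<phi> x)"
    and inj: "inj_on \<phi> (supported_on A)"
  shows "card A \<le> card B"
proof -
  define cut where "cut x = (\<lambda>i. if i \<in> A then x i else (0::'f))" for x
  have cut: "cut x \<in> supported_on A" "cut (x + y) = cut x + cut y" "cut (fscale a x)
    = fscale a (cut x)"
    for x y a by (auto simp: cut_def supported_on_def fun_eq_iff)
  have cut_id: "cut x = x" if "x \<in> supported_on A" for x
    using that by (auto simp: cut_def supported_on_def fun_eq_iff)
  have lin: "Vector_Spaces.linear fscale fscale (\<lambda>x. \<phi> (cut x))"
    by unfold_locales (simp_all add: cut add scale)
  have sp: "fn.span (unit_vector ` A) = (supported_on A :: ('i \<Rightarrow> 'f) set)"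
    by (rule span_unit_vectors[OF fin(1)])
  let ?U = "(\<lambda>x. \<phi> (cut x)) ` (unit_vector ` A)"
  have inj': "inj_on (\<lambda>x. \<phi> (cut x)) (supported_on A)"
    using inj cut_id by (auto simp: inj_on_def)
  have "fn.independent ?U"
    by (rule fnp.linear_independent_injective_image[OF lin independent_unit_vectors[OF fin(1)]])
      (simp add: sp inj')
  moreover have "?U \<subseteq> fn.span (unit_vector ` B)"
    unfolding span_unit_vectors[OF fin(2)] using maps cut by auto
  ultimately have "card ?U \<le> card (unit_vector ` B :: ('j \<Rightarrow> 'f) set)"
    using fn.independent_span_bound[OF finite_imageI[OF fin(2)]] by blast
  moreover have "unit_vector ` A \<subseteq> (supported_on A :: ('i \<Rightarrow> 'f) set)"
    by (auto simp: supported_on_def unit_vector_def split: if_splits)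
  then have "card ?U = card (unit_vector ` A :: ('i \<Rightarrow> 'f) set)"
    by (intro card_image inj_on_subset[OF inj'])
  ultimately show ?thesis
    by (simp add: card_image inj_on_subset[OF inj_unit_vector])
qed

section \<open>Interval decompositions are unique\<close>

text \<open>
  The operations of a persistence module are arbitrary functions, so that an isomorphism can be
  inverted on sums and multiples only if these stay in the carriers.
\<close>

definition closed_pmodule :: "('f, 'v) pmodule \<Rightarrow> bool" where
  "closed_pmodule V \<longleftrightarrow>
     (\<forall>t\<ge>0. \<forall>x\<in>vcarrier (pspace V t).
        (\<forall>y\<in>vcarrier (pspace V t). vadd (pspace V t) x y \<in> vcarrier (pspace V t)) \<and>
        (\<forall>a. vscale (pspace V t) a x \<in> vcarrier (pspace V t))) \<and>
     (\<forall>s t. 0 \<le> s \<and> s \<le> t \<longrightarrow> (\<forall>x\<in>vcarrier (pspace V s). pshift V s t x \<in> vcarrier (pspace V t)))"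

abbreviation interval_sum :: "real set list \<Rightarrow> ('f::field, nat \<Rightarrow> 'f) pmodule" where
  "interval_sum Is \<equiv> direct_sum (map interval_module Is)"

lemma interval_sum_carrier:
  "vcarrier (pspace (interval_sum Is) t) =
     {x \<in> extensional {..<length Is}. \<forall>i<length Is. t \<notin> Is ! i \<longrightarrow> x i = 0}"
  by (auto simp: direct_sum_def interval_module_def PiE_def Pi_def)

lemma interval_sum_add:
  "vadd (pspace (interval_sum Is) t) x y = (\<lambda>i\<in>{..<length Is}. x i + y i)"
  by (auto simp: direct_sum_def interval_module_def fun_eq_iff restrict_def)

lemma interval_sum_scale:
  "vscale (pspace (interval_sum Is) t) a x = (\<lambda>i\<in>{..<length Is}. a * x i)"
  by (auto simp: direct_sum_def interval_module_def fun_eq_iff restrict_def)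

lemma interval_sum_shift:
  "pshift (interval_sum Is) s t x = (\<lambda>i\<in>{..<length Is}. if s \<in> Is ! i \<and> t \<in> Is ! i then x i else 0)"
  by (auto simp: direct_sum_def interval_module_def fun_eq_iff restrict_def)

text \<open>
  Both cardinalities are the rank of the shift from \<open>s\<close> to \<open>t\<close>. In the proof, a vector \<open>x\<close>
  supported on the first index set is transported to \<open>v x\<close> in \<open>V\<close> and on to the second
  decomposition, and only the coordinates of intervals that contain \<open>s\<close> and \<open>t\<close> are kept. Nothing
  is lost: these coordinates determine the image under the shift, and the shift fixes \<open>x\<close>.
\<close>

lemma card_intervals_le:
  fixes V :: "('f::field, 'v) pmodule"
  assumes cl: "closed_pmodule V"
    and iso: "pmodule_isomorphic V (interval_sum Is)" "pmodule_isomorphic V (interval_sum Js)"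
    and st: "0 \<le> s" "s \<le> t"
  shows "card {i. i < length Is \<and> s \<in> Is ! i \<and> t \<in> Is ! i}
       \<le> card {j. j < length Js \<and> s \<in> Js ! j \<and> t \<in> Js ! j}"
    (is "card ?A \<le> card ?B")
proof -
  let ?Vs = "vcarrier (pspace V s)" and ?Vt = "vcarrier (pspace V t)"
  obtain \<phi> where \<phi>: "\<forall>t\<ge>0. linear_iso (pspace V t) (pspace (interval_sum Is) t) (\<phi> t)"
    and \<phi>_shift: "\<forall>s t. 0 \<le> s \<and> s \<le> t \<longrightarrow> (\<forall>x\<in>vcarrier (pspace V s).
       \<phi> t (pshift V s t x) = pshift (interval_sum Is) s t (\<phi> s x))"
    using iso(1) unfolding pmodule_isomorphic_def by blast
  obtain \<psi> where \<psi>: "\<forall>t\<ge>0. linear_iso (pspace V t) (pspace (interval_sum Js) t) (\<psi> t)"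
    and \<psi>_shift: "\<forall>s t. 0 \<le> s \<and> s \<le> t \<longrightarrow> (\<forall>x\<in>vcarrier (pspace V s).
       \<psi> t (pshift V s t x) = pshift (interval_sum Js) s t (\<psi> s x))"
    using iso(2) unfolding pmodule_isomorphic_def by blast
  have t: "0 \<le> t" using st by simp
  have bij_s: "bij_betw (\<phi> s) ?Vs (vcarrier (pspace (interval_sum Is) s))"
    and bij_t: "bij_betw (\<psi> t) ?Vt (vcarrier (pspace (interval_sum Js) t))"
    using \<phi> \<psi> st t unfolding linear_iso_def by auto
  have add\<phi>: "\<phi> s (vadd (pspace V s) x y) = (\<lambda>i\<in>{..<length Is}. \<phi> s x i + \<phi> s y i)"
    and scale\<phi>: "\<phi> s (vscale (pspace V s) a x) = (\<lambda>i\<in>{..<length Is}. a * \<phi> s x i)"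
    and add\<psi>: "\<psi> s (vadd (pspace V s) x y) = (\<lambda>i\<in>{..<length Js}. \<psi> s x i + \<psi> s y i)"
    and scale\<psi>: "\<psi> s (vscale (pspace V s) a x) = (\<lambda>i\<in>{..<length Js}. a * \<psi> s x i)"
    if "x \<in> ?Vs" "y \<in> ?Vs" for x y a
    using \<phi> \<psi> st that unfolding linear_iso_def interval_sum_add interval_sum_scale by auto
  have closed: "vadd (pspace V s) x y \<in> ?Vs" "vscale (pspace V s) a x \<in> ?Vs" "pshift V s t x \<in> ?Vt"
    if "x \<in> ?Vs" "y \<in> ?Vs" for x y a
    using cl st that unfolding closed_pmodule_def by auto
  define X where "X x = (\<lambda>i\<in>{..<length Is}. x i)" for x :: "nat \<Rightarrow> 'f"
  have X: "X x \<in> vcarrier (pspace (interval_sum Is) s)" if "x \<in> supported_on ?A" for x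
    using that by (auto simp: X_def interval_sum_carrier supported_on_def)
  have X_shift: "pshift (interval_sum Is) s t (X x) = X x" if "x \<in> supported_on ?A" for x
    using that by (fastforce simp: X_def interval_sum_shift supported_on_def fun_eq_iff restrict_def)
  define v where "v x = inv_into ?Vs (\<phi> s) (X x)" for x
  have v: "v x \<in> ?Vs" "\<phi> s (v x) = X x" if "x \<in> supported_on ?A" for x
    using bij_s X[OF that] unfolding v_def bij_betw_def
    by (auto intro: inv_into_into f_inv_into_f)
  have v_eq: "y = v x" if "y \<in> ?Vs" "\<phi> s y = X x" "x \<in> supported_on ?A" for x y
    using bij_s v[OF that(3)] that(1,2) unfolding bij_betw_def inj_on_def by metis
  have supp: "x + y \<in> supported_on ?A" "fscale a x \<in> supported_on ?A"
    if "x \<in> supported_on ?A" "y \<in> supported_on ?A" for x y :: "nat \<Rightarrow> 'f" and a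
    using that by (auto simp: supported_on_def, metis add_0, metis add_0, metis add_0)
  have v_add: "v (x + y) = vadd (pspace V s) (v x) (v y)"
    if "x \<in> supported_on ?A" "y \<in> supported_on ?A" for x y
    by (rule v_eq[symmetric])
      (use that in \<open>simp_all add: closed add\<phi> v supp X_def fun_eq_iff restrict_def\<close>)
  have v_scale: "v (fscale a x) = vscale (pspace V s) a (v x)"
    if "x \<in> supported_on ?A" for x a
    by (rule v_eq[symmetric])
      (use that in \<open>simp_all add: closed[OF _ v(1)] scale\<phi>[OF _ v(1)] v supp(2)[OF that that]
        X_def fun_eq_iff restrict_def\<close>)
  have \<phi>_v: "\<phi> t (pshift V s t (v x)) = pshift (interval_sum Is) s t (\<phi> s (v x))"
    if "x \<in> supported_on ?A" for x
    using \<phi>_shift st v(1)[OF that] by blast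
  define G where "G x = (\<lambda>j. if j \<in> ?B then \<psi> s (v x) j else 0)" for x
  show ?thesis
  proof (rule card_le_of_injective_linear[of ?A ?B G])
    show "finite ?A" "finite ?B" by auto
    show "G x \<in> supported_on ?B" for x
      by (auto simp: G_def supported_on_def)
    show "G (x + y) = G x + G y" if "x \<in> supported_on ?A" "y \<in> supported_on ?A" for x y
      using that by (simp add: G_def v_add add\<psi> v fun_eq_iff)
    show "G (fscale a x) = fscale a (G x)" if "x \<in> supported_on ?A" for x a
      using that by (simp add: G_def v_scale scale\<psi>[OF v(1) v(1)] fun_eq_iff)
    show "inj_on G (supported_on ?A)"
    proof (rule inj_onI)
      fix x y assume xy: "x \<in> supported_on ?A" "y \<in> supported_on ?A" and eq: "G x = G y"
      have "\<psi> s (v x) j = \<psi> s (v y) j" if "j \<in> ?B" for j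
        using fun_cong[OF eq, of j] that by (simp add: G_def)
      then have "pshift (interval_sum Js) s t (\<psi> s (v x)) = pshift (interval_sum Js) s t (\<psi> s (v y))"
        unfolding interval_sum_shift by (auto simp: fun_eq_iff restrict_def)
      then have "\<psi> t (pshift V s t (v x)) = \<psi> t (pshift V s t (v y))"
        using \<psi>_shift st v(1) xy by simp
      then have "pshift V s t (v x) = pshift V s t (v y)"
        by (rule inj_onD[OF bij_betw_imp_inj_on[OF bij_t]])
          (rule closed(3)[OF v(1) v(1)], rule xy, rule xy)+
      then have "pshift (interval_sum Is) s t (\<phi> s (v x)) = pshift (interval_sum Is) s t (\<phi> s (v y))"
        by (simp only: \<phi>_v[OF xy(1), symmetric] \<phi>_v[OF xy(2), symmetric])
      then have "pshift (interval_sum Is) s t (X x) = pshift (interval_sum Is) s t (X y)"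
        by (simp only: v(2)[OF xy(1)] v(2)[OF xy(2)])
      then have "X x = X y" using X_shift xy by simp
      have "x i = y i" for i
      proof (cases "i < length Is")
        case True
        then show ?thesis using fun_cong[OF \<open>X x = X y\<close>, of i] by (simp add: X_def)
      next
        case False
        then have "x i = 0" "y i = 0" using xy unfolding supported_on_def by blast+
        then show ?thesis by simp
      qed
      then show "x = y" by blast
    qed
  qed
qed

text \<open>
  For a maximal interval \<open>I\<close> of a finite family there are \<open>s\<close> and \<open>t\<close> such that \<open>I\<close> is the only
  interval of the family containing both: choose a point of \<open>I\<close> outside each member that does not
  contain \<open>I\<close>, and let \<open>s\<close> and \<open>t\<close> be the extreme ones. Hence the rank at \<open>s\<close> and \<open>t\<close> detects \<open>I\<close>.
\<close>

lemma rank_detects_maximal_interval: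
  fixes A B :: "real set multiset"
  assumes int: "\<And>J. J \<in># A + B \<Longrightarrow> is_interval J \<and> J \<subseteq> {0..}"
    and ne: "I \<noteq> {}" and IA: "I \<in># A" and IB: "I \<notin># B"
    and max: "\<And>J. J \<in># A + B \<Longrightarrow> I \<subseteq> J \<Longrightarrow> J = I"
    and rank: "\<And>s t. 0 \<le> s \<Longrightarrow> s \<le> t \<Longrightarrow>
      size {#J \<in># A. s \<in> J \<and> t \<in> J#} = size {#J \<in># B. s \<in> J \<and> t \<in> J#}"
  shows False
proof -
  obtain x0 where x0: "x0 \<in> I" using ne by blast
  let ?bad = "{J \<in> set_mset (A + B). \<not> I \<subseteq> J}"
  have "\<forall>J\<in>?bad. \<exists>p. p \<in> I \<and> p \<notin> J" by blast
  then obtain p where p: "\<And>J. J \<in> ?bad \<Longrightarrow> p J \<in> I \<and> p J \<notin> J" by metis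
  define pts where "pts = insert x0 (p ` ?bad)"
  have pts: "finite pts" "pts \<noteq> {}" "pts \<subseteq> I" unfolding pts_def using p x0 by auto
  define s t where "s = Min pts" and "t = Max pts"
  have st: "s \<in> I" "t \<in> I" "s \<le> t"
    using subsetD[OF pts(3) Min_in[OF pts(1,2)]] subsetD[OF pts(3) Max_in[OF pts(1,2)]]
      Min_le[OF pts(1) Max_in[OF pts(1,2)]] unfolding s_def t_def by simp_all
  have "0 \<le> s" using st int[of I] IA by auto
  have sup: "J = I" if "J \<in># A + B" "s \<in> J" "t \<in> J" for J
  proof (rule ccontr)
    assume "J \<noteq> I"
    then have "J \<in> ?bad" using max that by blast
    moreover have "p J \<in> J"
    proof -
      have "p J \<in> pts" using \<open>J \<in> ?bad\<close> unfolding pts_def by blast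
      then have "s \<le> p J" "p J \<le> t" using pts(1) unfolding s_def t_def by auto
      then show ?thesis using int[OF that(1)] that(2,3) unfolding is_interval_1 by blast
    qed
    ultimately show False using p by blast
  qed
  have "I \<in># {#J \<in># A. s \<in> J \<and> t \<in> J#}" using IA st by simp
  then have "{#J \<in># A. s \<in> J \<and> t \<in> J#} \<noteq> {#}" by (metis empty_not_add_mset multi_member_split)
  then have "{#J \<in># B. s \<in> J \<and> t \<in> J#} \<noteq> {#}"
    using rank[OF \<open>0 \<le> s\<close> st(3)] by (metis size_eq_0_iff_empty)
  then obtain J where "J \<in># {#J \<in># B. s \<in> J \<and> t \<in> J#}" by blast
  then have "J \<in># B" "s \<in> J" "t \<in> J" by auto
  then show False using sup[of J] IB by auto
qed

text \<open>
  After cancelling the common part, a maximal remaining interval occurs on one side only, although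
  the ranks on both sides agree.
\<close>

lemma interval_multiset_eqI:
  fixes A B :: "real set multiset"
  assumes int: "\<And>J. J \<in># A + B \<Longrightarrow> J \<noteq> {} \<and> J \<subseteq> {0..} \<and> is_interval J"
    and rank: "\<And>s t. 0 \<le> s \<Longrightarrow> s \<le> t \<Longrightarrow>
      size {#J \<in># A. s \<in> J \<and> t \<in> J#} = size {#J \<in># B. s \<in> J \<and> t \<in> J#}"
  shows "A = B"
proof (rule ccontr)
  assume "A \<noteq> B"
  define C D where "C = A - B" and "D = B - A"
  have AB: "A = A \<inter># B + C" "B = A \<inter># B + D"
    unfolding C_def D_def by (auto simp: multiset_eq_iff)
  have disj: "J \<in># C \<Longrightarrow> J \<notin># D" for J
    unfolding C_def D_def by (simp add: in_diff_count)
  have rank': "size {#J \<in># C. s \<in> J \<and> t \<in> J#} = size {#J \<in># D. s \<in> J \<and> t \<in> J#}"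
    if "0 \<le> s" "s \<le> t" for s t
  proof -
    have "size {#J \<in># A. s \<in> J \<and> t \<in> J#} =
        size {#J \<in># A \<inter># B. s \<in> J \<and> t \<in> J#} + size {#J \<in># C. s \<in> J \<and> t \<in> J#}"
      by (subst AB(1)) (simp only: filter_union_mset size_union)
    moreover have "size {#J \<in># B. s \<in> J \<and> t \<in> J#} =
        size {#J \<in># A \<inter># B. s \<in> J \<and> t \<in> J#} + size {#J \<in># D. s \<in> J \<and> t \<in> J#}"
      by (subst AB(2)) (simp only: filter_union_mset size_union)
    ultimately show ?thesis using rank[OF that] by simp
  qed
  have int': "is_interval J \<and> J \<subseteq> {0..} \<and> J \<noteq> {}" if "J \<in># C \<or> J \<in># D" for J
    using that in_diffD[of J A B] in_diffD[of J B A] int[of J] unfolding C_def D_def by auto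
  have "C + D \<noteq> {#}" using AB \<open>A \<noteq> B\<close> by auto
  then have "finite (set_mset (C + D))" "set_mset (C + D) \<noteq> {}" by auto
  then obtain I where I: "I \<in># C + D" "\<And>J. J \<in># C + D \<Longrightarrow> I \<subseteq> J \<Longrightarrow> J = I"
    using finite_has_maximal[of "set_mset (C + D)"] by metis
  consider "I \<in># C" "I \<notin># D" | "I \<in># D" "I \<notin># C" using I disj by auto
  then show False
  proof cases
    case 1
    show False
    proof (rule rank_detects_maximal_interval[of C D I])
      show "is_interval J \<and> J \<subseteq> {0..}" if "J \<in># C + D" for J
        using int'[of J] that by auto
      show "I \<noteq> {}" using int'[of I] 1 by blast
    qed (use 1 I rank' in auto)
  next
    case 2
    show False
    proof (rule rank_detects_maximal_interval[of D C I])
      show "is_interval J \<and> J \<subseteq> {0..}" if "J \<in># D + C" for J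
        using int'[of J] that by auto
      show "I \<noteq> {}" using int'[of I] 2 by blast
    qed (use 2 I rank' in auto)
  qed
qed

lemma intervals_of_eq:
  fixes V :: "('f::field, 'v) pmodule"
  assumes cl: "closed_pmodule V" and dec: "interval_decomposition V Is"
  shows "intervals_of V = mset Is"
proof -
  have "mset Js = mset Is" if Js: "interval_decomposition V Js" for Js
  proof (rule interval_multiset_eqI)
    show "J \<noteq> {} \<and> J \<subseteq> {0..} \<and> is_interval J" if "J \<in># mset Js + mset Is" for J
      using that Js dec unfolding interval_decomposition_def by auto
    fix s t :: real assume st: "0 \<le> s" "s \<le> t"
    have iso: "pmodule_isomorphic V (interval_sum Js)" "pmodule_isomorphic V (interval_sum Is)"
      using Js dec unfolding interval_decomposition_def by auto
    have "size {#J \<in># mset Ks. s \<in> J \<and> t \<in> J#}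
      = card {i. i < length Ks \<and> s \<in> Ks ! i \<and> t \<in> Ks ! i}" for Ks
      by (simp flip: mset_filter add: length_filter_conv_card)
    then show "size {#J \<in># mset Js. s \<in> J \<and> t \<in> J#} = size {#J \<in># mset Is. s \<in> J \<and> t \<in> J#}"
      using card_intervals_le[OF cl iso st] card_intervals_le[OF cl iso(2,1) st] by simp
  qed
  then show ?thesis
    unfolding intervals_of_def using someI[of "interval_decomposition V", OF dec] by blast
qed

lemma interval_decomposition_trans:
  assumes iso: "pmodule_isomorphic V W" and dec: "interval_decomposition W Is"
  shows "interval_decomposition V Is"
proof -
  obtain \<phi> where \<phi>: "\<And>t. 0 \<le> t \<Longrightarrow> linear_iso (pspace V t) (pspace W t) (\<phi> t)"
    "\<And>s t x. 0 \<le> s \<Longrightarrow> s \<le> t \<Longrightarrow> x \<in> vcarrier (pspace V s) \<Longrightarrow>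
        \<phi> t (pshift V s t x) = pshift W s t (\<phi> s x)"
    using iso unfolding pmodule_isomorphic_def by blast
  let ?S = "interval_sum Is"
  have iso': "pmodule_isomorphic W ?S" using dec unfolding interval_decomposition_def by blast
  obtain \<psi> where \<psi>: "\<And>t. 0 \<le> t \<Longrightarrow> linear_iso (pspace W t) (pspace ?S t) (\<psi> t)"
    "\<And>s t x. 0 \<le> s \<Longrightarrow> s \<le> t \<Longrightarrow> x \<in> vcarrier (pspace W s) \<Longrightarrow>
        \<psi> t (pshift W s t x) = pshift ?S s t (\<psi> s x)"
    using iso' unfolding pmodule_isomorphic_def by blast
  have mem: "\<phi> t x \<in> vcarrier (pspace W t)" if "0 \<le> t" "x \<in> vcarrier (pspace V t)" for t x
    using \<phi>(1)[OF that(1)] that(2) unfolding linear_iso_def bij_betw_def by blast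
  have "linear_iso (pspace V t) (pspace ?S t) (\<psi> t \<circ> \<phi> t)" if t: "0 \<le> t" for t
    using \<phi>(1)[OF t] \<psi>(1)[OF t] mem[OF t] unfolding linear_iso_def
    by (auto intro: bij_betw_trans)
  moreover have "(\<psi> t \<circ> \<phi> t) (pshift V s t x) = pshift ?S s t ((\<psi> s \<circ> \<phi> s) x)"
    if "0 \<le> s" "s \<le> t" "x \<in> vcarrier (pspace V s)" for s t x
    using that \<phi>(2) \<psi>(2) mem by simp
  ultimately have "pmodule_isomorphic V ?S"
    unfolding pmodule_isomorphic_def by (intro exI[of _ "\<lambda>t. \<psi> t \<circ> \<phi> t"]) auto
  then show ?thesis using dec unfolding interval_decomposition_def by blast
qed

section \<open>Alternating chains and the augmented boundary\<close>

text \<open>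
  The sign rule for arbitrary permutations follows from adjacent transpositions, and in this form
  it is compatible with recursion over lists. The second clause is a separate requirement because
  in characteristic 2 it does not follow from the first.
\<close>

definition alternating :: "('a list \<Rightarrow> 'f::field) \<Rightarrow> bool" where
  "alternating c \<longleftrightarrow> (\<forall>xs a b ys. c (xs @ a # b # ys) = - c (xs @ b # a # ys)) \<and>
     (\<forall>xs a ys. c (xs @ a # a # ys) = 0)"

lemma alternating_swap_adjacent: "alternating c \<Longrightarrow> c (xs @ a # b # ys) = - c (xs @ b # a # ys)"
  unfolding alternating_def by blast

lemma alternating_adjacent_eq: "alternating c \<Longrightarrow> c (xs @ a # a # ys) = 0"
  unfolding alternating_def by blast

lemma alternating_repeat:
  assumes "alternating c"
  shows "c (us @ a # vs @ a # ws) = 0"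
proof (induction vs arbitrary: us)
  case Nil
  then show ?case using alternating_adjacent_eq[OF assms] by simp
next
  case (Cons v vs)
  then show ?case
    using alternating_swap_adjacent[OF assms, of us a v "vs @ a # ws"] Cons[of "us @ [v]"] by simp
qed

lemma alternating_distinct:
  assumes "alternating c" "c xs \<noteq> 0"
  shows "distinct xs"
proof (rule ccontr)
  assume "\<not> distinct xs"
  then obtain us a vs ws where "xs = us @ [a] @ vs @ [a] @ ws" using not_distinct_decomp by blast
  then show False using alternating_repeat[OF assms(1)] assms(2) by simp
qed

lemma alternating_swap:
  assumes "alternating c"
  shows "c (us @ a # vs @ b # ws) = - c (us @ b # vs @ a # ws)"
proof (induction vs arbitrary: us)
  case Nil
  show ?case
    unfolding append_Nil by (rule alternating_swap_adjacent[OF assms])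
next
  case (Cons v vs)
  have "c (us @ a # v # vs @ b # ws) = - c (us @ v # a # vs @ b # ws)"
    by (rule alternating_swap_adjacent[OF assms])
  also have "c (us @ v # a # vs @ b # ws) = - c (us @ v # b # vs @ a # ws)"
    using Cons[of "us @ [v]"] by simp
  also have "c (us @ v # b # vs @ a # ws) = - c (us @ b # v # vs @ a # ws)"
    by (rule alternating_swap_adjacent[OF assms])
  finally show ?case by simp
qed

lemma permute_list_transpose:
  assumes "i < length xs" "j < length xs"
  shows "permute_list (Transposition.transpose i j) xs = xs[i := xs ! j, j := xs ! i]"
  using assms by (intro nth_equalityI)
    (auto simp: permute_list_def Transposition.transpose_def nth_list_update)

lemma alternating_transpose:
  assumes "alternating c" "i < length xs" "j < length xs" "i \<noteq> j"
  shows "c (permute_list (Transposition.transpose i j) xs) = - c xs"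
proof -
  have *: "c (permute_list (Transposition.transpose i j) xs) = - c xs" if "i < j" "j < length xs"
    for i j
  proof -
    have "i < length xs" using that by simp
    from id_take_nth_drop[OF this]
    obtain us x r where 1: "xs = us @ x # r" "length us = i" using that by fastforce
    define m where "m = j - Suc i"
    have m: "j = i + Suc m" "m < length r" unfolding m_def using that 1 by auto
    from id_take_nth_drop[OF m(2)]
    obtain vs y ws where 2: "r = vs @ y # ws" "length vs = m" using m(2) by fastforce
    have "permute_list (Transposition.transpose i j) xs = us @ y # vs @ x # ws"
      unfolding permute_list_transpose[OF \<open>i < length xs\<close> that(2)]
      using 1 2 m(1) by (auto simp: list_update_append nth_append)
    then show ?thesis using alternating_swap[OF assms(1), of us y vs x ws] 1 2 by simp
  qed
  show ?thesis using *[of i j] *[of j i] assms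
    by (cases "i < j") (auto simp: Transposition.transpose_commute)
qed

lemma alternating_permute:
  assumes c: "alternating c" and p: "p permutes {..<length xs}"
  shows "c (permute_list p xs) = of_int (sign p) * c xs"
proof -
  have "length ys = length xs \<longrightarrow> c (permute_list p ys) = of_int (sign p) * c ys" for ys
    using p finite_lessThan
  proof (induction p arbitrary: ys rule: permutes_induct)
    case id
    show ?case by simp
  next
    case (swap a b p)
    let ?t = "Transposition.transpose a b"
    show ?case
    proof
      assume len: "length ys = length xs"
      have "permute_list (?t \<circ> p) ys = permute_list p (permute_list ?t ys)"
        by (rule permute_list_compose) (use swap len in simp)
      then have "c (permute_list (?t \<circ> p) ys) = of_int (sign p) * c (permute_list ?t ys)"
        using swap.IH len by simp
      also have "c (permute_list ?t ys) = - c ys"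
        by (rule alternating_transpose[OF c]) (use swap len in auto)
      also have "sign (?t \<circ> p) = - sign p"
        using swap.hyps by (simp add: sign_compose permutation_swap_id sign_swap_id
            permutes_imp_permutation[OF finite_lessThan])
      then have "of_int (sign p) * - c ys = of_int (sign (?t \<circ> p)) * c ys" by simp
      finally show "c (permute_list (?t \<circ> p) ys) = of_int (sign (?t \<circ> p)) * c ys" .
    qed
  qed
  then show ?thesis by simp
qed

lemma chains_iff:
  "c \<in> chains k K \<longleftrightarrow> alternating c \<and> (\<forall>xs. c xs \<noteq> 0 \<longrightarrow> length xs = Suc k \<and> set xs \<in> K)"
proof
  assume c: "c \<in> chains k K"
  then have perm: "\<And>xs p. p permutes {..<length xs} \<Longrightarrow> c (permute_list p xs) = of_int (sign p) * c xs"
    and supp: "\<And>xs. c xs \<noteq> 0 \<Longrightarrow> length xs = Suc k \<and> distinct xs \<and> set xs \<in> K"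
    unfolding chains_def by blast+
  have "c (xs @ a # b # ys) = - c (xs @ b # a # ys)" for xs a b ys
  proof -
    let ?p = "Transposition.transpose (length xs) (Suc (length xs))"
    have "permute_list ?p (xs @ b # a # ys) = xs @ a # b # ys"
      by (subst permute_list_transpose) (auto simp: list_update_append nth_append)
    moreover have "?p permutes {..<length (xs @ b # a # ys)}"
      by (rule permutes_swap_id) auto
    ultimately show ?thesis using perm[of ?p "xs @ b # a # ys"] by (simp add: sign_swap_id)
  qed
  moreover have "c (xs @ a # a # ys) = 0" for xs a ys
    using supp[of "xs @ a # a # ys"] by fastforce
  ultimately show "alternating c \<and> (\<forall>xs. c xs \<noteq> 0 \<longrightarrow> length xs = Suc k \<and> set xs \<in> K)"
    using supp unfolding alternating_def by blast
next
  assume "alternating c \<and> (\<forall>xs. c xs \<noteq> 0 \<longrightarrow> length xs = Suc k \<and> set xs \<in> K)"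
  then show "c \<in> chains k K"
    unfolding chains_def using alternating_distinct[of c] alternating_permute[of c] by blast
qed

lemma alternating_linear:
  "alternating (0 :: 'a list \<Rightarrow> 'f::field)"
  "alternating c \<Longrightarrow> alternating d \<Longrightarrow> alternating (c + d)"
  "alternating c \<Longrightarrow> alternating (fscale a c)"
  for c d :: "'a list \<Rightarrow> 'f::field"
proof -
  show "alternating (0 :: 'a list \<Rightarrow> 'f)" by (simp add: alternating_def)
  show "alternating (fscale a c)" if c: "alternating c" for a c
    unfolding alternating_def fscale_apply
    by (metis c alternating_swap_adjacent alternating_adjacent_eq mult_minus_right mult_zero_right)
  show "alternating (c + d)" if "alternating c" "alternating d"
    unfolding alternating_def plus_fun_apply
  proof (intro conjI allI)
    fix xs ys a b
    show "c (xs @ a # b # ys) + d (xs @ a # b # ys) = - (c (xs @ b # a # ys) + d (xs @ b # a # ys))"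
      using alternating_swap_adjacent[OF that(1), of xs a b ys]
        alternating_swap_adjacent[OF that(2), of xs a b ys] by (simp only: minus_add_distrib)
    show "c (xs @ a # a # ys) + d (xs @ a # a # ys) = 0"
      using that by (simp add: alternating_adjacent_eq)
  qed
qed

lemma alternating_Cons: "alternating c \<Longrightarrow> alternating (\<lambda>ys. c (v # ys))"
  unfolding alternating_def by (metis append_Cons)

lemma subspace_chains: "fn.subspace (chains k K)"
proof (rule fn.subspaceI)
  show "0 \<in> chains k K" by (simp add: chains_iff alternating_linear)
  show "c + d \<in> chains k K" if "c \<in> chains k K" "d \<in> chains k K" for c d
    using that unfolding chains_iff by (auto simp: alternating_linear) (metis add_0)+
  show "fscale a c \<in> chains k K" if "c \<in> chains k K" for a c
    using that unfolding chains_iff by (auto simp: alternating_linear)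
qed

text \<open>
  The boundary with respect to a fixed vertex set, without the case distinction for the empty
  list: it is the boundary of the augmented complex, whose cycles in degree \<open>0\<close> are the chains of
  total weight \<open>0\<close>. Fixing \<open>X\<close> makes it the same linear map for all complexes on \<open>X\<close>.
\<close>

definition bd :: "'a set \<Rightarrow> ('a list \<Rightarrow> 'f::field) \<Rightarrow> 'a list \<Rightarrow> 'f" where
  "bd X c = (\<lambda>ys. \<Sum>v\<in>X. c (v # ys))"

lemma linear_bd: "Vector_Spaces.linear fscale fscale (bd X)"
  by unfold_locales (auto simp: bd_def fun_eq_iff sum.distrib sum_distrib_left)

lemmas bd_add = linear_bd[THEN fnp.linear_add]
  and bd_diff = linear_bd[THEN fnp.linear_diff]
  and bd_scale = linear_bd[THEN fnp.linear_scale]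
  and bd_0 = linear_bd[THEN fnp.linear_0]

lemma alternating_bd:
  assumes "alternating c"
  shows "alternating (bd X c)"
  unfolding alternating_def
proof (intro conjI allI)
  fix xs ys a b
  have "c (v # xs @ a # b # ys) = - c (v # xs @ b # a # ys)" for v
    by (rule alternating_swap_adjacent[OF alternating_Cons[OF assms]])
  then show "bd X c (xs @ a # b # ys) = - bd X c (xs @ b # a # ys)"
    by (simp add: bd_def sum_negf)
next
  fix xs ys a
  have "c (v # xs @ a # a # ys) = 0" for v
    by (rule alternating_adjacent_eq[OF alternating_Cons[OF assms]])
  then show "bd X c (xs @ a # a # ys) = 0" by (simp add: bd_def)
qed

text \<open>
  The pairs \<open>(v, w)\<close> and \<open>(w, v)\<close> cancel. The sum being equal to its own negative would not
  suffice in characteristic 2.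
\<close>

lemma sum_antisymmetric:
  fixes h :: "'a \<Rightarrow> 'a \<Rightarrow> 'f::ab_group_add"
  assumes "finite X" "\<And>v w. h v w = - h w v" "\<And>v. h v v = 0"
  shows "(\<Sum>v\<in>X. \<Sum>w\<in>X. h v w) = 0"
  using assms(1)
proof (induction X)
  case (insert x X)
  have "(\<Sum>v\<in>X. h v x) = - (\<Sum>w\<in>X. h x w)"
    by (subst assms(2)) (simp add: sum_negf)
  then show ?case using insert assms(3) by (simp add: sum.distrib)
qed simp

lemma bd_bd:
  assumes "finite X" "alternating c"
  shows "bd X (bd X c) = 0"
proof
  fix ys
  show "bd X (bd X c) ys = 0 ys"
    unfolding bd_def zero_fun_apply
  proof (rule sum_antisymmetric[OF assms(1)])
    show "c (w # v # ys) = - c (v # w # ys)" "c (v # v # ys) = 0" for v w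
      using alternating_swap_adjacent[OF assms(2), of "[]" w v ys]
        alternating_adjacent_eq[OF assms(2), of "[]" v ys] by simp_all
  qed
qed

text \<open>
  Exterior multiplication by a vertex: on an oriented simplex it puts \<open>w\<close> in front. The recursion
  is the expansion over the positions at which \<open>w\<close> may occur, each position contributing its sign.
\<close>

fun wedge :: "'a \<Rightarrow> ('a list \<Rightarrow> 'f::field) \<Rightarrow> 'a list \<Rightarrow> 'f" where
  "wedge w c [] = 0"
| "wedge w c (y # ys) = (if y = w then c ys else 0) - wedge w (\<lambda>zs. c (y # zs)) ys"

lemma wedge_linear:
  "wedge w (\<lambda>zs. c zs + d zs) ys = wedge w c ys + wedge w d ys"
  "wedge w (\<lambda>zs. - c zs) ys = - wedge w c ys"
  "wedge w (\<lambda>zs. a * c zs) ys = a * wedge w c ys"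
  "wedge w (\<lambda>zs. 0) ys = 0"
  by (induction ys arbitrary: c d) (auto simp: algebra_simps)

lemma wedge_0 [simp]: "wedge w 0 = 0"
  by (rule ext) (simp only: zero_fun_def wedge_linear)

lemma wedge_sum: "wedge w (\<lambda>zs. \<Sum>v\<in>X. f v zs) ys = (\<Sum>v\<in>X. wedge w (f v) ys)"
  by (induction X rule: infinite_finite_induct) (simp_all add: wedge_linear)

text \<open>
  Taking the boundary is contraction with the sum of all coordinate functionals, hence an
  antiderivation of the exterior algebra. This identity produces all the chain homotopies below.
\<close>

lemma bd_wedge:
  assumes "finite X" "w \<in> X"
  shows "bd X (wedge w c) = c - wedge w (bd X c)"
  using assms by (simp add: bd_def fun_eq_iff wedge_sum sum_subtractf)

lemma alternating_wedge:
  assumes "alternating c"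
  shows "alternating (wedge w c)"
proof -
  have 1: "wedge w c (xs @ a # b # ys) = - wedge w c (xs @ b # a # ys)" if "alternating c"
    for xs a b ys c
    using that
  proof (induction xs arbitrary: c)
    case Nil
    have "(\<lambda>zs. c (a # b # zs)) = (\<lambda>zs. - c (b # a # zs))"
      by (rule ext) (rule alternating_swap_adjacent[OF Nil, of "[]", unfolded append_Nil])
    then show ?case by (simp add: wedge_linear)
  next
    case (Cons x xs)
    show ?case
    proof (cases "x = w")
      case True
      then show ?thesis
        using Cons.IH[OF alternating_Cons[OF Cons.prems]] alternating_swap_adjacent[OF Cons.prems,
          of xs a b ys] by simp
    qed (use Cons.IH[OF alternating_Cons[OF Cons.prems]] in simp)
  qed
  have 2: "wedge w c (xs @ a # a # ys) = 0" if "alternating c" for xs a ys c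
    using that
  proof (induction xs arbitrary: c)
    case Nil
    have "(\<lambda>zs. c (a # a # zs)) = (\<lambda>zs. 0)"
      using alternating_adjacent_eq[OF Nil, of "[]"] by auto
    then show ?case by (simp add: wedge_linear)
  next
    case (Cons x xs)
    then show ?case
      using Cons.IH[OF alternating_Cons[OF Cons.prems]] alternating_adjacent_eq[OF Cons.prems, of
        xs a ys] by simp
  qed
  show ?thesis unfolding alternating_def using 1 2 assms by blast
qed

lemma wedge_nonzero:
  "wedge w c ys \<noteq> 0 \<Longrightarrow> \<exists>us vs. ys = us @ w # vs \<and> c (us @ vs) \<noteq> 0"
proof (induction ys arbitrary: c)
  case (Cons y ys)
  show ?case
  proof (cases "y = w \<and> c ys \<noteq> 0")
    case True
    then show ?thesis by (intro exI[of _ "[]"] exI[of _ ys]) auto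
  next
    case False
    then have "wedge w (\<lambda>zs. c (y # zs)) ys \<noteq> 0" using Cons.prems by (auto split: if_splits)
    from Cons.IH[OF this] obtain us vs where "ys = us @ w # vs" "c (y # us @ vs) \<noteq> 0" by blast
    then show ?thesis by (intro exI[of _ "y # us"] exI[of _ vs]) auto
  qed
qed simp

lemma wedge_chain:
  assumes "alternating c" "\<And>xs. c xs \<noteq> 0 \<Longrightarrow> length xs = k \<and> insert w (set xs) \<in> K"
  shows "wedge w c \<in> chains k K"
  unfolding chains_iff
proof (intro conjI allI impI)
  show "alternating (wedge w c)" by (rule alternating_wedge[OF assms(1)])
  fix ys assume "wedge w c ys \<noteq> 0"
  from wedge_nonzero[OF this] obtain us vs where "ys = us @ w # vs" "c (us @ vs) \<noteq> 0" by blast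
  then show "length ys = Suc k" "set ys \<in> K" using assms(2)[of "us @ vs"] by auto
qed

definition complex_on :: "'a set \<Rightarrow> 'a set set \<Rightarrow> bool" where
  "complex_on X K \<longleftrightarrow> finite X \<and> K \<subseteq> Pow X - {{}} \<and> (\<forall>\<sigma>\<in>K. \<forall>\<tau>. \<tau> \<subseteq> \<sigma> \<and> \<tau> \<noteq> {} \<longrightarrow> \<tau> \<in> K)"

text \<open>
  Cycles of the augmented complex. Modulo boundaries they give reduced homology, see
  \<open>reduced_homology_eq\<close>.
\<close>

definition rcycles :: "'a set \<Rightarrow> nat \<Rightarrow> 'a set set \<Rightarrow> ('a list \<Rightarrow> 'f::field) set" where
  "rcycles X k K = {z \<in> chains k K. bd X z = 0}"

lemma bd_chain:
  assumes "complex_on X K" "c \<in> chains (Suc k) K"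
  shows "bd X c \<in> chains k K"
  unfolding chains_iff
proof (intro conjI allI impI)
  show "alternating (bd X c)" using assms alternating_bd unfolding chains_iff by blast
  fix ys assume "bd X c ys \<noteq> 0"
  then obtain v where v: "c (v # ys) \<noteq> 0" unfolding bd_def by (metis sum.neutral)
  then have "length (v # ys) = Suc (Suc k)" "set (v # ys) \<in> K"
    using assms(2) unfolding chains_iff by blast+
  then show "length ys = Suc k" "set ys \<in> K"
    using assms(1) unfolding complex_on_def by (auto, metis length_0_conv nat.distinct(1)
      set_empty set_subset_Cons)
qed

lemma boundary_chain:
  assumes "complex_on X K" "c \<in> chains k K"
  shows "boundary K c ys = (if ys = [] then 0 else bd X c ys)"
proof -
  have "(\<Sum>v\<in>\<Union>K. c (v # ys)) = (\<Sum>v\<in>X. c (v # ys))"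
  proof (rule sum.mono_neutral_left)
    show "finite X" "\<Union>K \<subseteq> X" using assms(1) unfolding complex_on_def by auto
    show "\<forall>v\<in>X - \<Union>K. c (v # ys) = 0"
    proof (intro ballI, rule ccontr)
      fix v assume v: "v \<in> X - \<Union>K" "c (v # ys) \<noteq> 0"
      then have "set (v # ys) \<in> K" using assms(2) unfolding chains_iff by blast
      then show False using v by auto
    qed
  qed
  then show ?thesis by (simp add: boundary_def bd_def)
qed

lemma boundaries_eq:
  assumes "complex_on X K"
  shows "boundaries k K = (bd X ` chains (Suc k) K :: ('a list \<Rightarrow> 'f::field) set)"
proof -
  have "boundary K c = bd X c" if "c \<in> chains (Suc k) K" for c :: "'a list \<Rightarrow> 'f"
  proof
    fix ys
    have "bd X c [] = 0"
      unfolding bd_def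
    proof (intro sum.neutral ballI, rule ccontr)
      fix v assume "c [v] \<noteq> 0"
      then have "length [v] = Suc (Suc k)" using that unfolding chains_iff by blast
      then show False by simp
    qed
    then show "boundary K c ys = bd X c ys" using boundary_chain[OF assms that, of ys] by simp
  qed
  then show ?thesis unfolding boundaries_def by auto
qed

lemma subspace_rcycles: "fn.subspace (rcycles X k K)"
  using subspace_chains[of k K] unfolding fn.subspace_def rcycles_def
  by (auto simp: bd_add bd_scale bd_0)

lemma subspace_boundaries:
  assumes "complex_on X K"
  shows "fn.subspace (boundaries k K)"
  unfolding boundaries_eq[OF assms]
  by (rule fnp.linear_subspace_image[OF linear_bd subspace_chains])

lemma boundaries_subset_rcycles:
  assumes "complex_on X K"
  shows "boundaries k K \<subseteq> rcycles X k K"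
proof
  fix b assume "b \<in> boundaries k K"
  then obtain c where c: "c \<in> chains (Suc k) K" "b = bd X c" unfolding boundaries_eq[OF assms]
    by blast
  then have "bd X b = 0"
    using assms by (simp add: bd_bd complex_on_def chains_iff)
  then show "b \<in> rcycles X k K" using bd_chain[OF assms c(1)] c(2) by (simp add: rcycles_def)
qed

lemma chains_mono: "K \<subseteq> L \<Longrightarrow> chains k K \<subseteq> chains k L"
  unfolding chains_iff subset_iff by blast

lemma rcycles_mono: "K \<subseteq> L \<Longrightarrow> rcycles X k K \<subseteq> rcycles X k L"
  unfolding rcycles_def using chains_mono by blast

lemma boundaries_mono:
  "complex_on X K \<Longrightarrow> complex_on X L \<Longrightarrow> K \<subseteq> L \<Longrightarrow> boundaries k K \<subseteq> boundaries k L"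
  using chains_mono[of K L] by (auto simp: boundaries_eq)

text \<open>
  A cycle \<open>z\<close> of a full simplex is the boundary of the cone over it: \<open>\<partial> (w \<and> z) = z - w \<and> \<partial> z =
  z\<close>.
\<close>

lemma rcycles_full_simplex:
  assumes "finite X"
  shows "rcycles X k (Pow X - {{}}) \<subseteq> (boundaries k (Pow X - {{}}) :: ('a list \<Rightarrow> 'f::field) set)"
proof
  have co: "complex_on X (Pow X - {{}})" using assms by (auto simp: complex_on_def)
  fix z :: "'a list \<Rightarrow> 'f" assume z: "z \<in> rcycles X k (Pow X - {{}})"
  show "z \<in> boundaries k (Pow X - {{}})"
  proof (cases "X = {}")
    case True
    have "z xs = 0" for xs
    proof (rule ccontr)
      assume "z xs \<noteq> 0"
      then have "set xs \<in> Pow X - {{}}" using z unfolding rcycles_def chains_iff by blast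
      then show False using True by simp
    qed
    then have "z = 0" by auto
    then show ?thesis using fn.subspace_0[OF subspace_boundaries[OF co]] by simp
  next
    case False
    then obtain w where w: "w \<in> X" by blast
    have "wedge w z \<in> chains (Suc k) (Pow X - {{}})"
      by (rule wedge_chain) (use z w in \<open>auto simp: rcycles_def chains_iff\<close>)
    moreover have "wedge w (bd X z) = 0"
      using z by (simp add: rcycles_def)
    then have "bd X (wedge w z) = z" using bd_wedge[OF assms w, of z] by simp
    ultimately show ?thesis unfolding boundaries_eq[OF co] by (metis imageI)
  qed
qed

section \<open>Interval decomposition of the homology of a filtration\<close>

text \<open>
  The persistence module of an arbitrary family of complexes, to be applied to Cech complexes and
  to other filtrations with which they are compared.
\<close>

definition filtration_module ::
    "nat \<Rightarrow> (real \<Rightarrow> 'a set set) \<Rightarrow> ('f::field, ('a list \<Rightarrow> 'f) set) pmodule" where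
  "filtration_module k K =
     \<lparr>pspace = \<lambda>t. reduced_homology_space k (K t),
      pshift = \<lambda>s t. homology_map k id (K s) (K t)\<rparr>"

lemma PH_eq_filtration_module: "PH k P = filtration_module k (\<lambda>t. cech t P)"
  by (simp add: PH_def filtration_module_def)

lemma mem_coset_iff: "c \<in> z +o B \<longleftrightarrow> c - z \<in> B" for c z :: "'b \<Rightarrow> 'f::ab_group_add"
  by (rule set_minus_plus[symmetric])

lemma mem_own_coset: "fn.subspace B \<Longrightarrow> z \<in> z +o B"
  unfolding mem_coset_iff by (simp add: fn.subspace_0)

lemma coset_eq_iff:
  fixes B :: "('b \<Rightarrow> 'f::field) set"
  assumes "fn.subspace B"
  shows "z +o B = z' +o B \<longleftrightarrow> z - z' \<in> B"
proof
  assume eq: "z +o B = z' +o B"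
  show "z - z' \<in> B" using mem_own_coset[OF assms, of z] unfolding eq mem_coset_iff .
next
  assume d: "z - z' \<in> B"
  have sub: "z +o B \<subseteq> z' +o B" if "z - z' \<in> B" for z z' :: "'b \<Rightarrow> 'f"
  proof
    fix c assume "c \<in> z +o B"
    then have "(z - z') + (c - z) \<in> B"
      unfolding mem_coset_iff by (rule fn.subspace_add[OF assms that])
    then show "c \<in> z' +o B" unfolding mem_coset_iff by simp
  qed
  have "z' - z \<in> B" using fn.subspace_neg[OF assms d] by simp
  then show "z +o B = z' +o B" using sub[OF d] sub[of z' z] by blast
qed

lemma coset_plus_subspace:
  fixes B :: "('b \<Rightarrow> 'f::field) set"
  assumes "fn.subspace B" "S \<subseteq> B" "S \<noteq> {}"
  shows "(z +o S) + B = z +o B"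
proof
  show "(z +o S) + B \<subseteq> z +o B"
  proof
    fix c assume "c \<in> (z +o S) + B"
    then obtain s b where "s \<in> S" "b \<in> B" "c = z + s + b"
      unfolding elt_set_plus_def set_plus_def by blast
    then have "s + b \<in> B" "c - z = s + b" using assms fn.subspace_add[OF assms(1)] by auto
    then show "c \<in> z +o B" unfolding mem_coset_iff by simp
  qed
  show "z +o B \<subseteq> (z +o S) + B"
  proof
    fix c assume "c \<in> z +o B"
    then have c: "c - z \<in> B" unfolding mem_coset_iff .
    obtain s where s: "s \<in> S" using assms by blast
    have "(c - z) - s \<in> B" using fn.subspace_diff[OF assms(1) c] s assms(2) by blast
    moreover have "z + s \<in> z +o S" using s by (rule set_plus_intro2)
    ultimately have "(z + s) + ((c - z) - s) \<in> (z +o S) + B" by (rule set_plus_intro[rotated])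
    then show "c \<in> (z +o S) + B" by simp
  qed
qed

lemma coset_add:
  fixes B :: "('b \<Rightarrow> 'f::field) set"
  assumes "fn.subspace B"
  shows "(z +o B) + (z' +o B) = (z + z') +o B"
proof -
  have "(z +o B) + (z' +o B) = z' +o ((z +o B) + B)"
    by (metis set_plus_rearrange3 add.commute)
  also have "\<dots> = z' +o (z +o B)"
    using coset_plus_subspace[OF assms order_refl, of z] fn.subspace_0[OF assms] by auto
  also have "\<dots> = (z + z') +o B" by (simp add: set_plus_rearrange3 add.commute set_plus_rearrange2)
  finally show ?thesis .
qed

lemma coset_scale:
  fixes B :: "('b \<Rightarrow> 'f::field) set"
  assumes "fn.subspace B"
  shows "(\<lambda>c xs. a * c xs) ` (z +o B) + B = fscale a z +o B"
proof -
  have "(\<lambda>c xs. a * c xs) ` (z +o B) = fscale a z +o (fscale a ` B)"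
    by (force simp: elt_set_plus_def fun_eq_iff algebra_simps image_iff)
  moreover have "fscale a ` B \<subseteq> B" "fscale a ` B \<noteq> {}"
    using fn.subspace_scale[OF assms] fn.subspace_0[OF assms] by auto
  ultimately show ?thesis using coset_plus_subspace[OF assms] by simp
qed

lemma pushforward_id:
  assumes "c \<in> chains k K"
  shows "pushforward id K c = c"
proof
  fix ys
  have "{xs. distinct xs \<and> set xs \<in> K \<and> map id xs = ys}
    = (if distinct ys \<and> set ys \<in> K then {ys} else {})"
    by auto
  then show "pushforward id K c ys = c ys"
    using assms unfolding pushforward_def chains_def by auto
qed

text \<open>
  Summing a chain over all lists of a given length amounts to taking boundaries until the empty
  list is reached. This computes the map to the one-point complex.
\<close>

lemma sum_lists_Suc:
  assumes "finite X"
  shows "(\<Sum>xs | set xs \<subseteq> X \<and> length xs = Suc n. c xs) = (\<Sum>ys | set ys \<subseteq> X \<and> length ys = n. bd X c ys)"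
proof -
  have "(\<Sum>xs | set xs \<subseteq> X \<and> length xs = Suc n. c xs)
      = (\<Sum>(ys, v)\<in>{ys. set ys \<subseteq> X \<and> length ys = n} \<times> X. c (v # ys))"
    unfolding lists_length_Suc_eq
    by (subst sum.reindex) (auto simp: inj_on_def case_prod_beta)
  also have "\<dots> = (\<Sum>ys | set ys \<subseteq> X \<and> length ys = n. bd X c ys)"
    unfolding bd_def by (rule sum.cartesian_product[symmetric])
  finally show ?thesis .
qed

lemma pushforward_const:
  assumes K: "complex_on X K" and c: "c \<in> chains k K"
  shows "pushforward (\<lambda>_. ()) K c ys = (\<Sum>xs | set xs \<subseteq> X \<and> length xs = length ys. c xs)"
  unfolding pushforward_def
proof (rule sum.mono_neutral_left)
  show "finite {xs. set xs \<subseteq> X \<and> length xs = length ys}"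
    using K finite_lists_length_eq unfolding complex_on_def by blast
  have len: "map (\<lambda>_. ()) xs = ys \<longleftrightarrow> length xs = length ys" for xs :: "'a list"
    by (auto simp: list_eq_iff_nth_eq)
  show "{xs. distinct xs \<and> set xs \<in> K \<and> map (\<lambda>_. ()) xs = ys} \<subseteq> {xs. set xs
    \<subseteq> X \<and> length xs = length ys}"
    unfolding len using K unfolding complex_on_def by auto
  show "\<forall>xs\<in>{xs. set xs \<subseteq> X \<and> length xs = length ys} - {xs. distinct xs \<and> set xs
    \<in> K \<and> map (\<lambda>_. ()) xs = ys}. c xs = 0"
    unfolding len using c unfolding chains_def by blast
qed

text \<open>
  For a cycle \<open>z\<close>, the chain \<open>bd X z\<close> vanishes except possibly at the empty list, where its value
  is the augmentation of \<open>z\<close>.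
\<close>

lemma pushforward_const_eq_0_iff:
  assumes K: "complex_on X K" and z: "z \<in> cycles k K"
  shows "pushforward (\<lambda>_. ()) K z = 0 \<longleftrightarrow> bd X z = 0"
proof -
  have c: "z \<in> chains k K" and b0: "boundary K z = 0" using z unfolding cycles_def by auto
  have X: "finite X" using K unfolding complex_on_def by blast
  have b: "bd X z ys = 0" if "ys \<noteq> []" for ys
    using boundary_chain[OF K c, of ys] that fun_cong[OF b0, of ys] by simp
  show ?thesis
  proof
    assume "pushforward (\<lambda>_. ()) K z = 0"
    then have "(\<Sum>xs | set xs \<subseteq> X \<and> length xs = Suc 0. z xs) = 0"
      using pushforward_const[OF K c, of "[()]"] by simp
    moreover have "{ys. set ys \<subseteq> X \<and> length ys = 0} = {[]}" by auto
    ultimately have "bd X z [] = 0" unfolding sum_lists_Suc[OF X] by simp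
    then have "bd X z ys = 0" for ys using b[of ys] by (cases "ys = []") simp_all
    then show "bd X z = 0" by (simp add: fun_eq_iff)
  next
    assume bz: "bd X z = 0"
    show "pushforward (\<lambda>_. ()) K z = 0"
    proof
      fix ys :: "unit list"
      show "pushforward (\<lambda>_. ()) K z ys = 0 ys"
      proof (cases ys)
        case Nil
        have "z [] = 0" using c unfolding chains_def by force
        moreover have "{ys. set ys \<subseteq> X \<and> length ys = 0} = {[]}" by auto
        ultimately show ?thesis using Nil unfolding pushforward_const[OF K c] by simp
      next
        case (Cons y ys')
        then show ?thesis unfolding pushforward_const[OF K c] by (simp add: sum_lists_Suc[OF X] bz)
      qed
    qed
  qed
qed

lemma boundaries_point: "boundaries k {{()}} = ({0} :: (unit list \<Rightarrow> 'f::field) set)"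
proof -
  have "chains (Suc k) {{()}} = ({0} :: (unit list \<Rightarrow> 'f::field) set)"
  proof -
    have "c = 0" if c: "c \<in> chains (Suc k) {{()}}" for c :: "unit list \<Rightarrow> 'f"
    proof (rule ccontr)
      assume "c \<noteq> 0"
      then obtain xs where "c xs \<noteq> 0" by (auto simp: fun_eq_iff)
      then have "length xs = Suc (Suc k)" "distinct xs" using c unfolding chains_def by blast+
      then show False using distinct_card[of xs] card_mono[of "UNIV :: unit set" "set xs"] by simp
    qed
    then show ?thesis using fn.subspace_0[OF subspace_chains] by blast
  qed
  moreover have "boundary {{()}} (0 :: unit list \<Rightarrow> 'f) = 0" by (simp add: boundary_def fun_eq_iff)
  ultimately show ?thesis unfolding boundaries_def by simp
qed

lemma rcycles_subset_cycles:
  assumes "complex_on X K"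
  shows "rcycles X k K \<subseteq> cycles k K"
proof
  fix z assume z: "z \<in> rcycles X k K"
  then have "boundary K z ys = 0" for ys
    using boundary_chain[OF assms, of z k ys] unfolding rcycles_def by simp
  then show "z \<in> cycles k K" using z unfolding rcycles_def cycles_def by (simp add: fun_eq_iff)
qed

text \<open>
  The kernel of the map to a point consists of the classes of cycles of the augmented complex,
  uniformly in \<open>k\<close>: in positive degrees the augmentation is trivial.
\<close>

lemma reduced_homology_eq:
  assumes K: "complex_on X K"
  shows "reduced_homology k K = (\<lambda>z. z +o boundaries k K) ` (rcycles X k K :: ('a list \<Rightarrow>
      'f::field) set)"
proof -
  let ?B = "boundaries k K :: ('a list \<Rightarrow> 'f) set"
  have sB: "fn.subspace ?B" by (rule subspace_boundaries[OF K])
  have mem: "z \<in> z +o ?B" for z by (rule mem_own_coset[OF sB])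
  have key: "homology_map k (\<lambda>_. ()) K {{()}} (z +o ?B) = boundaries k {{()}} \<longleftrightarrow> z \<in> rcycles X k K"
    if z: "z \<in> cycles k K" for z
  proof -
    have "homology_map k (\<lambda>_. ()) K {{()}} (z +o ?B) = pushforward (\<lambda>_. ()) K ` (z +o ?B)"
      unfolding homology_map_def boundaries_point by (auto simp: set_plus_def)
    also have "\<dots> = boundaries k {{()}} \<longleftrightarrow> z \<in> rcycles X k K"
      unfolding boundaries_point
    proof
      assume "pushforward (\<lambda>_. ()) K ` (z +o ?B) = {0}"
      then have "pushforward (\<lambda>_. ()) K z = 0" using mem by blast
      then show "z \<in> rcycles X k K"
        using z pushforward_const_eq_0_iff[OF K z] unfolding rcycles_def cycles_def by simp
    next
      assume zr: "z \<in> rcycles X k K"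
      have "pushforward (\<lambda>_. ()) K c = 0" if "c \<in> z +o ?B" for c
      proof -
        have "c - z \<in> rcycles X k K"
          using that boundaries_subset_rcycles[OF K] unfolding mem_coset_iff by blast
        from fn.subspace_add[OF subspace_rcycles zr this] have c: "c \<in> rcycles X k K" by simp
        then have "c \<in> cycles k K" using rcycles_subset_cycles[OF K] by blast
        then show ?thesis using pushforward_const_eq_0_iff[OF K] c unfolding rcycles_def by blast
      qed
      moreover have "z +o ?B \<noteq> {}" using mem[of z] by blast
      ultimately have "(\<forall>c\<in>z +o ?B. pushforward (\<lambda>_. ()) K c = 0) \<and> z +o ?B \<noteq> {}" by blast
      then show "pushforward (\<lambda>_. ()) K ` (z +o ?B) = {0}"
        by (metis (no_types, lifting) image_cong image_constant_conv)
    qed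
    finally show ?thesis .
  qed
  show ?thesis
    unfolding reduced_homology_def homology_def
    using key rcycles_subset_cycles[OF K, of k] by (auto simp: image_iff)
qed

definition filtration_on :: "'a set \<Rightarrow> (real \<Rightarrow> 'a set set) \<Rightarrow> bool" where
  "filtration_on X K \<longleftrightarrow> finite X \<and> (\<forall>t\<ge>0. complex_on X (K t)) \<and>
     (\<forall>s t. 0 \<le> s \<and> s \<le> t \<longrightarrow> K s \<subseteq> K t)"

text \<open>
  The condition that makes all bars finite: a full simplex has no reduced homology.
\<close>

definition reaches_full_simplex :: "'a set \<Rightarrow> (real \<Rightarrow> 'a set set) \<Rightarrow> bool" where
  "reaches_full_simplex X K \<longleftrightarrow> (\<exists>T\<ge>0. K T = Pow X - {{}})"

lemma homology_map_id:
  fixes z :: "'a list \<Rightarrow> 'f::field"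
  assumes L: "complex_on X L" "complex_on X L'" "L \<subseteq> L'" and z: "z \<in> rcycles X k L"
  shows "homology_map k id L L' (z +o boundaries k L) = z +o boundaries k L'"
proof -
  have "c \<in> chains k L" if "c \<in> z +o boundaries k L" for c
  proof -
    have "c - z \<in> chains k L"
      using that boundaries_subset_rcycles[OF L(1)] unfolding mem_coset_iff rcycles_def by blast
    moreover have "z \<in> chains k L" using z unfolding rcycles_def by blast
    ultimately have "z + (c - z) \<in> chains k L" using fn.subspace_add[OF subspace_chains] by blast
    then show ?thesis by simp
  qed
  then have "pushforward id L ` (z +o boundaries k L) = z +o boundaries k L"
    using pushforward_id by (force simp: image_iff)
  moreover have "boundaries k L \<noteq> ({} :: ('a list \<Rightarrow> 'f) set)"
    using fn.subspace_0[OF subspace_boundaries[OF L(1), of k]] by auto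
  ultimately show ?thesis
    using coset_plus_subspace[OF subspace_boundaries[OF L(2)] boundaries_mono[OF L], where z = z]
    unfolding homology_map_def by simp
qed

definition life :: "'a set \<Rightarrow> nat \<Rightarrow> (real \<Rightarrow> 'a set set) \<Rightarrow> ('a list \<Rightarrow> 'f::field) \<Rightarrow> real set" where
  "life X k K e = {t. 0 \<le> t \<and> e \<in> rcycles X k (K t) \<and> e \<notin> boundaries k (K t)}"

definition adapted_basis ::
    "'a set \<Rightarrow> nat \<Rightarrow> (real \<Rightarrow> 'a set set) \<Rightarrow> ('a list \<Rightarrow> 'f::field) set \<Rightarrow> bool" where
  "adapted_basis X k K E \<longleftrightarrow> finite E \<and> fn.independent E \<and>
     (\<forall>t\<ge>0. fn.span (E \<inter> rcycles X k (K t)) = rcycles X k (K t) \<and>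
        fn.span (E \<inter> boundaries k (K t)) = boundaries k (K t))"

context
  fixes X :: "'a set" and K :: "real \<Rightarrow> 'a set set" and k :: nat
  assumes K: "filtration_on X K"
begin

lemma filtration_complex: "0 \<le> t \<Longrightarrow> complex_on X (K t)"
  and filtration_mono: "0 \<le> s \<Longrightarrow> s \<le> t \<Longrightarrow> K s \<subseteq> K t"
  and filtration_finite: "finite X"
  using K unfolding filtration_on_def by blast+

lemma filtration_rcycles_mono: "0 \<le> s \<Longrightarrow> s \<le> t \<Longrightarrow> rcycles X k (K s) \<subseteq> rcycles X k (K t)"
  using rcycles_mono filtration_mono by blast

lemma filtration_boundaries_mono: "0 \<le> s \<Longrightarrow> s \<le> t \<Longrightarrow> boundaries k (K s) \<subseteq> boundaries k (K t)"
  using boundaries_mono[OF filtration_complex filtration_complex filtration_mono, of s t k] by auto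

lemma filtration_module_carrier:
  "0 \<le> t \<Longrightarrow> vcarrier (pspace (filtration_module k K) t) =
     (\<lambda>z. z +o boundaries k (K t)) ` (rcycles X k (K t) :: ('a list \<Rightarrow> 'f::field) set)"
  by (simp add: filtration_module_def reduced_homology_space_def reduced_homology_eq[OF
    filtration_complex])

lemma filtration_module_add:
  "0 \<le> t \<Longrightarrow> vadd (pspace (filtration_module k K) t) (z +o boundaries k (K t)) (z' +o boundaries k
    (K t)) =
     (z + z') +o (boundaries k (K t) :: ('a list \<Rightarrow> 'f::field) set)"
  by (simp add: filtration_module_def reduced_homology_space_def
      coset_add[OF subspace_boundaries[OF filtration_complex]])

lemma filtration_module_scale:
  "0 \<le> t \<Longrightarrow> vscale (pspace (filtration_module k K) t) a (z +o boundaries k (K t)) =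
     fscale a z +o (boundaries k (K t) :: ('a list \<Rightarrow> 'f::field) set)"
  by (simp add: filtration_module_def reduced_homology_space_def
      coset_scale[OF subspace_boundaries[OF filtration_complex]])

lemma filtration_module_shift:
  assumes "0 \<le> s" "s \<le> t" "z \<in> rcycles X k (K s)"
  shows "pshift (filtration_module k K) s t (z +o boundaries k (K s)) =
     z +o (boundaries k (K t) :: ('a list \<Rightarrow> 'f::field) set)"
proof -
  have "0 \<le> t" using assms by simp
  from homology_map_id[OF filtration_complex[OF assms(1)] filtration_complex[OF this]
    filtration_mono[OF assms(1,2)] assms(3)]
  show ?thesis by (simp add: filtration_module_def)
qed

lemma closed_filtration_module: "closed_pmodule (filtration_module k K :: ('f::field, ('a list \<Rightarrow>
  'f) set) pmodule)"
proof -
  have "z + z' \<in> rcycles X k (K t)" "fscale a z \<in> rcycles X k (K t)"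
    if "z \<in> rcycles X k (K t)" "z' \<in> rcycles X k (K t)" for z z' :: "'a list \<Rightarrow> 'f" and t a
    using fn.subspace_add[OF subspace_rcycles that] fn.subspace_scale[OF subspace_rcycles that(1)]
      by auto
  moreover have "z \<in> rcycles X k (K t)" if "0 \<le> s" "s \<le> t" "z \<in> rcycles X k (K s)"
    for s t and z :: "'a list \<Rightarrow> 'f"
    using filtration_rcycles_mono that by blast
  ultimately show ?thesis
    unfolding closed_pmodule_def
    by (auto simp: filtration_module_carrier filtration_module_add filtration_module_scale
      filtration_module_shift)
qed

lemma is_interval_life: "is_interval (life X k K e)"
  unfolding is_interval_1
proof (intro ballI allI impI, elim conjE)
  fix a b x assume a: "a \<in> life X k K e" and b: "b \<in> life X k K e" and x: "a \<le> x" "x \<le> b"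
  have "0 \<le> a" "0 \<le> x" using a x by (auto simp: life_def)
  then show "x \<in> life X k K e"
    using a b filtration_rcycles_mono[OF _ x(1)] filtration_boundaries_mono[OF _ x(2)]
    unfolding life_def by blast
qed

lemma bounded_life:
  assumes full: "reaches_full_simplex X K"
  shows "bounded (life X k K e)"
proof -
  obtain T where T: "0 \<le> T" "K T = Pow X - {{}}" using full unfolding reaches_full_simplex_def
    by blast
  have "t \<le> T" if e: "t \<in> life X k K e" for t
  proof (rule ccontr)
    assume "\<not> t \<le> T"
    then have t: "T \<le> t" "0 \<le> t" using T by auto
    have "K t \<subseteq> K T" using filtration_complex[OF t(2)] unfolding complex_on_def T(2) by (elim conjE)
    then have "e \<in> rcycles X k (K T)" using e rcycles_mono unfolding life_def by blast
    then have "e \<in> boundaries k (K T)" using rcycles_full_simplex[OF filtration_finite] T(2) by auto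
    then have "e \<in> boundaries k (K t)" using filtration_boundaries_mono[OF T(1) t(1)] by blast
    then show False using e unfolding life_def by blast
  qed
  then have "life X k K e \<subseteq> {0..T}" by (auto simp: life_def)
  then show ?thesis by (rule bounded_subset[OF bounded_closed_interval])
qed

text \<open>
  The coordinates of a homology class with respect to the basis elements that are alive at time
  \<open>t\<close> are those of any representing cycle: a boundary has no such coordinates, because \<open>B\<^sub>t\<close> is
  spanned by the basis elements that have already died. A class is zero if all these coordinates
  vanish, because the remaining coordinates of a cycle belong to dead elements. The shift from \<open>s\<close>
  to \<open>t\<close> keeps the cycle, hence its coordinates.
\<close>

lemma filtration_interval_decomposition:
  fixes E :: "('a list \<Rightarrow> 'f::field) set"
  assumes full: "reaches_full_simplex X K"
    and adapted: "adapted_basis X k K E"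
    and es: "distinct es" "set es = {e \<in> E. life X k K e \<noteq> {}}"
  shows "interval_decomposition (filtration_module k K :: ('f, ('a list \<Rightarrow> 'f) set) pmodule) (map
      (life X k K) es)"
proof -
  have E: "fn.independent E"
    and Z: "\<And>t. 0 \<le> t \<Longrightarrow> fn.span (E \<inter> rcycles X k (K t)) = rcycles X k (K t)"
    and B: "\<And>t. 0 \<le> t \<Longrightarrow> fn.span (E \<inter> boundaries k (K t)) = boundaries k (K t)"
    using adapted unfolding adapted_basis_def by auto
  define Is where "Is = map (life X k K) es"
  let ?n = "length es"
  have Is: "length Is = ?n" "\<And>i. i < ?n \<Longrightarrow> Is ! i = life X k K (es ! i)" unfolding Is_def by auto
  let ?M = "filtration_module k K :: ('f, ('a list \<Rightarrow> 'f) set) pmodule"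
  let ?S = "interval_sum Is :: ('f, nat \<Rightarrow> 'f) pmodule"
  define Zt where "Zt t = (rcycles X k (K t) :: ('a list \<Rightarrow> 'f) set)" for t
  define Bt where "Bt t = (boundaries k (K t) :: ('a list \<Rightarrow> 'f) set)" for t
  define r where "r = fn.representation E"
  have sZ: "fn.subspace (Zt t)" for t unfolding Zt_def by (rule subspace_rcycles)
  have sB: "fn.subspace (Bt t)" if "0 \<le> t" for t
    unfolding Bt_def by (rule subspace_boundaries[OF filtration_complex[OF that]])
  have life_iff: "t \<in> life X k K e \<longleftrightarrow> 0 \<le> t \<and> e \<in> Zt t \<and> e \<notin> Bt t" for t e
    unfolding life_def Zt_def Bt_def by simp
  have BZ: "Bt t \<subseteq> Zt t" if "0 \<le> t" for t
    unfolding Bt_def Zt_def by (rule boundaries_subset_rcycles[OF filtration_complex[OF that]])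
  have Zspan: "Zt t \<subseteq> fn.span E" if "0 \<le> t" for t
    using Z[OF that] fn.span_mono[of "E \<inter> Zt t" E] unfolding Zt_def by auto
  have r_in: "e \<in> U" if "z \<in> fn.span (E \<inter> U)" "r z e \<noteq> 0" for z e U
  proof -
    have "r z = fn.representation (E \<inter> U) z"
      unfolding r_def by (rule fn.representation_extend[OF E that(1)]) simp
    then show ?thesis using that(2) fn.representation_ne_zero[of "E \<inter> U" z e] by simp
  qed
  have r_Z: "e \<in> Zt t" if "z \<in> Zt t" "r z e \<noteq> 0" "0 \<le> t" for z e t
    using r_in[of z "Zt t" e] that Z[OF that(3)] unfolding Zt_def by simp
  have r_B: "e \<in> Bt t" if "z \<in> Bt t" "r z e \<noteq> 0" "0 \<le> t" for z e t
    using r_in[of z "Bt t" e] that B[OF that(3)] unfolding Bt_def by simp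
  have r_add: "r (z + z') e = r z e + r z' e" if "z \<in> Zt t" "z' \<in> Zt t" "0 \<le> t" for z z' e t
    unfolding r_def using fn.representation_add[OF E subsetD[OF Zspan] subsetD[OF Zspan], OF
      that(3,2,3,1)] by simp
  have r_diff: "r (z - z') e = r z e - r z' e" if "z \<in> Zt t" "z' \<in> Zt t" "0 \<le> t" for z z' e t
    unfolding r_def using fn.representation_diff[OF E subsetD[OF Zspan] subsetD[OF Zspan], OF
      that(3,2,3,1)] by simp
  have r_scale: "r (fscale a z) e = a * r z e" if "z \<in> Zt t" "0 \<le> t" for a z e t
    unfolding r_def using fn.representation_scale[OF E subsetD[OF Zspan], OF that(2,1)] by simp
  have es_E: "es ! i \<in> E" if "i < ?n" for i using es(2) that nth_mem by blast
  define \<phi> where "\<phi> t h = (\<lambda>i\<in>{..<?n}. if t \<in> life X k K (es ! i)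
      then r (SOME z. z \<in> Zt t \<and> h = z +o Bt t) (es ! i) else 0)" for t h
  have \<phi>: "\<phi> t (z +o Bt t) = (\<lambda>i\<in>{..<?n}. if t \<in> life X k K (es ! i) then r z (es ! i) else 0)"
    if "0 \<le> t" "z \<in> Zt t" for t z
  proof -
    let ?y = "SOME y. y \<in> Zt t \<and> z +o Bt t = y +o Bt t"
    have y: "?y \<in> Zt t \<and> z +o Bt t = ?y +o Bt t"
      by (rule someI[of _ z]) (use that in simp)
    then have d: "z - ?y \<in> Bt t" using coset_eq_iff[OF sB[OF that(1)]] by blast
    have "r ?y e = r z e" if e: "t \<in> life X k K e" for e
    proof (rule ccontr)
      assume "r ?y e \<noteq> r z e"
      then have "r (z - ?y) e \<noteq> 0" using r_diff[of z t ?y e] y that \<open>0 \<le> t\<close> \<open>z \<in> Zt t\<close> by simp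
      then show False using r_B[OF d _ \<open>0 \<le> t\<close>] e unfolding life_iff by blast
    qed
    then show ?thesis unfolding \<phi>_def by (auto simp: fun_eq_iff restrict_def)
  qed
  have carrier: "vcarrier (pspace ?M t) = (\<lambda>z. z +o Bt t) ` Zt t" if "0 \<le> t" for t
    unfolding Zt_def Bt_def by (rule filtration_module_carrier[OF that])
  have lin: "linear_iso (pspace ?M t) (pspace ?S t) (\<phi> t)" if t: "0 \<le> t" for t
    unfolding linear_iso_def
  proof (intro conjI ballI allI)
    show "bij_betw (\<phi> t) (vcarrier (pspace ?M t)) (vcarrier (pspace ?S t))"
      unfolding bij_betw_def
    proof
      show "inj_on (\<phi> t) (vcarrier (pspace ?M t))"
        unfolding carrier[OF t]
      proof (rule inj_onI, elim imageE, simp only:)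
        fix z z' assume z: "z \<in> Zt t" "z' \<in> Zt t" and eq: "\<phi> t (z +o Bt t) = \<phi> t (z' +o Bt t)"
        let ?d = "z - z'"
        have d: "?d \<in> Zt t" using fn.subspace_diff[OF sZ] z by blast
        have "e \<in> Bt t" if e: "r ?d e \<noteq> 0" for e
        proof (rule ccontr)
          assume nB: "e \<notin> Bt t"
          have "e \<in> Zt t" using r_Z[OF d e t] .
          moreover have "e \<in> E" using e unfolding r_def by (rule fn.representation_ne_zero)
          ultimately have "e \<in> set es" "t \<in> life X k K e" using nB t es(2) life_iff by auto
          then obtain i where i: "i < ?n" "es ! i = e" by (auto simp: in_set_conv_nth)
          have "r z e = r z' e"
            using fun_cong[OF eq, of i] i \<open>t \<in> life X k K e\<close> unfolding \<phi>[OF t z(1)] \<phi>[OF t z(2)]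
              by simp
          then show False using e r_diff[OF z t] by simp
        qed
        then have "(\<Sum>e | r ?d e \<noteq> 0. fscale (r ?d e) e) \<in> Bt t"
          by (intro fn.subspace_sum[OF sB[OF t]] fn.subspace_scale[OF sB[OF t]]) auto
        moreover have "(\<Sum>e | r ?d e \<noteq> 0. fscale (r ?d e) e) = ?d"
          unfolding r_def by (rule fn.sum_nonzero_representation_eq[OF E]) (use Zspan[OF t] d in
            blast)
        ultimately show "z +o Bt t = z' +o Bt t" using coset_eq_iff[OF sB[OF t]] by simp
      qed
      show "\<phi> t ` vcarrier (pspace ?M t) = vcarrier (pspace ?S t)"
      proof
        show "\<phi> t ` vcarrier (pspace ?M t) \<subseteq> vcarrier (pspace ?S t)"
          unfolding carrier[OF t] by (auto simp: \<phi>[OF t] interval_sum_carrier Is)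
        show "vcarrier (pspace ?S t) \<subseteq> \<phi> t ` vcarrier (pspace ?M t)"
        proof
          fix x assume "x \<in> vcarrier (pspace ?S t)"
          then have x: "x \<in> extensional {..<?n}" "\<And>i. i < ?n \<Longrightarrow> t \<notin> life X k K (es ! i) \<Longrightarrow> x i = 0"
            unfolding interval_sum_carrier by (auto simp: Is)
          define z where "z = (\<Sum>j<?n. fscale (x j) (es ! j))"
          have "fscale (x j) (es ! j) \<in> Zt t" if "j < ?n" for j
            using x(2)[OF that] fn.subspace_scale[OF sZ, of "es ! j" t "x j"] fn.subspace_0[OF sZ,
              of t]
            by (cases "t \<in> life X k K (es ! j)") (auto simp: life_iff fscale_def zero_fun_def)
          then have z: "z \<in> Zt t" unfolding z_def by (intro fn.subspace_sum[OF sZ]) auto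
          have "r z (es ! i) = x i" if i: "i < ?n" for i
          proof -
            have "r z (es ! i) = (\<Sum>j<?n. r (fscale (x j) (es ! j)) (es ! i))"
              unfolding z_def r_def
              by (subst fn.representation_sum[OF E]) (use es_E in \<open>auto intro: fn.span_scale
                fn.span_base\<close>)
            also have "\<dots> = (\<Sum>j<?n. if j = i then x i else 0)"
            proof (rule sum.cong[OF refl])
              fix j assume "j \<in> {..<?n}"
              then have j: "j < ?n" by simp
              show "r (fscale (x j) (es ! j)) (es ! i) = (if j = i then x i else 0)"
                using fn.representation_scale[OF E fn.span_base[OF es_E[OF j]], of "x j"]
                  fn.representation_basis[OF E es_E[OF j]] nth_eq_iff_index_eq[OF es(1) j i]
                unfolding r_def by auto
            qed
            also have "\<dots> = x i" using i by simp
            finally show ?thesis .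
          qed
          then have "\<phi> t (z +o Bt t) = x"
            unfolding \<phi>[OF t z] using x by (auto simp: fun_eq_iff restrict_def extensional_def)
          then show "x \<in> \<phi> t ` vcarrier (pspace ?M t)" unfolding carrier[OF t] using z by blast
        qed
      qed
    qed
    fix h assume "h \<in> vcarrier (pspace ?M t)"
    then obtain z where z: "z \<in> Zt t" "h = z +o Bt t" unfolding carrier[OF t] by blast
    show "\<phi> t (vscale (pspace ?M t) a h) = vscale (pspace ?S t) a (\<phi> t h)" for a
      unfolding z(2) using filtration_module_scale[OF t, of a z] fn.subspace_scale[OF sZ z(1), of a]
      by (auto simp: Bt_def[symmetric] \<phi>[OF t] z(1) r_scale[OF z(1) t] interval_sum_scale Is
        fun_eq_iff restrict_def)
    fix h' assume "h' \<in> vcarrier (pspace ?M t)"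
    then obtain z' where z': "z' \<in> Zt t" "h' = z' +o Bt t" unfolding carrier[OF t] by blast
    show "\<phi> t (vadd (pspace ?M t) h h') = vadd (pspace ?S t) (\<phi> t h) (\<phi> t h')"
      unfolding z(2) z'(2) using filtration_module_add[OF t, of z z'] fn.subspace_add[OF sZ z(1)
        z'(1)]
      by (auto simp: Bt_def[symmetric] \<phi>[OF t] z(1) z'(1) r_add[OF z(1) z'(1) t] interval_sum_add
        Is fun_eq_iff restrict_def)
  qed
  have shift: "\<phi> t (pshift ?M s t h) = pshift ?S s t (\<phi> s h)"
    if st: "0 \<le> s" "s \<le> t" and h: "h \<in> vcarrier (pspace ?M s)" for s t h
  proof -
    have t: "0 \<le> t" using st by simp
    obtain z where z: "z \<in> Zt s" "h = z +o Bt s" using h unfolding carrier[OF st(1)] by blast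
    have zt: "z \<in> Zt t" using z(1) filtration_rcycles_mono[OF st] unfolding Zt_def by blast
    have "r z e = 0" if "t \<in> life X k K e" "s \<notin> life X k K e" for e
    proof (rule ccontr)
      assume "r z e \<noteq> 0"
      then have "e \<in> Zt s" using r_Z[OF z(1) _ st(1)] by blast
      then have "e \<in> Bt s" using that st unfolding life_iff by blast
      then show False using that filtration_boundaries_mono[OF st] unfolding life_iff Bt_def by blast
    qed
    moreover have "pshift ?M s t h = z +o Bt t"
      unfolding z(2) Bt_def by (rule filtration_module_shift[OF st]) (use z(1) in \<open>simp add: Zt_def\<close>)
    ultimately show ?thesis
      by (auto simp: z(2) \<phi>[OF t zt] \<phi>[OF st(1) z(1)] interval_sum_shift Is fun_eq_iff restrict_def)
  qed
  have "pmodule_isomorphic ?M ?S"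
    unfolding pmodule_isomorphic_def using lin shift by blast
  moreover have "\<forall>I\<in>set (map (life X k K) es). I \<noteq> {} \<and> I \<subseteq> {0..} \<and> is_interval I \<and> bounded I"
    using is_interval_life bounded_life[OF full] es(2) by (auto simp: life_def)
  ultimately show ?thesis unfolding interval_decomposition_def Is_def by blast
qed

end

section \<open>Deleting dominated vertices\<close>

lemma alternating_Cons_nonzero:
  assumes "alternating d" "d ys \<noteq> 0" "v \<in> set ys"
  shows "\<exists>zs. d (v # zs) \<noteq> 0"
proof -
  obtain us vs where ys: "ys = us @ v # vs" using assms(3) by (meson split_list)
  show ?thesis
  proof (cases us)
    case Nil
    then show ?thesis using ys assms(2) by auto
  next
    case (Cons u us')
    have "d ([] @ u # us' @ v # vs) = - d ([] @ v # us' @ u # vs)"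
      by (rule alternating_swap[OF assms(1)])
    then have "d (v # us' @ u # vs) \<noteq> 0" using ys Cons assms(2) by auto
    then show ?thesis by blast
  qed
qed

text \<open>
  A chain is \<open>c\<^sub>0 + v \<and> c\<^sub>1\<close>, where \<open>c\<^sub>0\<close> and \<open>c\<^sub>1\<close> do not involve \<open>v\<close> and \<open>c\<^sub>1\<close> is the
  contraction of \<open>c\<close> with \<open>v\<close>.
\<close>

definition contract :: "'a \<Rightarrow> ('a list \<Rightarrow> 'f::field) \<Rightarrow> 'a list \<Rightarrow> 'f" where
  "contract v c = (\<lambda>ys. c (v # ys))"

text \<open>
  The chain map induced by sending \<open>v\<close> to \<open>w\<close> and fixing the other vertices: \<open>c\<^sub>0 + v \<and> c\<^sub>1\<close>
  becomes \<open>c\<^sub>0 + w \<and> c\<^sub>1\<close>.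
\<close>

definition replace_vertex :: "'a \<Rightarrow> 'a \<Rightarrow> ('a list \<Rightarrow> 'f::field) \<Rightarrow> 'a list \<Rightarrow> 'f" where
  "replace_vertex v w c = c - wedge v (contract v c) + wedge w (contract v c)"

lemma alternating_contract: "alternating c \<Longrightarrow> alternating (contract v c)"
  unfolding contract_def by (rule alternating_Cons)

lemma contract_contract: "alternating c \<Longrightarrow> contract v (contract v c) = 0"
  using alternating_adjacent_eq[of c "[]" v] by (auto simp: contract_def fun_eq_iff)

lemma contract_wedge: "contract v (wedge w c) = (if v = w then c else 0) - wedge w (contract v c)"
  by (auto simp: contract_def fun_eq_iff)

lemma contract_add: "contract v (c + d) = contract v c + contract v d"
  and contract_diff: "contract v (c - d) = contract v c - contract v d"
  by (auto simp: contract_def fun_eq_iff)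

lemma bd_contract:
  assumes "alternating c"
  shows "bd X (contract v c) = - contract v (bd X c)"
proof
  fix ys
  have "c (v # u # ys) = - c (u # v # ys)" for u
    using alternating_swap_adjacent[OF assms, of "[]" v u ys] by simp
  then show "bd X (contract v c) ys = (- contract v (bd X c)) ys"
    by (simp add: bd_def contract_def sum_negf)
qed

text \<open>
  If every simplex that contains \<open>v\<close> remains a simplex after adding \<open>w\<close>, then the subcomplex \<open>L\<close>
  of the simplices without \<open>v\<close> carries all the homology, as \<open>K\<close> can be collapsed to \<open>L\<close> by moving
  \<open>v\<close> to \<open>w\<close>.
\<close>

context
  fixes X :: "'a set" and K L :: "'a set set" and v w :: 'a
  assumes K: "complex_on X K" and vw: "v \<in> X" "w \<in> X" "v \<noteq> w"
    and dom: "\<And>\<sigma>. \<sigma> \<in> K \<Longrightarrow> v \<in> \<sigma> \<Longrightarrow> insert w \<sigma> \<in> K"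
    and L: "L = {\<sigma> \<in> K. v \<notin> \<sigma>}"
begin

lemma finite_vertices: "finite X"
  using K unfolding complex_on_def by blast

lemma face_closed: "\<sigma> \<in> K \<Longrightarrow> \<tau> \<subseteq> \<sigma> \<Longrightarrow> \<tau> \<noteq> {} \<Longrightarrow> \<tau> \<in> K"
  using K unfolding complex_on_def by blast

lemma complex_without_vertex: "complex_on X L"
  using K unfolding complex_on_def L by blast

lemma contract_chain:
  assumes "c \<in> chains k K"
  shows "wedge v (contract v c) \<in> chains k K" "wedge w (contract v c) \<in> chains k K"
proof -
  have "alternating c" using assms unfolding chains_iff by blast
  then have alt: "alternating (contract v c)" by (rule alternating_contract)
  have supp: "length xs = k \<and> insert v (set xs) \<in> K" if "contract v c xs \<noteq> 0" for xs
    using assms that unfolding chains_iff contract_def by fastforce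
  show "wedge v (contract v c) \<in> chains k K"
    by (rule wedge_chain[OF alt supp])
  have "insert w (set xs) \<in> K" if "contract v c xs \<noteq> 0" for xs
    using face_closed[OF dom[of "insert v (set xs)"], of "insert w (set xs)"] supp[OF that] by blast
  then show "wedge w (contract v c) \<in> chains k K"
    using wedge_chain[OF alt, of k w K] supp by blast
qed

lemma replace_vertex_chain:
  assumes c: "c \<in> chains k K"
  shows "replace_vertex v w c \<in> chains k L"
proof -
  let ?d = "replace_vertex v w c"
  have d: "?d \<in> chains k K"
    unfolding replace_vertex_def
    by (intro fn.subspace_add[OF subspace_chains] fn.subspace_diff[OF subspace_chains] c
      contract_chain)
  have alt: "alternating c" using c unfolding chains_iff by blast
  have "contract v ?d = 0"
    using vw(3) unfolding replace_vertex_def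
    by (simp add: contract_add contract_diff contract_wedge contract_contract[OF alt])
  then have "?d (v # zs) = 0" for zs by (metis contract_def zero_fun_apply)
  then have "v \<notin> set ys" if "?d ys \<noteq> 0" for ys
    using alternating_Cons_nonzero[of ?d ys v] d that unfolding chains_iff by blast
  then show ?thesis using d unfolding chains_iff L by blast
qed

lemma bd_replace_vertex:
  assumes alt: "alternating c" and "contract v (bd X c) = 0"
  shows "bd X (replace_vertex v w c) = bd X c"
  unfolding replace_vertex_def bd_add bd_diff
    bd_wedge[OF finite_vertices vw(1)] bd_wedge[OF finite_vertices vw(2)] bd_contract[OF alt] assms(2)
  by simp

text \<open>
  Moving \<open>v\<close> to \<open>w\<close> changes a cycle by the boundary of \<open>w \<and> v \<and> z\<^sub>1\<close>, where \<open>z\<^sub>1\<close> is the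
  contraction of \<open>z\<close> with \<open>v\<close>. This chain lies in \<open>K\<close> because \<open>w\<close> can be added to simplices that
  contain \<open>v\<close>.
\<close>

lemma cycle_homologous_without_vertex:
  assumes z: "z \<in> rcycles X k K"
  shows "\<exists>z'\<in>rcycles X k L. z - z' \<in> boundaries k K"
proof
  have c: "z \<in> chains k K" and alt: "alternating z" and bz: "bd X z = 0"
    using z unfolding rcycles_def chains_iff by auto
  have "contract v (bd X z) = 0" unfolding bz by (auto simp: contract_def)
  then show "replace_vertex v w z \<in> rcycles X k L"
    using replace_vertex_chain[OF c] bd_replace_vertex[OF alt] bz unfolding rcycles_def by simp
  let ?d = "wedge w (wedge v (contract v z))"
  have "?d \<in> chains (Suc k) K"
  proof (rule wedge_chain)
    show "alternating (wedge v (contract v z))"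
      by (rule alternating_wedge[OF alternating_contract[OF alt]])
    fix xs assume nz: "wedge v (contract v z) xs \<noteq> 0"
    then have "length xs = Suc k" "set xs \<in> K" using contract_chain(1)[OF c] unfolding chains_iff
      by blast+
    moreover have "v \<in> set xs" using wedge_nonzero[OF nz] by auto
    ultimately show "length xs = Suc k \<and> insert w (set xs) \<in> K" using dom by blast
  qed
  moreover have "bd X ?d = z - replace_vertex v w z"
    unfolding replace_vertex_def
      bd_wedge[OF finite_vertices vw(1)] bd_wedge[OF finite_vertices vw(2)] bd_contract[OF alt]
      \<open>contract v (bd X z) = 0\<close> by simp
  ultimately show "z - replace_vertex v w z \<in> boundaries k K"
    unfolding boundaries_eq[OF K] by (metis imageI)
qed

text \<open>
  If \<open>z = \<partial> d\<close> does not involve \<open>v\<close>, then moving \<open>v\<close> to \<open>w\<close> in \<open>d\<close> does not change the boundary.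
\<close>

lemma boundary_without_vertex:
  assumes z: "z \<in> rcycles X k L" and zb: "z \<in> boundaries k K"
  shows "z \<in> boundaries k L"
proof -
  obtain d where d: "d \<in> chains (Suc k) K" "z = bd X d" using zb unfolding boundaries_eq[OF K]
    by blast
  have "z (v # ys) = 0" for ys
  proof (rule ccontr)
    assume "z (v # ys) \<noteq> 0"
    then have "set (v # ys) \<in> L" using z unfolding rcycles_def chains_iff by blast
    then show False unfolding L by simp
  qed
  then have "contract v (bd X d) = 0" unfolding d(2)[symmetric] by (auto simp: contract_def)
  then have "bd X (replace_vertex v w d) = z"
    using bd_replace_vertex d unfolding chains_iff by blast
  then show ?thesis
    unfolding boundaries_eq[OF complex_without_vertex] using replace_vertex_chain[OF d(1)] by blast
qed

end

text \<open>
  The two statements say that the inclusion of the subcomplex without \<open>D\<close> is surjective and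
  injective on homology. The vertices of \<open>D\<close> are deleted one at a time; the vertex \<open>r v\<close> that
  dominates \<open>v\<close> lies outside \<open>D\<close>, so it is still present when \<open>v\<close> is deleted.
\<close>

lemma remove_dominated_vertices:
  fixes K :: "'a set set"
  assumes "finite D" and K: "complex_on X K" and r: "\<And>v. v \<in> D \<Longrightarrow> v \<in> X \<and> r v \<in> X - D"
    and dom: "\<And>\<sigma> v. \<sigma> \<in> K \<Longrightarrow> v \<in> \<sigma> \<Longrightarrow> v \<in> D \<Longrightarrow> insert (r v) \<sigma> \<in> K"
  shows "(\<forall>z\<in>rcycles X k K. \<exists>z'\<in>rcycles X k {\<sigma> \<in> K. \<sigma> \<inter> D
      = {}}. z - z' \<in> (boundaries k K :: ('a list \<Rightarrow> 'f::field) set)) \<and>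
     rcycles X k {\<sigma> \<in> K. \<sigma> \<inter> D = {}} \<inter> boundaries k K
       \<subseteq> (boundaries k {\<sigma> \<in> K. \<sigma> \<inter> D = {}} :: ('a list \<Rightarrow> 'f) set)"
  using assms(1) r dom
proof (induction D)
  case empty
  have "z - z \<in> boundaries k K" for z :: "'a list \<Rightarrow> 'f"
    using fn.subspace_0[OF subspace_boundaries[OF K]] by simp
  moreover have "{\<sigma> \<in> K. \<sigma> \<inter> {} = {}} = K" by blast
  ultimately show ?case by (metis Int_lower2)
next
  case (insert v D)
  define K' where "K' = {\<sigma> \<in> K. \<sigma> \<inter> D = {}}"
  define L where "L = {\<sigma> \<in> K. \<sigma> \<inter> insert v D = {}}"
  have r': "\<And>u. u \<in> D \<Longrightarrow> u \<in> X \<and> r u \<in> X - D" using insert.prems(1) by blast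
  have IH: "\<forall>z\<in>rcycles X k K. \<exists>z'\<in>rcycles X k K'. z - z' \<in> (boundaries k K :: ('a list \<Rightarrow> 'f) set)"
    "rcycles X k K' \<inter> boundaries k K \<subseteq> (boundaries k K' :: ('a list \<Rightarrow> 'f) set)"
    using insert.IH[OF r' insert.prems(2)] unfolding K'_def by blast+
  have K': "complex_on X K'" using K unfolding complex_on_def K'_def by blast
  have rv: "v \<in> X" "r v \<in> X" "v \<noteq> r v" "r v \<notin> D" using insert.prems(1)[of v] by auto
  have L_eq: "L = {\<sigma> \<in> K'. v \<notin> \<sigma>}" unfolding L_def K'_def by blast
  have dom': "insert (r v) \<sigma> \<in> K'" if "\<sigma> \<in> K'" "v \<in> \<sigma>" for \<sigma>
    using insert.prems(2)[of \<sigma> v] that rv(4) unfolding K'_def by blast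
  have K'K: "K' \<subseteq> K" and LK': "L \<subseteq> K'" unfolding L_eq K'_def by auto
  have sB: "fn.subspace (boundaries k K :: ('a list \<Rightarrow> 'f) set)" by (rule subspace_boundaries[OF K])
  show ?case
    unfolding L_def[symmetric]
  proof (intro conjI ballI subsetI)
    fix z :: "'a list \<Rightarrow> 'f" assume "z \<in> rcycles X k K"
    then obtain z' where z': "z' \<in> rcycles X k K'" "z - z' \<in> boundaries k K" using IH(1) by blast
    obtain z'' where z'': "z'' \<in> rcycles X k L" "z' - z'' \<in> boundaries k K'"
      using cycle_homologous_without_vertex[OF K' rv(1-3) dom' L_eq z'(1)] by blast
    have "(z - z') + (z' - z'') \<in> boundaries k K"
      using fn.subspace_add[OF sB z'(2)] boundaries_mono[OF K' K K'K] z''(2) by blast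
    then have "z - z'' \<in> boundaries k K" by simp
    then show "\<exists>z''\<in>rcycles X k L. z - z'' \<in> boundaries k K" using z''(1) by blast
  next
    fix z :: "'a list \<Rightarrow> 'f" assume z: "z \<in> rcycles X k L \<inter> boundaries k K"
    then have "z \<in> boundaries k K'" using IH(2) rcycles_mono[OF LK'] by blast
    then show "z \<in> boundaries k L"
      using boundary_without_vertex[OF K' rv(1-3) dom' L_eq] z by blast
  qed
qed

lemma pmodule_isomorphic_inclusion:
  fixes L K :: "real \<Rightarrow> 'a set set"
  assumes L: "filtration_on X L" and K: "filtration_on X K"
    and LK: "\<And>t. 0 \<le> t \<Longrightarrow> L t \<subseteq> K t"
    and surj: "\<And>t z. 0 \<le> t \<Longrightarrow> z \<in> rcycles X k (K t) \<Longrightarrow>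
      \<exists>z'\<in>rcycles X k (L t). z - z' \<in> (boundaries k (K t) :: ('a list \<Rightarrow> 'f::field) set)"
    and inj: "\<And>t z. 0 \<le> t \<Longrightarrow> z \<in> rcycles X k (L t) \<Longrightarrow> z \<in> boundaries k (K t) \<Longrightarrow>
      z \<in> (boundaries k (L t) :: ('a list \<Rightarrow> 'f) set)"
  shows "pmodule_isomorphic (filtration_module k L :: ('f, ('a list \<Rightarrow> 'f) set) pmodule)
      (filtration_module k K)"
proof -
  let ?FL = "filtration_module k L :: ('f, ('a list \<Rightarrow> 'f) set) pmodule"
  let ?FK = "filtration_module k K :: ('f, ('a list \<Rightarrow> 'f) set) pmodule"
  define \<phi> where "\<phi> t = (homology_map k id (L t) (K t) :: ('a list \<Rightarrow> 'f) set \<Rightarrow> ('a list \<Rightarrow> 'f)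
    set)" for t
  have \<phi>: "\<phi> t (z +o boundaries k (L t)) = z +o boundaries k (K t)"
    if "0 \<le> t" "z \<in> rcycles X k (L t)" for t z
    unfolding \<phi>_def by (rule homology_map_id[OF filtration_complex[OF L that(1)]
      filtration_complex[OF K that(1)] LK[OF that(1)] that(2)])
  have sub: "z \<in> rcycles X k (K t)" if "0 \<le> t" "z \<in> rcycles X k (L t)" for t and z :: "'a list \<Rightarrow> 'f"
    using rcycles_mono[OF LK[OF that(1)]] that(2) by blast
  have "linear_iso (pspace ?FL t) (pspace ?FK t) (\<phi> t)" if t: "0 \<le> t" for t
    unfolding linear_iso_def filtration_module_carrier[OF L t] filtration_module_carrier[OF K t]
  proof (intro conjI ballI allI)
    have sL: "fn.subspace (boundaries k (L t) :: ('a list \<Rightarrow> 'f) set)"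
      by (rule subspace_boundaries[OF filtration_complex[OF L t]])
    have sK: "fn.subspace (boundaries k (K t) :: ('a list \<Rightarrow> 'f) set)"
      by (rule subspace_boundaries[OF filtration_complex[OF K t]])
    show "bij_betw (\<phi> t) ((\<lambda>z. z +o boundaries k (L t)) ` rcycles X k (L t))
        ((\<lambda>z. z +o boundaries k (K t)) ` rcycles X k (K t))"
      unfolding bij_betw_def
    proof
      show "inj_on (\<phi> t) ((\<lambda>z. z +o boundaries k (L t)) ` rcycles X k (L t))"
      proof (rule inj_onI, elim imageE, simp only:)
        fix z z' assume z: "z \<in> rcycles X k (L t)" "z' \<in> rcycles X k (L t)"
          and eq: "\<phi> t (z +o boundaries k (L t)) = \<phi> t (z' +o boundaries k (L t))"
        have "z - z' \<in> boundaries k (K t)"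
          using eq coset_eq_iff[OF sK] unfolding \<phi>[OF t z(1)] \<phi>[OF t z(2)] by blast
        then have "z - z' \<in> boundaries k (L t)"
          using inj[OF t] fn.subspace_diff[OF subspace_rcycles z] by blast
        then show "z +o boundaries k (L t) = z' +o boundaries k (L t)"
          using coset_eq_iff[OF sL] by blast
      qed
      show "\<phi> t ` (\<lambda>z. z +o boundaries k (L t)) ` rcycles X k (L t) =
          (\<lambda>z. z +o boundaries k (K t)) ` rcycles X k (K t)"
      proof
        show "\<phi> t ` (\<lambda>z. z +o boundaries k (L t)) ` rcycles X k (L t)
            \<subseteq> (\<lambda>z. z +o boundaries k (K t)) ` rcycles X k (K t)"
          using \<phi>[OF t] sub[OF t] by auto
        show "(\<lambda>z. z +o boundaries k (K t)) ` rcycles X k (K t)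
            \<subseteq> \<phi> t ` (\<lambda>z. z +o boundaries k (L t)) ` rcycles X k (L t)"
        proof (rule image_subsetI)
          fix z :: "'a list \<Rightarrow> 'f" assume "z \<in> rcycles X k (K t)"
          then obtain z' where z': "z' \<in> rcycles X k (L t)" "z - z' \<in> boundaries k (K t)"
            using surj[OF t] by blast
          then have "z +o boundaries k (K t) = \<phi> t (z' +o boundaries k (L t))"
            using coset_eq_iff[OF sK] \<phi>[OF t] by blast
          then show "z +o boundaries k (K t) \<in> \<phi> t ` (\<lambda>z. z +o boundaries k (L t)) ` rcycles X k
            (L t)"
            using z'(1) by blast
        qed
      qed
    qed
    fix h :: "('a list \<Rightarrow> 'f) set" assume "h \<in> (\<lambda>z. z +o boundaries k (L t)) ` rcycles X k (L t)"
    then obtain z where z: "z \<in> rcycles X k (L t)" "h = z +o boundaries k (L t)" by blast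
    show "\<phi> t (vscale (pspace ?FL t) a h) = vscale (pspace ?FK t) a (\<phi> t h)" for a
      using fn.subspace_scale[OF subspace_rcycles z(1), of a]
      by (simp add: z \<phi>[OF t] filtration_module_scale[OF L t] filtration_module_scale[OF K t])
    fix h' :: "('a list \<Rightarrow> 'f) set" assume "h' \<in> (\<lambda>z. z +o boundaries k (L t)) ` rcycles X k (L t)"
    then obtain z' where z': "z' \<in> rcycles X k (L t)" "h' = z' +o boundaries k (L t)" by blast
    show "\<phi> t (vadd (pspace ?FL t) h h') = vadd (pspace ?FK t) (\<phi> t h) (\<phi> t h')"
      using fn.subspace_add[OF subspace_rcycles z(1) z'(1)]
      by (simp add: z z' \<phi>[OF t] filtration_module_add[OF L t] filtration_module_add[OF K t])
  qed
  moreover have "\<phi> t (pshift ?FL s t h) = pshift ?FK s t (\<phi> s h)"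
    if st: "0 \<le> s" "s \<le> t" and h: "h \<in> vcarrier (pspace ?FL s)" for s t h
  proof -
    obtain z where z: "z \<in> rcycles X k (L s)" "h = z +o boundaries k (L s)"
      using h unfolding filtration_module_carrier[OF L st(1)] by blast
    have "z \<in> rcycles X k (L t)" using filtration_rcycles_mono[OF L st] z(1) by blast
    then show ?thesis
      using st by (simp add: z(2) \<phi>[OF st(1) z(1)] \<phi> filtration_module_shift[OF L st z(1)]
          filtration_module_shift[OF K st sub[OF st(1) z(1)]])
  qed
  ultimately show ?thesis unfolding pmodule_isomorphic_def by blast
qed

section \<open>Stability of the barcode of a filtration\<close>

definition filtration_barcode ::
    "'f::field itself \<Rightarrow> nat \<Rightarrow> (real \<Rightarrow> 'a set set) \<Rightarrow> barcode" where
  "filtration_barcode F k K = abs_barcode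
     (image_mset (\<lambda>I. (Inf I, Sup I - Inf I))
       (intervals_of (filtration_module k K :: ('f, ('a list \<Rightarrow> 'f) set) pmodule)))"

definition birth :: "'a set \<Rightarrow> nat \<Rightarrow> (real \<Rightarrow> 'a set set) \<Rightarrow> ('a list \<Rightarrow> 'f::field) \<Rightarrow> real" where
  "birth X k K e = Inf {t. 0 \<le> t \<and> e \<in> rcycles X k (K t)}"

definition death :: "nat \<Rightarrow> (real \<Rightarrow> 'a set set) \<Rightarrow> ('a list \<Rightarrow> 'f::field) \<Rightarrow> real" where
  "death k K e = Inf {t. 0 \<le> t \<and> e \<in> boundaries k (K t)}"

definition bar_of :: "'a set \<Rightarrow> nat \<Rightarrow> (real \<Rightarrow> 'a set set) \<Rightarrow> ('a list \<Rightarrow> 'f::field) \<Rightarrow> bar" where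
  "bar_of X k K e = (birth X k K e, death k K e - birth X k K e)"

lemma bdd_below_times: "bdd_below {t::real. 0 \<le> t \<and> P t}"
  by (rule bdd_belowI[of _ 0]) auto

lemma full_simplex_cycle:
  assumes K: "filtration_on X K" and full: "reaches_full_simplex X K"
    and e: "e \<in> rcycles X k (Pow X - {{}})"
  shows "\<exists>t\<ge>0. e \<in> boundaries k (K t)"
proof -
  obtain T where "0 \<le> T" "K T = Pow X - {{}}" using full unfolding reaches_full_simplex_def by blast
  then show ?thesis using rcycles_full_simplex[OF filtration_finite[OF K]] e by (metis subsetD)
qed

lemma birth_death_bounds:
  assumes K: "filtration_on X K" and full: "reaches_full_simplex X K"
    and e: "e \<in> rcycles X k (Pow X - {{}})"
  shows "0 \<le> birth X k K e" "birth X k K e \<le> death k K e"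
proof -
  let ?Z = "{t. 0 \<le> t \<and> e \<in> rcycles X k (K t)}" and ?B = "{t. 0 \<le> t \<and> e \<in> boundaries k (K t)}"
  have ne: "?B \<noteq> {}" using full_simplex_cycle[OF K full e] by blast
  have sub: "?B \<subseteq> ?Z" using boundaries_subset_rcycles[OF filtration_complex[OF K]] by blast
  then show "birth X k K e \<le> death k K e"
    unfolding birth_def death_def by (intro cInf_superset_mono ne bdd_below_times)
  show "0 \<le> birth X k K e"
    unfolding birth_def using ne sub by (intro cInf_greatest) auto
qed

text \<open>
  Whatever the types of the endpoints of the two up-sets of times at which \<open>e\<close> is a cycle and a
  boundary, their difference has the two infima as its endpoints.
\<close>

lemma life_endpoints:
  assumes K: "filtration_on X K" and ne: "life X k K e \<noteq> {}" and full: "reaches_full_simplex X K"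
  shows "(Inf (life X k K e), Sup (life X k K e) - Inf (life X k K e)) = bar_of X k K e"
proof -
  let ?Z = "{t. 0 \<le> t \<and> e \<in> rcycles X k (K t)}" and ?B = "{t. 0 \<le> t \<and> e \<in> boundaries k (K t)}"
  let ?I = "life X k K e"
  have life: "?I = ?Z - ?B" unfolding life_def by blast
  obtain u where u: "u \<in> ?I" using ne by blast
  have "complex_on X (K u)" using u filtration_complex[OF K] unfolding life by blast
  then have "K u \<subseteq> Pow X - {{}}" unfolding complex_on_def by blast
  then have "e \<in> rcycles X k (Pow X - {{}})" using u rcycles_mono unfolding life by blast
  then have neB: "?B \<noteq> {}" using full_simplex_cycle[OF K full] by blast
  have upB: "t \<in> ?B" if "s \<in> ?B" "s \<le> t" for s t
    using that filtration_boundaries_mono[OF K, of s t k] by auto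
  have upZ: "t \<in> ?Z" if "s \<in> ?Z" "s \<le> t" for s t
    using that filtration_rcycles_mono[OF K, of s t k] by auto
  have IB: "t \<le> b" if "t \<in> ?I" "b \<in> ?B" for t b
    using upB[OF that(2), of t] that(1) unfolding life by fastforce
  have bddI: "bdd_below ?I" "bdd_above ?I"
  proof -
    show "bdd_below ?I" unfolding life by (rule bdd_below_mono[OF bdd_below_times Diff_subset])
    show "bdd_above ?I" using IB neB by (meson bdd_above.I ex_in_conv)
  qed
  have "Inf ?I = Inf ?Z"
  proof (rule antisym)
    show "Inf ?Z \<le> Inf ?I"
      by (rule cInf_superset_mono[OF ne bdd_below_times]) (auto simp: life)
    show "Inf ?I \<le> Inf ?Z"
    proof (rule cInf_greatest)
      show "?Z \<noteq> {}" using u unfolding life by blast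
      fix z assume z: "z \<in> ?Z"
      show "Inf ?I \<le> z"
      proof (cases "z \<in> ?B")
        case True
        then show ?thesis using IB[OF u True] cInf_lower[OF u bddI(1)] by linarith
      next
        case False
        then have "z \<in> ?I" using z unfolding life by blast
        then show ?thesis using bddI(1) by (rule cInf_lower)
      qed
    qed
  qed
  moreover have "Sup ?I = Inf ?B"
  proof (rule antisym)
    show "Sup ?I \<le> Inf ?B"
      by (intro cSup_least cInf_greatest ne neB IB)
    show "Inf ?B \<le> Sup ?I"
    proof (rule dense_le)
      fix x assume x: "x < Inf ?B"
      show "x \<le> Sup ?I"
      proof (cases "x \<le> u")
        case True
        then show ?thesis using cSup_upper[OF u bddI(2)] by linarith
      next
        case False
        then have "x \<in> ?Z" using upZ[of u x] u unfolding life by auto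
        moreover have "x \<notin> ?B" using x cInf_lower[OF _ bdd_below_times, of x] by fastforce
        ultimately have "x \<in> ?I" unfolding life by blast
        then show ?thesis using bddI(2) by (rule cSup_upper)
      qed
    qed
  qed
  ultimately show ?thesis unfolding bar_of_def birth_def death_def by simp
qed

lemma bar_of_empty_life:
  assumes K: "filtration_on X K" and "life X k K e = {}"
  shows "snd (bar_of X k K e) = 0"
proof -
  have "{t. 0 \<le> t \<and> e \<in> rcycles X k (K t)} = {t. 0 \<le> t \<and> e \<in> boundaries k (K t)}"
    using assms(2) boundaries_subset_rcycles[OF filtration_complex[OF K]] unfolding life_def by blast
  then show ?thesis by (simp add: bar_of_def birth_def death_def)
qed

text \<open>
  All basis elements that are cycles of the full simplex may be listed: those with empty life
  contribute a bar of length \<open>0\<close>, which does not affect the barcode. The list then depends on \<open>E\<close>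
  but not on the filtration, which is what makes bars of two filtrations matchable.
\<close>

lemma filtration_barcode_eq:
  fixes E :: "('a list \<Rightarrow> 'f::field) set"
  assumes K: "filtration_on X K" and full: "reaches_full_simplex X K"
    and E: "adapted_basis X k K E"
  defines "b \<equiv> image_mset (bar_of X k K) (mset_set (E \<inter> rcycles X k (Pow X - {{}})))"
  shows "filtration_barcode TYPE('f) k K = abs_barcode b" "valid_bars b"
proof -
  let ?E0 = "E \<inter> rcycles X k (Pow X - {{}})"
  let ?E1 = "{e \<in> E. life X k K e \<noteq> {}}"
  have finE: "finite E" using E unfolding adapted_basis_def by blast
  obtain es where es: "set es = ?E1" "distinct es"
    using finite_distinct_list[of ?E1] finE by auto
  have "interval_decomposition (filtration_module k K :: ('f, ('a list \<Rightarrow> 'f) set) pmodule) (map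
    (life X k K) es)"
    by (rule filtration_interval_decomposition[OF K full E es(2,1)])
  then have int: "intervals_of (filtration_module k K :: ('f, ('a list \<Rightarrow> 'f) set) pmodule)
    = mset (map (life X k K) es)"
    by (rule intervals_of_eq[OF closed_filtration_module[OF K]])
  have mset_es: "mset es = mset_set ?E1" using es by (metis mset_set_set)
  define c where "c = image_mset (bar_of X k K) (mset_set ?E1)"
  have "image_mset (\<lambda>I. (Inf I, Sup I - Inf I)) (mset (map (life X k K) es)) = c"
  proof -
    have "image_mset (\<lambda>I. (Inf I, Sup I - Inf I)) (mset (map (life X k K) es)) =
        image_mset (\<lambda>e. (Inf (life X k K e), Sup (life X k K e) - Inf (life X k K e))) (mset_set ?E1)"
      by (simp add: mset_es multiset.map_comp comp_def)
    also have "\<dots> = c"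
      unfolding c_def by (rule image_mset_cong) (use finE in \<open>auto simp: life_endpoints[OF K _ full]\<close>)
    finally show ?thesis .
  qed
  then have fb: "filtration_barcode TYPE('f) k K = abs_barcode c"
    unfolding filtration_barcode_def int by simp
  show valid: "valid_bars b"
    using birth_death_bounds[OF K full] finE unfolding b_def valid_bars_def by (auto simp: bar_of_def)
  have sub: "?E1 \<subseteq> ?E0"
  proof
    fix e assume "e \<in> ?E1"
    then obtain t where "e \<in> E" "0 \<le> t" "e \<in> rcycles X k (K t)" unfolding life_def by blast
    moreover have "K t \<subseteq> Pow X - {{}}" using filtration_complex[OF K \<open>0 \<le> t\<close>]
      unfolding complex_on_def by blast
    ultimately show "e \<in> ?E0" using rcycles_mono by blast
  qed
  have "mset_set ?E0 = mset_set ?E1 + mset_set (?E0 - ?E1)"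
    using finE sub by (subst mset_set_Union[symmetric]) (auto intro: arg_cong[of _ _ mset_set])
  then have split: "b = c + image_mset (bar_of X k K) (mset_set (?E0 - ?E1))"
    unfolding b_def c_def by simp
  have "filter_mset (\<lambda>p. snd p \<noteq> 0) (image_mset (bar_of X k K) (mset_set (?E0 - ?E1))) = {#}"
    using finE bar_of_empty_life[OF K] by (auto simp: filter_mset_eq_conv)
  then have "filter_mset (\<lambda>p. snd p \<noteq> 0) c = filter_mset (\<lambda>p. snd p \<noteq> 0) b"
    unfolding split by simp
  moreover have "valid_bars c" using valid unfolding split valid_bars_def by auto
  ultimately have "barcode_eq c b" using valid unfolding barcode_eq_def by simp
  then show "filtration_barcode TYPE('f) k K = abs_barcode b"
    unfolding fb using Quotient3_rel_abs[OF Quotient3_barcode] by blast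
qed

text \<open>
  Comparability makes the cycle spaces of both filtrations together a single chain of subspaces,
  and likewise the boundary spaces.
\<close>

lemma exists_common_adapted_basis:
  fixes K L :: "real \<Rightarrow> 'a set set"
  assumes K: "filtration_on X K" and L: "filtration_on X L"
    and comparable: "\<And>s t. 0 \<le> s \<Longrightarrow> 0 \<le> t \<Longrightarrow> K s \<subseteq> L t \<or> L t \<subseteq> K s"
  obtains E :: "('a list \<Rightarrow> 'f::field) set" where "adapted_basis X k K E" "adapted_basis X k L E"
proof -
  define \<C> where "\<C> = K ` {0..} \<union> L ` {0..}"
  have X: "finite X" using filtration_finite[OF K] .
  have co: "complex_on X C" if "C \<in> \<C>" for C
    using that filtration_complex[OF K] filtration_complex[OF L] unfolding \<C>_def by auto
  have chain: "C \<subseteq> D \<or> D \<subseteq> C" if "C \<in> \<C>" "D \<in> \<C>" for C D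
  proof -
    have mono: "K s \<subseteq> K t \<or> K t \<subseteq> K s" "L s \<subseteq> L t \<or> L t \<subseteq> L s" if "0 \<le> s" "0 \<le> t" for s t
      using filtration_mono[OF K, of s t] filtration_mono[OF K, of t s]
        filtration_mono[OF L, of s t] filtration_mono[OF L, of t s] that by linarith+
    consider s t where "0 \<le> s" "0 \<le> t" "C = K s" "D = K t" | s t where "0 \<le> s" "0
      \<le> t" "C = L s" "D = L t"
      | s t where "0 \<le> s" "0 \<le> t" "C = K s" "D = L t" | s t where "0 \<le> s" "0 \<le> t" "C = L s" "D = K t"
      using \<open>C \<in> \<C>\<close> \<open>D \<in> \<C>\<close> unfolding \<C>_def by auto
    then show ?thesis
    proof cases
      case (1 s t)
      then show ?thesis using mono(1)[of s t] by simp
    next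
      case (2 s t)
      then show ?thesis using mono(2)[of s t] by simp
    next
      case (3 s t)
      then show ?thesis using comparable[of s t] by simp
    next
      case (4 s t)
      then show ?thesis using comparable[of t s] by blast
    qed
  qed
  have "\<C> \<subseteq> Pow (Pow X)" using co unfolding complex_on_def by blast
  then have fin: "finite \<C>" by (rule finite_subset) (use X in simp)
  let ?S = "{xs. set xs \<subseteq> X \<and> length xs = Suc k}"
  have finS: "finite ?S" by (rule finite_lists_length_eq[OF X])
  have sp: "chains k C \<subseteq> fn.span (unit_vector ` ?S :: ('a list \<Rightarrow> 'f) set)" if "C \<in> \<C>" for C
    unfolding span_unit_vectors[OF finS]
  proof
    have C: "\<sigma> \<subseteq> X" if "\<sigma> \<in> C" for \<sigma> using co[OF \<open>C \<in> \<C>\<close>] that unfolding complex_on_def by blast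
    fix c :: "'a list \<Rightarrow> 'f" assume "c \<in> chains k C"
    then show "c \<in> supported_on ?S" unfolding chains_iff supported_on_def using C by blast
  qed
  obtain E :: "('a list \<Rightarrow> 'f) set" where E: "finite E" "fn.independent E"
    and span: "\<And>U. U \<in> rcycles X k ` \<C> \<union> boundaries k ` \<C> \<Longrightarrow> fn.span (E \<inter> U) = U"
  proof (rule fn.common_adapted_basis[of "rcycles X k ` \<C>" "boundaries k ` \<C>" "unit_vector ` ?S"])
    show "finite (rcycles X k ` \<C>)" "finite (boundaries k ` \<C>)" "finite (unit_vector ` ?S)"
      using fin finS by auto
    show "fn.subspace U \<and> U \<subseteq> fn.span (unit_vector ` ?S)"
      if "U \<in> rcycles X k ` \<C> \<union> boundaries k ` \<C>" for U :: "('a list \<Rightarrow> 'f) set"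
    proof -
      obtain C where C: "C \<in> \<C>" "U = rcycles X k C \<or> U = boundaries k C" using \<open>U \<in> _\<close> by blast
      then have "fn.subspace U" using subspace_rcycles subspace_boundaries[OF co[OF C(1)]] by blast
      moreover have "U \<subseteq> chains k C"
        using C(2) boundaries_subset_rcycles[OF co[OF C(1)]] unfolding rcycles_def by blast
      ultimately show ?thesis using sp[OF C(1)] by blast
    qed
    show "U \<subseteq> V \<or> V \<subseteq> U" if UV: "U \<in> rcycles X k ` \<C>" "V \<in> rcycles X k ` \<C>"
      for U V :: "('a list \<Rightarrow> 'f) set"
    proof -
      obtain C D where "C \<in> \<C>" "D \<in> \<C>" "U = rcycles X k C" "V = rcycles X k D" using UV by blast
      then show ?thesis using chain[of C D] rcycles_mono[of C D] rcycles_mono[of D C] by blast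
    qed
    show "U \<subseteq> V \<or> V \<subseteq> U" if UV: "U \<in> boundaries k ` \<C>" "V \<in> boundaries k ` \<C>"
      for U V :: "('a list \<Rightarrow> 'f) set"
    proof -
      obtain C D where "C \<in> \<C>" "D \<in> \<C>" "U = boundaries k C" "V = boundaries k D" using UV by blast
      then show ?thesis using chain[of C D] boundaries_mono[OF co co, of C D] boundaries_mono[OF
        co co, of D C] by blast
    qed
  qed blast
  have mem: "K t \<in> \<C>" "L t \<in> \<C>" if "0 \<le> t" for t using that unfolding \<C>_def by auto
  show thesis
  proof (rule that)
    show "adapted_basis X k K E" "adapted_basis X k L E"
      unfolding adapted_basis_def using E span mem by simp_all
  qed
qed

lemma Inf_le_Inf_plus:
  fixes A B :: "real set"
  assumes "A \<noteq> {}" "bdd_below B" and shift: "\<And>t d. t \<in> A \<Longrightarrow> \<delta> < d \<Longrightarrow> t + d \<in> B"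
  shows "Inf B \<le> Inf A + \<delta>"
proof -
  have "Inf B - \<delta> \<le> t" if "t \<in> A" for t
  proof -
    have "Inf B - t \<le> \<delta>"
      by (rule dense_ge) (use cInf_lower[OF shift[OF that] assms(2)] in \<open>auto simp: algebra_simps\<close>)
    then show ?thesis by simp
  qed
  then have "Inf B - \<delta> \<le> Inf A" by (intro cInf_greatest assms(1))
  then show ?thesis by simp
qed

text \<open>
  The bars of one basis element in the two filtrations are matched with each other. Requiring the
  inclusions only for shifts by more than \<open>\<delta>\<close> covers the case \<open>\<delta> = 0\<close> of filtrations that differ
  in whether simplices are present at their entry times, see \<open>filtration_barcode_stability\<close>.
\<close>

lemma filtration_barcode_dist_comparable:
  fixes K L :: "real \<Rightarrow> 'a set set"
  assumes K: "filtration_on X K" "reaches_full_simplex X K"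
    and L: "filtration_on X L" "reaches_full_simplex X L"
    and \<delta>: "0 \<le> \<delta>"
    and comparable: "\<And>s t. 0 \<le> s \<Longrightarrow> 0 \<le> t \<Longrightarrow> K s \<subseteq> L t \<or> L t \<subseteq> K s"
    and KL: "\<And>t d. 0 \<le> t \<Longrightarrow> \<delta> < d \<Longrightarrow> K t \<subseteq> L (t + d)"
    and LK: "\<And>t d. 0 \<le> t \<Longrightarrow> \<delta> < d \<Longrightarrow> L t \<subseteq> K (t + d)"
  shows "dist (filtration_barcode TYPE('f::field) k K) (filtration_barcode TYPE('f) k L) \<le> \<delta>"
proof -
  obtain E :: "('a list \<Rightarrow> 'f) set" where E: "adapted_basis X k K E" "adapted_basis X k L E"
    using exists_common_adapted_basis[OF K(1) L(1) comparable] by blast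
  let ?E0 = "E \<inter> rcycles X k (Pow X - {{}})"
  let ?b = "image_mset (bar_of X k K) (mset_set ?E0)"
    and ?c = "image_mset (bar_of X k L) (mset_set ?E0)"
  note b = filtration_barcode_eq[OF K E(1)] and c = filtration_barcode_eq[OF L E(2)]
  have le: "birth X k L e \<le> birth X k K e + \<delta> \<and> death k L e \<le> death k K e + \<delta>"
    if K: "filtration_on X K" "reaches_full_simplex X K"
      and L: "filtration_on X L"
      and KL: "\<And>t d. 0 \<le> t \<Longrightarrow> \<delta> < d \<Longrightarrow> K t \<subseteq> L (t + d)"
      and e: "e \<in> rcycles X k (Pow X - {{}})" for e :: "'a list \<Rightarrow> 'f" and K L :: "real \<Rightarrow> 'a set set"
  proof
    obtain u where u: "0 \<le> u" "e \<in> boundaries k (K u)" using full_simplex_cycle[OF K e] by blast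
    have Z: "rcycles X k (K t) \<subseteq> (rcycles X k (L (t + d)) :: ('a list \<Rightarrow> 'f) set)"
      if "0 \<le> t" "\<delta> < d" for t d
      by (rule rcycles_mono[OF KL[OF that]])
    have "e \<in> rcycles X k (K u)" using u boundaries_subset_rcycles[OF filtration_complex[OF K(1)]]
      by blast
    then show "birth X k L e \<le> birth X k K e + \<delta>"
      unfolding birth_def
      by (intro Inf_le_Inf_plus bdd_below_times) (use u \<delta> subsetD[OF Z] in auto)
    have "boundaries k (K t) \<subseteq> (boundaries k (L (t + d)) :: ('a list \<Rightarrow> 'f) set)"
      if "0 \<le> t" "\<delta> < d" for t d
      by (rule boundaries_mono[OF filtration_complex[OF K(1)] filtration_complex[OF L] KL]) (use
        that \<delta> in auto)
    then show "death k L e \<le> death k K e + \<delta>"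
      unfolding death_def
      by (intro Inf_le_Inf_plus bdd_below_times) (use u \<delta> in auto)
  qed
  have bar: "bar_dist (bar_of X k K e) (bar_of X k L e) \<le> \<delta>" if "e \<in> ?E0" for e
    using le[OF K L(1) KL, of e] le[OF L K(1) LK, of e] that
    unfolding bar_dist_def bar_of_def by (auto simp: abs_le_iff)
  have finE: "finite ?E0" using E(1) unfolding adapted_basis_def by blast
  have "rel_mset (\<lambda>p q. bar_dist p q \<le> \<delta>) ?b ?c"
    by (rule rel_msetI[of "image_mset (\<lambda>e. (bar_of X k K e, bar_of X k L e)) (mset_set ?E0)"])
      (use finE bar in \<open>auto simp: multiset.map_comp comp_def\<close>)
  then have "padded \<delta> ?b ?c"
    by (intro paddedI[where r = "{#}" and s = "{#}"]) auto
  then have "bottleneck ?b ?c \<le> \<delta>" using bottleneck_le_iff[OF b(2) c(2)] \<delta> by blast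
  moreover have "dist (abs_barcode ?b) (abs_barcode ?c) = bottleneck ?b ?c"
    by (rule dist_barcode.abs_eq) (use b(2) c(2) in \<open>auto simp: barcode_eq_def\<close>)
  ultimately show ?thesis unfolding b(1) c(1) by simp
qed

definition sublevel :: "'a set \<Rightarrow> ('a set \<Rightarrow> real) \<Rightarrow> real \<Rightarrow> 'a set set" where
  "sublevel X f t = {\<sigma> \<in> Pow X - {{}}. f \<sigma> \<le> t}"

text \<open>
  The possible families of entry times of the simplices on \<open>X\<close> into a filtration.
\<close>

definition monotone_simplex_function :: "'a set \<Rightarrow> ('a set \<Rightarrow> real) \<Rightarrow> bool" where
  "monotone_simplex_function X f \<longleftrightarrow>
     (\<forall>\<sigma>\<in>Pow X - {{}}. 0 \<le> f \<sigma> \<and> (\<forall>\<tau>\<in>Pow \<sigma> - {{}}. f \<tau> \<le> f \<sigma>))"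

lemma filtration_sublevel:
  assumes X: "finite X" and f: "monotone_simplex_function X f"
  shows "filtration_on X (sublevel X f)" "reaches_full_simplex X (sublevel X f)"
proof -
  have "complex_on X (sublevel X f t)" for t
    unfolding complex_on_def
  proof (intro conjI ballI allI impI)
    fix \<sigma> \<tau> assume "\<sigma> \<in> sublevel X f t" "\<tau> \<subseteq> \<sigma> \<and> \<tau> \<noteq> {}"
    moreover from this have "f \<tau> \<le> f \<sigma>" using f
      unfolding monotone_simplex_function_def sublevel_def by blast
    ultimately show "\<tau> \<in> sublevel X f t" unfolding sublevel_def by auto
  qed (use X in \<open>auto simp: sublevel_def\<close>)
  then show "filtration_on X (sublevel X f)" using X unfolding filtration_on_def
    by (auto simp: sublevel_def)
  define T where "T = Max (insert 0 (f ` (Pow X - {{}})))"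
  have "finite (insert 0 (f ` (Pow X - {{}})))" using X by simp
  then have "0 \<le> T" "\<And>\<sigma>. \<sigma> \<in> Pow X - {{}} \<Longrightarrow> f \<sigma> \<le> T" unfolding T_def by auto
  then show "reaches_full_simplex X (sublevel X f)"
    unfolding reaches_full_simplex_def sublevel_def by (intro exI[of _ T]) auto
qed

text \<open>
  Two sublevel sets can fail to be comparable only if \<open>f\<close> and \<open>g\<close> order two simplices in opposite
  ways.
\<close>

lemma sublevel_barcode_dist_same_order:
  assumes X: "finite X" and f: "monotone_simplex_function X f" and g: "monotone_simplex_function X g"
    and order: "\<And>\<sigma> \<tau>. \<sigma> \<in> Pow X - {{}} \<Longrightarrow> \<tau> \<in> Pow X - {{}} \<Longrightarrow> f \<sigma> < f \<tau> \<Longrightarrow> g \<sigma> \<le> g \<tau>"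
    and \<delta>: "0 \<le> \<delta>" "\<And>\<sigma>. \<sigma> \<in> Pow X - {{}} \<Longrightarrow> \<bar>f \<sigma> - g \<sigma>\<bar> \<le> \<delta>"
  shows "dist (filtration_barcode TYPE('f::field) k (sublevel X f)) (filtration_barcode TYPE('f) k
      (sublevel X g)) \<le> \<delta>"
proof (rule filtration_barcode_dist_comparable[OF filtration_sublevel[OF X f]
  filtration_sublevel[OF X g] \<delta>(1)])
  fix s t
  show "sublevel X f s \<subseteq> sublevel X g t \<or> sublevel X g t \<subseteq> sublevel X f s"
  proof (rule ccontr)
    assume "\<not> ?thesis"
    then obtain \<sigma> \<tau> where "\<sigma> \<in> sublevel X f s" "\<sigma> \<notin> sublevel X g t" "\<tau>
      \<in> sublevel X g t" "\<tau> \<notin> sublevel X f s"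
      by blast
    then have "\<sigma> \<in> Pow X - {{}}" "\<tau> \<in> Pow X - {{}}" "f \<sigma> < f \<tau>" "g \<tau> < g \<sigma>"
      unfolding sublevel_def by auto
    then show False using order[of \<sigma> \<tau>] by simp
  qed
next
  fix t d :: real assume d: "\<delta> < d"
  show "sublevel X f t \<subseteq> sublevel X g (t + d)"
  proof
    fix \<sigma> assume "\<sigma> \<in> sublevel X f t"
    then have "\<sigma> \<in> Pow X - {{}}" "f \<sigma> \<le> t" unfolding sublevel_def by blast+
    then show "\<sigma> \<in> sublevel X g (t + d)" using \<delta>(2)[of \<sigma>] d by (simp add: sublevel_def)
  qed
  show "sublevel X g t \<subseteq> sublevel X f (t + d)"
  proof
    fix \<sigma> assume "\<sigma> \<in> sublevel X g t"
    then have "\<sigma> \<in> Pow X - {{}}" "g \<sigma> \<le> t" unfolding sublevel_def by blast+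
    then show "\<sigma> \<in> sublevel X f (t + d)" using \<delta>(2)[of \<sigma>] d by (simp add: sublevel_def)
  qed
qed

text \<open>
  A strict inequality between two values at \<open>x\<close> persists near \<open>x\<close>, and there are finitely many of
  them.
\<close>

lemma eventually_same_order:
  fixes f g :: "'s \<Rightarrow> real"
  assumes S: "finite S"
  defines "h \<equiv> \<lambda>s \<sigma>. (1 - s) * f \<sigma> + s * g \<sigma>"
  shows "\<exists>d>0. \<forall>a. \<bar>a - x\<bar> < d \<longrightarrow> (\<forall>\<sigma>\<in>S. \<forall>\<tau>\<in>S. h x \<sigma> < h x \<tau> \<longrightarrow> h a \<sigma> \<le> h a \<tau>)"
proof -
  have "\<forall>\<^sub>F a in nhds x. h a \<sigma> \<le> h a \<tau>" if "h x \<sigma> < h x \<tau>" for \<sigma> \<tau>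
  proof -
    have "isCont (\<lambda>a. h a \<tau> - h a \<sigma>) x" unfolding h_def by (intro continuous_intros)
    then have "((\<lambda>a. h a \<tau> - h a \<sigma>) \<longlongrightarrow> h x \<tau> - h x \<sigma>) (nhds x)"
      by (simp add: continuous_at tendsto_nhds_iff)
    moreover have "0 < h x \<tau> - h x \<sigma>" using that by simp
    ultimately have "\<forall>\<^sub>F a in nhds x. 0 < h a \<tau> - h a \<sigma>" by (rule order_tendstoD)
    then show ?thesis by eventually_elim simp
  qed
  then have "\<forall>\<^sub>F a in nhds x. \<forall>\<sigma>\<in>S. \<forall>\<tau>\<in>S. h x \<sigma> < h x \<tau> \<longrightarrow> h a \<sigma> \<le> h a \<tau>"
    using S by (intro eventually_ball_finite ballI) (auto intro: eventually_mono)
  then show ?thesis unfolding eventually_nhds_metric dist_real_def by blast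
qed

text \<open>
  The distance of barcodes along the segment from \<open>f\<close> to \<open>g\<close> grows at most at rate \<open>\<delta>\<close> near each
  point, by \<open>sublevel_barcode_dist_same_order\<close>, and such local bounds add up by bisection of the
  parameter interval.
\<close>

lemma sublevel_barcode_dist:
  fixes f g :: "'a set \<Rightarrow> real"
  assumes X: "finite X" and f: "monotone_simplex_function X f" and g: "monotone_simplex_function X g"
    and \<delta>: "0 \<le> \<delta>" "\<And>\<sigma>. \<sigma> \<in> Pow X - {{}} \<Longrightarrow> \<bar>f \<sigma> - g \<sigma>\<bar> \<le> \<delta>"
  shows "dist (filtration_barcode TYPE('f::field) k (sublevel X f)) (filtration_barcode TYPE('f) k
      (sublevel X g)) \<le> \<delta>"
proof -
  define h where "h s \<sigma> = (1 - s) * f \<sigma> + s * g \<sigma>" for s \<sigma>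
  define B where "B s = filtration_barcode TYPE('f) k (sublevel X (h s))" for s
  have mono: "monotone_simplex_function X (h s)" if "0 \<le> s" "s \<le> 1" for s
    using f g that unfolding monotone_simplex_function_def h_def
    by (auto intro!: add_mono mult_left_mono add_nonneg_nonneg mult_nonneg_nonneg)
  have diff: "\<bar>h a \<sigma> - h x \<sigma>\<bar> \<le> \<delta> * \<bar>a - x\<bar>" if "\<sigma> \<in> Pow X - {{}}" for a x \<sigma>
  proof -
    have "h a \<sigma> - h x \<sigma> = (a - x) * (g \<sigma> - f \<sigma>)" unfolding h_def by (simp add: algebra_simps)
    then show ?thesis
      using mult_left_mono[OF \<delta>(2)[OF that], of "\<bar>a - x\<bar>"]
        by (simp add: abs_mult abs_minus_commute mult.commute)
  qed
  \<comment> \<open>The local premise of the rule concerns intervals that may leave \<open>[0, 1]\<close>, where \<open>h\<close> need not be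
    monotone; hence the guard.\<close>
  have "0 \<le> (0::real) \<and> (1::real) \<le> 1 \<longrightarrow> dist (B 0) (B 1) \<le> \<delta> * (1 - 0)"
  proof (rule Bolzano[where P = "\<lambda>a b. 0 \<le> a \<and> b \<le> 1 \<longrightarrow> dist (B a) (B b) \<le> \<delta> * (b - a)"])
    show "(0::real) \<le> 1" by simp
  next
    fix a b c :: real
    assume 1: "0 \<le> a \<and> b \<le> 1 \<longrightarrow> dist (B a) (B b) \<le> \<delta> * (b - a)"
      and 2: "0 \<le> b \<and> c \<le> 1 \<longrightarrow> dist (B b) (B c) \<le> \<delta> * (c - b)" and "a \<le> b" "b \<le> c"
    show "0 \<le> a \<and> c \<le> 1 \<longrightarrow> dist (B a) (B c) \<le> \<delta> * (c - a)"
    proof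
      assume "0 \<le> a \<and> c \<le> 1"
      then have "dist (B a) (B b) \<le> \<delta> * (b - a)" "dist (B b) (B c) \<le> \<delta> * (c - b)"
        using 1 2 \<open>a \<le> b\<close> \<open>b \<le> c\<close> by auto
      then show "dist (B a) (B c) \<le> \<delta> * (c - a)"
        using dist_triangle[of "B a" "B c" "B b"] by (simp add: algebra_simps)
    qed
  next
    fix x :: real assume x: "0 \<le> x" "x \<le> 1"
    obtain d where d: "d > 0"
      "\<And>a. \<bar>a - x\<bar> < d \<Longrightarrow> \<forall>\<sigma>\<in>Pow X - {{}}. \<forall>\<tau>\<in>Pow X - {{}}. h x \<sigma> < h x \<tau> \<longrightarrow> h a \<sigma> \<le> h a \<tau>"
      using eventually_same_order[of "Pow X - {{}}" x f g] X unfolding h_def by auto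
    have near: "dist (B x) (B a) \<le> \<delta> * \<bar>a - x\<bar>" if a: "0 \<le> a" "a \<le> 1" "\<bar>a - x\<bar> < d" for a
      unfolding B_def
    proof (rule sublevel_barcode_dist_same_order[OF X mono[OF x] mono[OF a(1,2)]])
      show "h a \<sigma> \<le> h a \<tau>" if "\<sigma> \<in> Pow X - {{}}" "\<tau> \<in> Pow X - {{}}" "h x \<sigma> < h x \<tau>" for \<sigma> \<tau>
        using d(2)[OF a(3)] that by blast
      show "\<bar>h x \<sigma> - h a \<sigma>\<bar> \<le> \<delta> * \<bar>a - x\<bar>" if "\<sigma> \<in> Pow X - {{}}" for \<sigma>
        using diff[OF that, of x a] by (simp add: abs_minus_commute)
    qed (use \<delta>(1) in simp)
    show "\<exists>d>0. \<forall>a b. a \<le> x \<and> x \<le> b \<and> b - a < d \<longrightarrow>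
        (0 \<le> a \<and> b \<le> 1 \<longrightarrow> dist (B a) (B b) \<le> \<delta> * (b - a))"
    proof (intro exI[of _ d] conjI d(1) allI impI)
      fix a b assume ab: "a \<le> x \<and> x \<le> b \<and> b - a < d" "0 \<le> a \<and> b \<le> 1"
      have "dist (B x) (B a) \<le> \<delta> * \<bar>a - x\<bar>" "dist (B x) (B b) \<le> \<delta> * \<bar>b - x\<bar>"
        using near[of a] near[of b] ab x by auto
      moreover have "\<bar>a - x\<bar> = x - a" "\<bar>b - x\<bar> = b - x" using ab by auto
      ultimately show "dist (B a) (B b) \<le> \<delta> * (b - a)"
        using dist_triangle2[of "B a" "B b" "B x"] by (simp add: dist_commute algebra_simps)
    qed
  qed
  moreover have "h 0 = f" "h 1 = g" unfolding h_def by auto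
  ultimately show ?thesis unfolding B_def by simp
qed

text \<open>
  Each filtration has the same barcode as the sublevel filtration of its entry times, and entry
  times of \<open>K\<close> and \<open>L\<close> differ by at most \<open>\<delta>\<close>.
\<close>

lemma filtration_barcode_stability:
  fixes K L :: "real \<Rightarrow> 'a set set"
  assumes K: "filtration_on X K" "reaches_full_simplex X K"
    and L: "filtration_on X L" "reaches_full_simplex X L"
    and \<delta>: "0 \<le> \<delta>"
    and KL: "\<And>t. 0 \<le> t \<Longrightarrow> K t \<subseteq> L (t + \<delta>)"
    and LK: "\<And>t. 0 \<le> t \<Longrightarrow> L t \<subseteq> K (t + \<delta>)"
  shows "dist (filtration_barcode TYPE('f::field) k K) (filtration_barcode TYPE('f) k L) \<le> \<delta>"
proof -
  have X: "finite X" by (rule filtration_finite[OF K(1)])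
  define entry where "entry M \<sigma> = Inf {t. 0 \<le> t \<and> \<sigma> \<in> M t}" for M :: "real \<Rightarrow> 'a set set" and \<sigma>
  have ne: "{t. 0 \<le> t \<and> \<sigma> \<in> M t} \<noteq> {}"
    if "reaches_full_simplex X M" "\<sigma> \<in> Pow X - {{}}" for M \<sigma>
    using that unfolding reaches_full_simplex_def by blast
  have entry_le: "entry M \<sigma> \<le> t" if "0 \<le> t" "\<sigma> \<in> M t" for M \<sigma> t
    unfolding entry_def using that by (intro cInf_lower bdd_below_times) auto
  have entry_less: "\<sigma> \<in> M t"
    if M: "filtration_on X M" "reaches_full_simplex X M" and \<sigma>: "\<sigma> \<in> Pow X - {{}}" "entry M \<sigma> < t"
      for M \<sigma> t
  proof -
    obtain s where "0 \<le> s" "\<sigma> \<in> M s" "s < t"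
      using cInf_lessD[OF ne[OF M(2) \<sigma>(1)]] \<sigma>(2) unfolding entry_def by blast
    then show ?thesis using filtration_mono[OF M(1), of s t] by auto
  qed
  have mono: "monotone_simplex_function X (entry M)"
    if M: "filtration_on X M" "reaches_full_simplex X M" for M
    unfolding monotone_simplex_function_def
  proof (intro ballI conjI)
    fix \<sigma> assume \<sigma>: "\<sigma> \<in> Pow X - {{}}"
    show "0 \<le> entry M \<sigma>" unfolding entry_def using ne[OF M(2) \<sigma>] by (intro cInf_greatest) auto
    fix \<tau> assume \<tau>: "\<tau> \<in> Pow \<sigma> - {{}}"
    have "{t. 0 \<le> t \<and> \<sigma> \<in> M t} \<subseteq> {t. 0 \<le> t \<and> \<tau> \<in> M t}"
      using filtration_complex[OF M(1)] \<tau> unfolding complex_on_def by blast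
    then show "entry M \<tau> \<le> entry M \<sigma>"
      unfolding entry_def by (rule cInf_superset_mono[OF ne[OF M(2) \<sigma>] bdd_below_times])
  qed
  \<comment> \<open>A simplex may or may not be present at its entry time, so \<open>M\<close> and the sublevel filtration of
    the entry times can differ, but only at single instants.\<close>
  have closure: "dist (filtration_barcode TYPE('f) k M) (filtration_barcode TYPE('f) k (sublevel X
    (entry M))) \<le> 0"
    if M: "filtration_on X M" "reaches_full_simplex X M" for M
  proof -
    have in_sub: "M s \<subseteq> sublevel X (entry M) t" if "0 \<le> s" "s \<le> t" for s t
    proof
      fix \<sigma> assume "\<sigma> \<in> M s"
      moreover have "M s \<subseteq> Pow X - {{}}" using filtration_complex[OF M(1) that(1)]
        unfolding complex_on_def by blast
      ultimately show "\<sigma> \<in> sublevel X (entry M) t"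
        using entry_le[OF that(1), of \<sigma> M] that(2) unfolding sublevel_def by auto
    qed
    have sub_in: "sublevel X (entry M) s \<subseteq> M t" if "s < t" for s t
    proof
      fix \<sigma> assume "\<sigma> \<in> sublevel X (entry M) s"
      then have "\<sigma> \<in> Pow X - {{}}" "entry M \<sigma> < t" using that unfolding sublevel_def by auto
      then show "\<sigma> \<in> M t" by (rule entry_less[OF M])
    qed
    show ?thesis
    proof (rule filtration_barcode_dist_comparable[OF M filtration_sublevel[OF X mono[OF M]]])
      show "M s \<subseteq> sublevel X (entry M) t \<or> sublevel X (entry M) t \<subseteq> M s" if "0 \<le> s" for s t
        using in_sub[OF that, of t] sub_in[of t s] by linarith
    qed (use in_sub sub_in in auto)
  qed
  have half: "entry L \<sigma> \<le> entry K \<sigma> + \<delta>"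
    if "reaches_full_simplex X K" "\<And>t. 0 \<le> t \<Longrightarrow> K t \<subseteq> L (t + \<delta>)" "\<sigma> \<in> Pow X - {{}}" for K L \<sigma>
  proof -
    have "entry L \<sigma> - \<delta> \<le> t" if t: "t \<in> {t. 0 \<le> t \<and> \<sigma> \<in> K t}" for t
      using entry_le[of "t + \<delta>" \<sigma> L] \<open>\<And>t. 0 \<le> t \<Longrightarrow> K t \<subseteq> L (t + \<delta>)\<close>[of t] t \<delta> by auto
    then have "entry L \<sigma> - \<delta> \<le> entry K \<sigma>"
      unfolding entry_def[of K] by (intro cInf_greatest ne that(1,3))
    then show ?thesis by simp
  qed
  have "dist (filtration_barcode TYPE('f) k (sublevel X (entry K)))
      (filtration_barcode TYPE('f) k (sublevel X (entry L))) \<le> \<delta>"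
  proof (rule sublevel_barcode_dist[OF X mono[OF K] mono[OF L] \<delta>])
    show "\<bar>entry K \<sigma> - entry L \<sigma>\<bar> \<le> \<delta>" if "\<sigma> \<in> Pow X - {{}}" for \<sigma>
      using half[OF K(2) KL that] half[OF L(2) LK that] by (simp add: abs_le_iff)
  qed
  then show ?thesis using closure[OF K] closure[OF L] by simp
qed

section \<open>Cech complexes of close sets and the theorem\<close>

lemma exists_interval_decomposition:
  fixes K :: "real \<Rightarrow> 'a set set"
  assumes K: "filtration_on X K" and full: "reaches_full_simplex X K"
  shows "\<exists>Is. interval_decomposition (filtration_module k K :: ('f::field, ('a list \<Rightarrow> 'f) set)
      pmodule) Is"
proof -
  have "K s \<subseteq> K t \<or> K t \<subseteq> K s" if "0 \<le> s" "0 \<le> t" for s t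
    using filtration_mono[OF K, of s t] filtration_mono[OF K, of t s] that by linarith
  then obtain E :: "('a list \<Rightarrow> 'f) set" where E: "adapted_basis X k K E"
    using exists_common_adapted_basis[OF K K] by metis
  have "finite {e \<in> E. life X k K e \<noteq> {}}" using E unfolding adapted_basis_def by simp
  from finite_distinct_list[OF this] obtain es
    where "set es = {e \<in> E. life X k K e \<noteq> {}}" "distinct es" by blast
  then show ?thesis using filtration_interval_decomposition[OF K full E] by blast
qed

lemma mem_cech: "\<sigma> \<in> cech t P \<longleftrightarrow> \<sigma> \<noteq> {} \<and> \<sigma> \<subseteq> P \<and> (\<exists>y. \<forall>x\<in>\<sigma>. dist x y \<le> t)"
proof -
  have "(\<Inter>x\<in>\<sigma>. cball x t) \<noteq> {} \<longleftrightarrow> (\<exists>y. \<forall>x\<in>\<sigma>. dist x y \<le> t)"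
    by (simp add: set_eq_iff)
  then show ?thesis unfolding cech_def by blast
qed

text \<open>
  Each vertex \<open>x\<close> of \<open>X\<close> acts as a copy of the point \<open>r x\<close> of \<open>P\<close>.
\<close>

definition pulled_back_cech :: "'a set \<Rightarrow> ('a \<Rightarrow> 'a) \<Rightarrow> 'a::metric_space set \<Rightarrow> real \<Rightarrow> 'a set set" where
  "pulled_back_cech X r P t = {\<sigma> \<in> Pow X - {{}}. r ` \<sigma> \<in> cech t P}"

lemma mem_pulled_back_cech:
  assumes "r ` X \<subseteq> P"
  shows "\<sigma> \<in> pulled_back_cech X r P t \<longleftrightarrow> \<sigma> \<subseteq> X \<and> \<sigma> \<noteq> {} \<and> (\<exists>y. \<forall>x\<in>\<sigma>. dist (r x) y \<le> t)"
  using assms unfolding pulled_back_cech_def mem_cech by blast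

lemma filtration_pulled_back_cech:
  assumes X: "finite X" and r: "r ` X \<subseteq> P"
  shows "filtration_on X (pulled_back_cech X r P)"
  unfolding filtration_on_def complex_on_def
proof (intro conjI allI impI ballI X)
  fix t \<sigma> \<tau> assume "\<sigma> \<in> pulled_back_cech X r P t" "\<tau> \<subseteq> \<sigma> \<and> \<tau> \<noteq> {}"
  then show "\<tau> \<in> pulled_back_cech X r P t" unfolding mem_pulled_back_cech[OF r] by blast
next
  fix s t :: real assume "0 \<le> s \<and> s \<le> t"
  then show "pulled_back_cech X r P s \<subseteq> pulled_back_cech X r P t"
    unfolding subset_iff mem_pulled_back_cech[OF r] by (meson order_trans)
qed (auto simp: pulled_back_cech_def)

text \<open>
  For large radii, the ball around every point of \<open>P\<close> contains one fixed point of the space.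
\<close>

lemma pulled_back_cech_reaches_full_simplex:
  assumes X: "finite X" and r: "r ` X \<subseteq> P"
  shows "reaches_full_simplex X (pulled_back_cech X r P)"
proof -
  obtain y :: 'a where True by blast
  define T where "T = (\<Sum>x\<in>X. dist (r x) y)"
  have T: "dist (r x) y \<le> T" if "x \<in> X" for x
    unfolding T_def by (rule member_le_sum[OF that]) (use X in auto)
  have "0 \<le> T" unfolding T_def by (simp add: sum_nonneg)
  moreover have "pulled_back_cech X r P T = Pow X - {{}}"
  proof (rule set_eqI)
    fix \<sigma>
    show "\<sigma> \<in> pulled_back_cech X r P T \<longleftrightarrow> \<sigma> \<in> Pow X - {{}}"
      unfolding mem_pulled_back_cech[OF r] using T by blast
  qed
  ultimately show ?thesis unfolding reaches_full_simplex_def by blast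
qed

text \<open>
  The vertices in \<open>X - P\<close> are dominated by their images in \<open>P\<close>, since \<open>x\<close> and \<open>r x\<close> are copies of
  the same point. Without them, the Cech complex of \<open>P\<close> is left.
\<close>

lemma barcode_map_eq_pulled_back:
  fixes P :: "'a::metric_space set"
  assumes X: "finite X" and P: "P \<subseteq> X" and r: "r ` X \<subseteq> P" and r_id: "\<And>x. x \<in> P \<Longrightarrow> r x = x"
  shows "barcode_map TYPE('f::field) k P = filtration_barcode TYPE('f) k (pulled_back_cech X r P)"
proof -
  let ?K = "pulled_back_cech X r P"
  have K: "filtration_on X ?K" "reaches_full_simplex X ?K"
    by (rule filtration_pulled_back_cech[OF X r], rule pulled_back_cech_reaches_full_simplex[OF X r])
  have cech: "filtration_on X (\<lambda>t. cech t P)"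
    unfolding filtration_on_def complex_on_def
  proof (intro conjI allI impI ballI X)
    fix t \<sigma> \<tau> assume "\<sigma> \<in> cech t P" "\<tau> \<subseteq> \<sigma> \<and> \<tau> \<noteq> {}"
    then show "\<tau> \<in> cech t P" unfolding mem_cech by blast
  next
    fix s t :: real assume "0 \<le> s \<and> s \<le> t"
    then show "cech s P \<subseteq> cech t P" unfolding subset_iff mem_cech by (meson order_trans)
  qed (use P in \<open>auto simp: cech_def\<close>)
  have restrict: "cech t P = {\<sigma> \<in> ?K t. \<sigma> \<inter> (X - P) = {}}" for t
  proof (rule set_eqI)
    fix \<sigma>
    have "(\<exists>y. \<forall>x\<in>\<sigma>. dist (r x) y \<le> t) \<longleftrightarrow> (\<exists>y. \<forall>x\<in>\<sigma>. dist x y \<le> t)" if "\<sigma> \<subseteq> P"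
      using that r_id by (metis subsetD)
    then show "\<sigma> \<in> cech t P \<longleftrightarrow> \<sigma> \<in> {\<sigma> \<in> ?K t. \<sigma> \<inter> (X - P) = {}}"
      unfolding mem_Collect_eq mem_cech mem_pulled_back_cech[OF r] using P by blast
  qed
  have compare: "(\<forall>z\<in>rcycles X k (?K t). \<exists>z'\<in>rcycles X k (cech t P). z - z'
    \<in> (boundaries k (?K t) :: ('a list \<Rightarrow> 'f) set)) \<and>
     rcycles X k (cech t P) \<inter> boundaries k (?K t) \<subseteq> (boundaries k (cech t P) :: ('a list \<Rightarrow> 'f) set)"
    if t: "0 \<le> t" for t
    unfolding restrict
  proof (rule remove_dominated_vertices[where r = r])
    show "finite (X - P)" using X by simp
    show "complex_on X (?K t)" by (rule filtration_complex[OF K(1) t])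
    show "v \<in> X \<and> r v \<in> X - (X - P)" if "v \<in> X - P" for v using that r P by blast
    show "insert (r v) \<sigma> \<in> ?K t" if "\<sigma> \<in> ?K t" "v \<in> \<sigma>" for \<sigma> v
    proof -
      have "v \<in> X" using that unfolding mem_pulled_back_cech[OF r] by blast
      then have "r v \<in> P" using r by blast
      then have "r v \<in> X" "r (r v) = r v" using P r_id by auto
      then show ?thesis using that unfolding mem_pulled_back_cech[OF r] by auto
    qed
  qed
  have iso: "pmodule_isomorphic (filtration_module k (\<lambda>t. cech t P) :: ('f, ('a list \<Rightarrow> 'f) set)
    pmodule) (filtration_module k ?K)"
  proof (rule pmodule_isomorphic_inclusion[OF cech K(1)])
    show "cech t P \<subseteq> ?K t" for t unfolding restrict by blast
  qed (use compare in blast)+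
  obtain Is where Is: "interval_decomposition (filtration_module k ?K :: ('f, ('a list \<Rightarrow> 'f) set)
    pmodule) Is"
    using exists_interval_decomposition[OF K] by blast
  have "intervals_of (PH k P :: ('f, ('a list \<Rightarrow> 'f) set) pmodule) = mset Is"
    unfolding PH_eq_filtration_module
    by (rule intervals_of_eq[OF closed_filtration_module[OF cech] interval_decomposition_trans[OF
      iso Is]])
  moreover have "intervals_of (filtration_module k ?K :: ('f, ('a list \<Rightarrow> 'f) set) pmodule) = mset Is"
    by (rule intervals_of_eq[OF closed_filtration_module[OF K(1)] Is])
  ultimately show ?thesis unfolding barcode_map_def filtration_barcode_def by simp
qed

text \<open>
  The two retractions of \<open>P \<union> Q\<close> move every point to positions at most \<open>\<delta>\<close> apart, so a common
  point of balls of radius \<open>t\<close> for one of them is a common point of balls of radius \<open>t + \<delta>\<close> for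
  the other.
\<close>

lemma barcode_map_dist_le:
  fixes P Q :: "'a::metric_space set"
  assumes fin: "finite P" "finite Q" and \<delta>: "0 \<le> \<delta>"
    and PQ: "\<And>p. p \<in> P \<Longrightarrow> \<exists>q\<in>Q. dist p q \<le> \<delta>" and QP: "\<And>q. q \<in> Q \<Longrightarrow> \<exists>p\<in>P. dist q p \<le> \<delta>"
  shows "dist (barcode_map TYPE('f::field) k P) (barcode_map TYPE('f) k Q) \<le> \<delta>"
proof -
  obtain f where f: "\<And>p. p \<in> P \<Longrightarrow> f p \<in> Q \<and> dist p (f p) \<le> \<delta>" using PQ by metis
  obtain g where g: "\<And>q. q \<in> Q \<Longrightarrow> g q \<in> P \<and> dist q (g q) \<le> \<delta>" using QP by metis
  define X where "X = P \<union> Q"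
  define r where "r x = (if x \<in> P then x else g x)" for x
  define r' where "r' x = (if x \<in> Q then x else f x)" for x
  have X: "finite X" "P \<subseteq> X" "Q \<subseteq> X" using fin unfolding X_def by auto
  have r: "r ` X \<subseteq> P" "r' ` X \<subseteq> Q" using f g unfolding X_def r_def r'_def by auto
  have close: "dist (r x) (r' x) \<le> \<delta>" if "x \<in> X" for x
    using that f[of x] g[of x] \<delta> unfolding X_def r_def r'_def by (auto simp: dist_commute)
  have sub: "pulled_back_cech X r P t \<subseteq> pulled_back_cech X r' Q (t + \<delta>)"
    if r: "r ` X \<subseteq> P" "r' ` X \<subseteq> Q" and close: "\<And>x. x \<in> X \<Longrightarrow> dist (r x) (r' x) \<le> \<delta>" for r r' P Q t
  proof
    fix \<sigma> assume "\<sigma> \<in> pulled_back_cech X r P t"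
    then obtain y where \<sigma>: "\<sigma> \<subseteq> X" "\<sigma> \<noteq> {}" and y: "\<And>x. x \<in> \<sigma> \<Longrightarrow> dist (r x) y \<le> t"
      unfolding mem_pulled_back_cech[OF r(1)] by blast
    have "dist (r' x) y \<le> t + \<delta>" if "x \<in> \<sigma>" for x
      using dist_triangle[of "r' x" y "r x"] close[of x] y[OF that] that \<sigma>(1)
        by (auto simp: dist_commute)
    then show "\<sigma> \<in> pulled_back_cech X r' Q (t + \<delta>)"
      using \<sigma> unfolding mem_pulled_back_cech[OF r(2)] by blast
  qed
  have "dist (filtration_barcode TYPE('f) k (pulled_back_cech X r P))
      (filtration_barcode TYPE('f) k (pulled_back_cech X r' Q)) \<le> \<delta>"
  proof (rule filtration_barcode_stability[OF _ _ _ _ \<delta>])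
    show "pulled_back_cech X r P t \<subseteq> pulled_back_cech X r' Q (t + \<delta>)" for t
      by (rule sub[OF r close])
    show "pulled_back_cech X r' Q t \<subseteq> pulled_back_cech X r P (t + \<delta>)" for t
      by (rule sub[OF r(2,1)]) (use close in \<open>simp add: dist_commute\<close>)
  qed (rule filtration_pulled_back_cech[OF X(1) r(1)] pulled_back_cech_reaches_full_simplex[OF
    X(1) r(1)]
      filtration_pulled_back_cech[OF X(1) r(2)] pulled_back_cech_reaches_full_simplex[OF X(1) r(2)])+
  moreover have "barcode_map TYPE('f) k P = filtration_barcode TYPE('f) k (pulled_back_cech X r P)"
    by (rule barcode_map_eq_pulled_back[OF X(1,2) r(1)]) (simp add: r_def)
  moreover have "barcode_map TYPE('f) k Q = filtration_barcode TYPE('f) k (pulled_back_cech X r' Q)"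
    by (rule barcode_map_eq_pulled_back[OF X(1,3) r(2)]) (simp add: r'_def)
  ultimately show ?thesis by simp
qed

lemma in_thickening_finite:
  assumes "finite B" "B \<noteq> {}" "x \<in> thickening B \<delta>"
  shows "\<exists>b\<in>B. dist x b \<le> \<delta>"
proof -
  have "infdist x B = Min ((\<lambda>b. dist x b) ` B)"
    unfolding infdist_notempty[OF assms(2)] using assms by (intro cInf_eq_Min) auto
  moreover have "Min ((\<lambda>b. dist x b) ` B) \<in> (\<lambda>b. dist x b) ` B" using assms by (intro Min_in) auto
  ultimately show ?thesis using assms(3) unfolding thickening_def by force
qed

lemma barcode_map_1_lipschitz:
  fixes P Q :: "'a::metric_space compacts"
  assumes "P \<in> finite_compacts" "Q \<in> finite_compacts"
  shows "dist (barcode_map TYPE('f::field) k (set_of_compact P)) (barcode_map TYPE('f) k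
      (set_of_compact Q)) \<le> dist P Q"
proof -
  let ?P = "set_of_compact P" and ?Q = "set_of_compact Q"
  have fin: "finite ?P" "finite ?Q" using assms unfolding finite_compacts_def by auto
  have cpt: "compact ?P" "?P \<noteq> {}" "compact ?Q" "?Q \<noteq> {}"
    using set_of_compact[of P] set_of_compact[of Q] by auto
  have "hausdorff_dist ?P ?Q \<le> dist P Q" by (simp add: dist_compacts.rep_eq)
  then have "?P \<subseteq> thickening ?Q (dist P Q)" "?Q \<subseteq> thickening ?P (dist P Q)"
    unfolding hausdorff_dist_le_iff[OF cpt] by auto
  then show ?thesis
    using fin cpt by (intro barcode_map_dist_le in_thickening_finite) auto
qed

text \<open>
  Finite nets approximate a compact set.
\<close>

lemma closure_finite_compacts: "closure finite_compacts = (UNIV :: 'a::metric_space compacts set)"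
proof -
  have "\<exists>P\<in>finite_compacts. dist P C < e" if e: "0 < e" for C :: "'a compacts" and e
  proof -
    let ?C = "set_of_compact C"
    have C: "compact ?C" "?C \<noteq> {}" using set_of_compact[of C] by auto
    obtain F where F: "finite F" "F \<subseteq> ?C" "?C \<subseteq> (\<Union>x\<in>F. ball x (e / 2))"
      using compactE_image[OF C(1), of ?C "\<lambda>x. ball x (e / 2)"] e
        by (metis (no_types, lifting) UN_I centre_in_ball half_gt_zero open_ball subsetI)
    have "F \<noteq> {}" using F C by auto
    then have set: "set_of_compact (Abs_compacts F) = F"
      using F by (intro Abs_compacts_inverse) (simp add: finite_imp_compact)
    have "infdist x F \<le> e / 2" if "x \<in> ?C" for x
    proof -
      obtain y where "y \<in> F" "dist y x < e / 2" using F(3) \<open>x \<in> ?C\<close> by auto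
      then show ?thesis using infdist_le[of y F x] by (simp add: dist_commute)
    qed
    moreover have "infdist x ?C \<le> e / 2" if "x \<in> F" for x
      using F(2) that e by auto
    ultimately have "0 \<le> e / 2 \<and> F \<subseteq> thickening ?C (e / 2) \<and> ?C \<subseteq> thickening F (e / 2)"
      using e by (auto simp: thickening_def)
    then have "hausdorff_dist F ?C \<le> e / 2"
      unfolding hausdorff_dist_le_iff[OF finite_imp_compact[OF F(1)] \<open>F \<noteq> {}\<close> C] .
    then have "dist (Abs_compacts F) C < e" using e by (simp add: dist_compacts.rep_eq set)
    moreover have "Abs_compacts F \<in> finite_compacts" using F(1) by (simp add: finite_compacts_def set)
    ultimately show ?thesis by blast
  qed
  then show ?thesis unfolding set_eq_iff closure_approachable by blast
qed

theorem proposition2p17: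
  fixes k :: nat
    and \<iota> :: "barcode \<Rightarrow> 'c::complete_space"
    and \<beta> :: "'a::metric_space compacts \<Rightarrow> 'c"
  assumes completion: "is_completion \<iota>"
    and \<beta>_def: "\<beta> = (\<lambda>P. \<iota> (barcode_map TYPE('f::field) k (set_of_compact P)))"
  shows "1-lipschitz_on finite_compacts \<beta> \<and>
    (\<exists>!g :: 'a compacts \<Rightarrow> 'c. continuous_on UNIV g \<and> (\<forall>P\<in>finite_compacts. g P = \<beta> P)) \<and>
    (\<forall>g :: 'a compacts \<Rightarrow> 'c. continuous_on UNIV g \<and> (\<forall>P\<in>finite_compacts. g P = \<beta> P)
       \<longrightarrow> 1-lipschitz_on UNIV g)"
proof -
  have iso: "dist (\<iota> x) (\<iota> y) = dist x y" for x y
    using completion unfolding is_completion_def by blast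
  have lip: "1-lipschitz_on finite_compacts \<beta>"
    by (rule lipschitz_onI) (simp_all add: \<beta>_def iso barcode_map_1_lipschitz)
  have ext_lip: "1-lipschitz_on UNIV g"
    if g: "continuous_on UNIV g" "\<forall>P\<in>finite_compacts. g P = \<beta> P" for g :: "'a compacts \<Rightarrow> 'c"
  proof -
    have "1-lipschitz_on finite_compacts g"
      using lip g(2) by (simp add: lipschitz_on_def)
    from lipschitz_on_closure[OF this] show ?thesis
      using g(1) unfolding closure_finite_compacts by blast
  qed
  obtain g :: "'a compacts \<Rightarrow> 'c" where g: "1-lipschitz_on UNIV g" "\<forall>P\<in>finite_compacts. g P = \<beta> P"
    using lipschitz_extend_closure[OF lip] unfolding closure_finite_compacts by blast
  have "\<exists>!g :: 'a compacts \<Rightarrow> 'c. continuous_on UNIV g \<and> (\<forall>P\<in>finite_compacts. g P = \<beta> P)"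
  proof (rule ex1I[of _ g])
    show "continuous_on UNIV g \<and> (\<forall>P\<in>finite_compacts. g P = \<beta> P)"
      using g lipschitz_on_continuous_on by blast
    fix h :: "'a compacts \<Rightarrow> 'c"
    assume h: "continuous_on UNIV h \<and> (\<forall>P\<in>finite_compacts. h P = \<beta> P)"
    have "closed {P. h P = g P}"
      using h lipschitz_on_continuous_on[OF g(1)] by (intro closed_Collect_eq) auto
    moreover have "finite_compacts \<subseteq> {P. h P = g P}" using h g(2) by auto
    ultimately have "closure finite_compacts \<subseteq> {P. h P = g P}" by (rule closure_minimal[rotated])
    then show "h = g" unfolding closure_finite_compacts by auto
  qed
  then show ?thesis using lip ext_lip by blast
qed

end
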